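(* Assume $\det R_1\neq 0$ and $\det R_2=0$. For every integer $k\ge0$, the bounded operator $$B_R^k:\mathring W^{k+2}(0,N+1)\to W^k(0,N+1),\qquad B_R^kv=-(R_Qv)'',$$ is Fredholm, $\dim\ker(B_R^k)=0$, and $\operatorname{codim}\operatorname{Im}(B_R^k)=2(k+1)$.
   Context: $N\ge1$ is a natural number and $b_j$ ($-N\le j\le N$) are real numbers. $W^k(a,b)$ is the $L_2$-based Sobolev space of order $k$ ($W^0=L_2$); $\mathring W^k(a,b)$ is the subspace of those $u\in W^k(a,b)$ with $u^{(\mu)}(a)=u^{(\mu)}(b)=0$ for $\mu=0,\dots,k-1$. The difference operator $R:L_2(\mathbb R)\to L_2(\mathbb R)$ is $(Rv)(t)=\sum_{j=-N}^N b_j v(t+j)$. Let $I_Q:L_2(0,N+1)\to L_2(\mathbb R)$ be extension by zero, $P_Q:L_2(\mathbb R)\to L_2(0,N+1)$ restriction to $(0,N+1)$, and $R_Q=P_QRI_Q:L_2(0,N+1)\to L_2(0,N+1)$ (it maps $\mathring W^{k}(0,N+1)$ continuously into $W^{k}(0,N+1)$). $R_1$ is the $(N+1)\times(N+1)$ matrix with entries $r_{ik}=b_{k-i}$ ($i,k=1,\dots,N+1$), and $R_2$ is the $N\times N$ matrix obtained from $R_1$ by deleting the last row and the last column. A bounded operator between Banach spaces is Fredholm if its kernel has finite dimension and its range is closed and of finite codimension. *)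

theory Defs
  imports "HOL-Analysis.Analysis" "Jordan_Normal_Form.Determinant"
begin

section \<open>Quotients of subspaces and Fredholm operators\<close>

locale ambient_vector_space = vector_space scale
  for scale :: "'a::field \<Rightarrow> 'b::ab_group_add \<Rightarrow> 'b"
begin

definition finite_dim :: "'b set \<Rightarrow> bool" where
  "finite_dim V \<longleftrightarrow> (\<exists>B. finite B \<and> V \<subseteq> span B)"

text \<open>The cosets of the elements of \<open>B\<close> are pairwise distinct and form a basis of \<open>V / U\<close>.\<close>

definition quotient_basis :: "'b set \<Rightarrow> 'b set \<Rightarrow> 'b set \<Rightarrow> bool" where
  "quotient_basis U V B \<longleftrightarrow>
     B \<subseteq> V \<and> independent B \<and> span B \<inter> U = {0} \<and> V \<subseteq> span (U \<union> B)"

definition finite_codim :: "'b set \<Rightarrow> 'b set \<Rightarrow> bool" where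
  "finite_codim U V \<longleftrightarrow> (\<exists>B. finite B \<and> quotient_basis U V B)"

text \<open>As for \<^const>\<open>dim\<close>, the value is only meaningful in the finite case.\<close>

definition codim :: "'b set \<Rightarrow> 'b set \<Rightarrow> nat" where
  "codim U V = card (SOME B. quotient_basis U V B)"

definition linear_between :: "'b set \<Rightarrow> 'b set \<Rightarrow> ('b \<Rightarrow> 'b) \<Rightarrow> bool" where
  "linear_between X Y T \<longleftrightarrow>
     T ` X \<subseteq> Y \<and>
     (\<forall>x\<in>X. \<forall>y\<in>X. T (x + y) = T x + T y) \<and>
     (\<forall>c. \<forall>x\<in>X. T (scale c x) = scale c (T x))"

text \<open>
  A Banach space is given by a subspace of the ambient vector space together with its own norm;
  an operator is a function on the ambient space of which only the values on \<open>X\<close> matter.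
\<close>

definition bounded_between ::
  "'b set \<Rightarrow> ('b \<Rightarrow> real) \<Rightarrow> 'b set \<Rightarrow> ('b \<Rightarrow> real) \<Rightarrow> ('b \<Rightarrow> 'b) \<Rightarrow> bool" where
  "bounded_between X normX Y normY T \<longleftrightarrow>
     linear_between X Y T \<and> (\<exists>C. \<forall>x\<in>X. normY (T x) \<le> C * normX x)"

definition kernel_on :: "'b set \<Rightarrow> ('b \<Rightarrow> 'b) \<Rightarrow> 'b set" where
  "kernel_on X T = {x \<in> X. T x = 0}"

definition norm_closed_in :: "'b set \<Rightarrow> 'b set \<Rightarrow> ('b \<Rightarrow> real) \<Rightarrow> bool" where
  "norm_closed_in Z Y normY \<longleftrightarrow>
     (\<forall>z y. (\<forall>n::nat. z n \<in> Z) \<and> y \<in> Y \<and> (\<lambda>n. normY (z n - y)) \<longlonglongrightarrow> 0 \<longrightarrow> y \<in> Z)"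

definition fredholm ::
  "'b set \<Rightarrow> ('b \<Rightarrow> real) \<Rightarrow> 'b set \<Rightarrow> ('b \<Rightarrow> real) \<Rightarrow> ('b \<Rightarrow> 'b) \<Rightarrow> bool" where
  "fredholm X normX Y normY T \<longleftrightarrow>
     bounded_between X normX Y normY T \<and>
     finite_dim (kernel_on X T) \<and>
     norm_closed_in (T ` X) Y normY \<and>
     finite_codim (T ` X) Y"

end

section \<open>The space of square integrable functions on the real line\<close>

text \<open>
  The sort \<open>{real_normed_field, euclidean_space}\<close> of the values is used to treat real-valued
  and complex-valued functions at the same time; linear structure and dimensions refer to the
  field of values.
\<close>

definition square_integrable :: "(real \<Rightarrow> 'a::{real_normed_field,euclidean_space}) \<Rightarrow> bool" where
  "square_integrable f \<longleftrightarrow>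
     f \<in> borel_measurable lborel \<and> integrable lborel (\<lambda>x. (norm (f x))\<^sup>2)"

lemma square_integrable_0: "square_integrable (\<lambda>x. 0)"
  by (simp add: square_integrable_def)

lemma square_integrable_add:
  assumes "square_integrable f" "square_integrable g"
  shows "square_integrable (\<lambda>x. f x + g x)"
proof -
  have [measurable]: "f \<in> borel_measurable lborel" "g \<in> borel_measurable lborel"
    using assms by (auto simp: square_integrable_def)
  have "integrable lborel (\<lambda>x. 2 * (norm (f x))\<^sup>2 + 2 * (norm (g x))\<^sup>2)"
    using assms by (auto simp: square_integrable_def)
  then have "integrable lborel (\<lambda>x. (norm (f x + g x))\<^sup>2)"
  proof (rule Bochner_Integration.integrable_bound)
    show "AE x in lborel. norm ((norm (f x + g x))\<^sup>2) \<le> norm (2 * (norm (f x))\<^sup>2 + 2 * (norm (g x))\<^sup>2)"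
    proof (rule AE_I2)
      fix x
      have "(norm (f x + g x))\<^sup>2 \<le> (norm (f x) + norm (g x))\<^sup>2"
        by (simp add: norm_triangle_ineq power_mono)
      also have "\<dots> \<le> 2 * (norm (f x))\<^sup>2 + 2 * (norm (g x))\<^sup>2"
        using sum_squares_bound[of "norm (f x)" "norm (g x)"] by (simp add: power2_sum)
      finally show "norm ((norm (f x + g x))\<^sup>2) \<le> norm (2 * (norm (f x))\<^sup>2 + 2 * (norm (g x))\<^sup>2)"
        by simp
    qed
  qed simp
  then show ?thesis by (simp add: square_integrable_def)
qed

lemma square_integrable_scale:
  assumes "square_integrable f"
  shows "square_integrable (\<lambda>x. c * f x)"
  using assms by (auto simp: square_integrable_def norm_mult power_mult_distrib)

lemma square_integrable_uminus:
  assumes "square_integrable f"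
  shows "square_integrable (\<lambda>x. - f x)"
  using assms by (auto simp: square_integrable_def)

lemma square_integrable_shift:
  assumes "square_integrable f"
  shows "square_integrable (\<lambda>x. f (x + h))"
  using assms lborel_integrable_real_affine[of "\<lambda>x. (norm (f x))\<^sup>2" 1 h]
  by (auto simp: square_integrable_def add.commute)

lemma square_integrable_restrict:
  assumes "square_integrable f"
  shows "square_integrable (\<lambda>x. indicator {a<..<b} x *\<^sub>R f x)"
proof -
  have [measurable]: "f \<in> borel_measurable lborel"
    using assms by (auto simp: square_integrable_def)
  have "integrable lborel (\<lambda>x. (norm (f x))\<^sup>2)"
    using assms by (auto simp: square_integrable_def)
  then have "integrable lborel (\<lambda>x. (norm (indicator {a<..<b} x *\<^sub>R f x))\<^sup>2)"
    by (rule Bochner_Integration.integrable_bound) (auto split: split_indicator)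
  then show ?thesis by (simp add: square_integrable_def)
qed

definition l2_rel ::
  "(real \<Rightarrow> 'a::{real_normed_field,euclidean_space}) \<Rightarrow> (real \<Rightarrow> 'a) \<Rightarrow> bool" where
  "l2_rel f g \<longleftrightarrow> square_integrable f \<and> square_integrable g \<and> (AE x in lborel. f x = g x)"

quotient_type (overloaded) 'a L2 =
  "real \<Rightarrow> 'a::{real_normed_field,euclidean_space}" / partial: l2_rel
proof (rule part_equivpI)
  show "\<exists>f. l2_rel f f"
    by (rule exI[of _ "\<lambda>x. 0"]) (simp add: l2_rel_def square_integrable_0)
  show "symp l2_rel"
    by (auto intro!: sympI simp: l2_rel_def elim: AE_mp)
  show "transp l2_rel"
    by (rule transpI) (auto simp: l2_rel_def elim: AE_mp)
qed

instantiation L2 :: ("{real_normed_field,euclidean_space}") ab_group_add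
begin

lift_definition zero_L2 :: "'a L2" is "\<lambda>x. 0"
  by (simp add: l2_rel_def square_integrable_0)

lift_definition plus_L2 :: "'a L2 \<Rightarrow> 'a L2 \<Rightarrow> 'a L2" is "\<lambda>f g x. f x + g x"
  by (auto simp: l2_rel_def square_integrable_add)

lift_definition uminus_L2 :: "'a L2 \<Rightarrow> 'a L2" is "\<lambda>f x. - f x"
  by (auto simp: l2_rel_def square_integrable_uminus)

definition minus_L2 :: "'a L2 \<Rightarrow> 'a L2 \<Rightarrow> 'a L2" where
  "minus_L2 u v = u + - v"

instance
proof
  fix u v w :: "'a L2"
  show "u + v + w = u + (v + w)"
    by transfer (auto simp: l2_rel_def square_integrable_add algebra_simps)
  show "u + v = v + u"
    by transfer (auto simp: l2_rel_def square_integrable_add algebra_simps)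
  show "0 + u = u"
    by transfer (auto simp: l2_rel_def)
  show "- u + u = 0"
    by transfer (auto simp: l2_rel_def square_integrable_0)
  show "u - v = u + - v"
    by (rule minus_L2_def)
qed

end

lift_definition l2_scale :: "'a::{real_normed_field,euclidean_space} \<Rightarrow> 'a L2 \<Rightarrow> 'a L2"
  is "\<lambda>c f x. c * f x"
  by (auto simp: l2_rel_def square_integrable_scale)

global_interpretation l2: ambient_vector_space l2_scale
proof
  fix c d :: "'a::{real_normed_field,euclidean_space}" and u v :: "'a L2"
  show "l2_scale c (u + v) = l2_scale c u + l2_scale c v"
    by transfer
      (auto simp: l2_rel_def square_integrable_add square_integrable_scale algebra_simps)
  show "l2_scale (c + d) u = l2_scale c u + l2_scale d u"
    by transfer
      (auto simp: l2_rel_def square_integrable_add square_integrable_scale distrib_right)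
  show "l2_scale c (l2_scale d u) = l2_scale (c * d) u"
    by transfer (auto simp: l2_rel_def square_integrable_scale mult.assoc)
  show "l2_scale 1 u = u"
    by transfer (auto simp: l2_rel_def)
qed

lift_definition l2_norm :: "'a::{real_normed_field,euclidean_space} L2 \<Rightarrow> real"
  is "\<lambda>f. sqrt (\<integral>x. (norm (f x))\<^sup>2 \<partial>lborel)"
proof -
  fix f g :: "real \<Rightarrow> 'a"
  assume "l2_rel f g"
  then have "(\<integral>x. (norm (f x))\<^sup>2 \<partial>lborel) = (\<integral>x. (norm (g x))\<^sup>2 \<partial>lborel)"
    by (intro integral_cong_AE) (auto simp: l2_rel_def square_integrable_def)
  then show "sqrt (\<integral>x. (norm (f x))\<^sup>2 \<partial>lborel) = sqrt (\<integral>x. (norm (g x))\<^sup>2 \<partial>lborel)"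
    by simp
qed

lift_definition l2_shift :: "real \<Rightarrow> 'a::{real_normed_field,euclidean_space} L2 \<Rightarrow> 'a L2"
  is "\<lambda>h f t. f (t + h)"
proof -
  fix h and f g :: "real \<Rightarrow> 'a"
  assume *: "l2_rel f g"
  then have [measurable]: "f \<in> borel_measurable borel" "g \<in> borel_measurable borel"
    by (auto simp: l2_rel_def square_integrable_def)
  have "AE x in lborel. f (h + 1 * x) = g (h + 1 * x)"
    by (rule AE_borel_affine) (use * in \<open>auto simp: l2_rel_def\<close>)
  then show "l2_rel (\<lambda>t. f (t + h)) (\<lambda>t. g (t + h))"
    using * by (simp add: l2_rel_def square_integrable_shift add.commute)
qed

lift_definition l2_restrict ::
    "real \<Rightarrow> real \<Rightarrow> 'a::{real_normed_field,euclidean_space} L2 \<Rightarrow> 'a L2"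
  is "\<lambda>a b f t. indicator {a<..<b} t *\<^sub>R f t"
  by (auto simp: l2_rel_def square_integrable_restrict)

text \<open>
  \<open>L\<^sub>2(a,b)\<close> is identified with its image under extension by zero. With this identification
  \<^const>\<open>l2_restrict\<close> is the restriction operator and extension by zero is the inclusion.
\<close>

definition L2_on :: "real \<Rightarrow> real \<Rightarrow> 'a::{real_normed_field,euclidean_space} L2 set" where
  "L2_on a b = {u. l2_restrict a b u = u}"

section \<open>Sobolev spaces on an interval\<close>

definition test_functions :: "real \<Rightarrow> real \<Rightarrow> (real \<Rightarrow> real) set" where
  "test_functions a b =
     {\<phi>. (\<forall>m x. (deriv ^^ m) \<phi> differentiable at x) \<and>
         (\<exists>K. compact K \<and> K \<subseteq> {a<..<b} \<and> (\<forall>x. x \<notin> K \<longrightarrow> \<phi> x = 0))}"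

lemma test_function_deriv_measurable:
  assumes "\<phi> \<in> test_functions a b"
  shows "(deriv ^^ m) \<phi> \<in> borel_measurable borel"
proof (rule borel_measurable_continuous_onI)
  show "continuous_on UNIV ((deriv ^^ m) \<phi>)"
    using assms
    by (auto simp: test_functions_def continuous_on_eq_continuous_at
        intro!: differentiable_imp_continuous_within)
qed

text \<open>\<open>is_weak_deriv a b m u g\<close>: on \<open>(a,b)\<close>, \<open>g\<close> is the \<open>m\<close>-th weak derivative of \<open>u\<close>.\<close>

lift_definition is_weak_deriv ::
    "real \<Rightarrow> real \<Rightarrow> nat \<Rightarrow> 'a::{real_normed_field,euclidean_space} L2 \<Rightarrow> 'a L2 \<Rightarrow> bool"
  is "\<lambda>a b m f g. \<forall>\<phi>\<in>test_functions a b.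
        (LINT x:{a<..<b}|lborel. (deriv ^^ m) \<phi> x *\<^sub>R f x) =
        (- 1) ^ m *\<^sub>R (LINT x:{a<..<b}|lborel. \<phi> x *\<^sub>R g x)"
proof -
  fix a b :: real and m :: nat and f f' g g' :: "real \<Rightarrow> 'a"
  assume f: "l2_rel f f'" and g: "l2_rel g g'"
  have eq: "(LINT x:{a<..<b}|lborel. (deriv ^^ n) \<phi> x *\<^sub>R u x) =
      (LINT x:{a<..<b}|lborel. (deriv ^^ n) \<phi> x *\<^sub>R u' x)"
    if "l2_rel u u'" "\<phi> \<in> test_functions a b" for n \<phi> and u u' :: "real \<Rightarrow> 'a"
  proof -
    have [measurable]: "u \<in> borel_measurable borel" "u' \<in> borel_measurable borel"
      "(deriv ^^ n) \<phi> \<in> borel_measurable borel"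
      using that test_function_deriv_measurable by (auto simp: l2_rel_def square_integrable_def)
    have "AE x in lborel. u x = u' x"
      using that by (simp add: l2_rel_def)
    then show ?thesis
      unfolding set_lebesgue_integral_def by (intro integral_cong_AE) auto
  qed
  show "(\<forall>\<phi>\<in>test_functions a b.
        (LINT x:{a<..<b}|lborel. (deriv ^^ m) \<phi> x *\<^sub>R f x) =
        (- 1) ^ m *\<^sub>R (LINT x:{a<..<b}|lborel. \<phi> x *\<^sub>R g x)) =
    (\<forall>\<phi>\<in>test_functions a b.
        (LINT x:{a<..<b}|lborel. (deriv ^^ m) \<phi> x *\<^sub>R f' x) =
        (- 1) ^ m *\<^sub>R (LINT x:{a<..<b}|lborel. \<phi> x *\<^sub>R g' x))"
    using eq[OF f, of _ m] eq[OF g, of _ 0] by simp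
qed

definition sobolev :: "nat \<Rightarrow> real \<Rightarrow> real \<Rightarrow> 'a::{real_normed_field,euclidean_space} L2 set" where
  "sobolev k a b = {u \<in> L2_on a b. \<forall>m\<le>k. \<exists>g\<in>L2_on a b. is_weak_deriv a b m u g}"

definition weak_deriv ::
  "real \<Rightarrow> real \<Rightarrow> nat \<Rightarrow> 'a::{real_normed_field,euclidean_space} L2 \<Rightarrow> 'a L2" where
  "weak_deriv a b m u = (THE g. g \<in> L2_on a b \<and> is_weak_deriv a b m u g)"

definition sobolev_norm ::
  "nat \<Rightarrow> real \<Rightarrow> real \<Rightarrow> 'a::{real_normed_field,euclidean_space} L2 \<Rightarrow> real" where
  "sobolev_norm k a b u = sqrt (\<Sum>m\<le>k. (l2_norm (weak_deriv a b m u))\<^sup>2)"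

text \<open>
  Boundary values are those of the representative that is continuous on the closed interval
  (it exists for every element of the Sobolev space of order 1, and it is unique for \<open>a < b\<close>).
\<close>

lift_definition is_continuous_rep ::
    "real \<Rightarrow> real \<Rightarrow> 'a::{real_normed_field,euclidean_space} L2 \<Rightarrow> (real \<Rightarrow> 'a) \<Rightarrow> bool"
  is "\<lambda>a b f h. continuous_on {a..b} h \<and> (AE x in lborel. x \<in> {a<..<b} \<longrightarrow> f x = h x)"
  by (auto simp: l2_rel_def fun_eq_iff elim!: AE_mp intro: AE_I2)

definition vanishes_at_ends ::
  "real \<Rightarrow> real \<Rightarrow> 'a::{real_normed_field,euclidean_space} L2 \<Rightarrow> bool" where
  "vanishes_at_ends a b u \<longleftrightarrow> (\<exists>h. is_continuous_rep a b u h \<and> h a = 0 \<and> h b = 0)"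

definition sobolev0 :: "nat \<Rightarrow> real \<Rightarrow> real \<Rightarrow> 'a::{real_normed_field,euclidean_space} L2 set" where
  "sobolev0 k a b = {u \<in> sobolev k a b. \<forall>\<mu><k. vanishes_at_ends a b (weak_deriv a b \<mu> u)}"

section \<open>The difference operator\<close>

definition diff_op ::
  "nat \<Rightarrow> (int \<Rightarrow> real) \<Rightarrow> 'a::{real_normed_field,euclidean_space} L2 \<Rightarrow> 'a L2" where
  "diff_op N b v = (\<Sum>j\<in>{- int N..int N}. l2_scale (of_real (b j)) (l2_shift (of_int j) v))"

definition R_Q ::
  "nat \<Rightarrow> (int \<Rightarrow> real) \<Rightarrow> 'a::{real_normed_field,euclidean_space} L2 \<Rightarrow> 'a L2" where
  "R_Q N b v = l2_restrict 0 (real N + 1) (diff_op N b v)"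

definition B_R ::
  "nat \<Rightarrow> (int \<Rightarrow> real) \<Rightarrow> 'a::{real_normed_field,euclidean_space} L2 \<Rightarrow> 'a L2" where
  "B_R N b v = - weak_deriv 0 (real N + 1) 2 (R_Q N b v)"

text \<open>Rows and columns are numbered from 0 here, which does not affect the difference \<open>k - i\<close>.\<close>

definition R_1 :: "nat \<Rightarrow> (int \<Rightarrow> real) \<Rightarrow> real mat" where
  "R_1 N b = mat (N + 1) (N + 1) (\<lambda>(i, k). b (int k - int i))"

definition R_2 :: "nat \<Rightarrow> (int \<Rightarrow> real) \<Rightarrow> real mat" where
  "R_2 N b = mat_delete (R_1 N b) N N"

end

theory Submission
  imports Defs
begin

text \<open>
  For \<open>z\<close> in \<open>L\<^sub>2(a,b)\<close> let \<open>J z\<close> be its primitive that vanishes at \<open>a\<close>, and let \<open>I z\<close> be its integral.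
  Then \<open>W\<^sup>k\<^sup>+\<^sup>1\<close> consists of the functions \<open>J z + c\<close> with \<open>z \<in> W\<^sup>k\<close>, and the functions of \<open>W\<^sup>k\<^sup>+\<^sup>1\<close>
  with vanishing boundary values are the \<open>J z\<close> with \<open>z\<close> in the corresponding subspace of \<open>W\<^sup>k\<close> and
  \<open>I z = 0\<close>. Since extension by zero commutes with differentiation for functions that vanish at the ends,
  \<open>(R\<^sub>Q v)'' = R\<^sub>Q v''\<close>. Hence the image of \<open>B\<^sub>R\<close> is \<open>R\<^sub>Q\<close> applied to the \<open>z\<close> of order \<open>k\<close> with vanishing
  boundary values and \<open>I z = I (J z) = 0\<close>. As \<open>R\<^sub>1\<close> is invertible, so is \<open>R\<^sub>Q\<close> on \<open>L\<^sub>2\<close>. Raising the order by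
  one raises the codimension of the image of \<open>R\<^sub>Q\<close> by two, once for the condition \<open>I z = 0\<close> and once
  for the constants, which gives \<open>2 k\<close>; the conditions \<open>I z = 0\<close> and \<open>I (J z) = 0\<close> contribute two more.
\<close>

section \<open>Codimension of subspaces\<close>

text \<open>The obstacle is that \<open>R_Q\<close> does not preserve the boundary conditions:
  \<open>R_Q v\<close> has nonzero boundary values in general, and the inverse of \<open>R_Q\<close>
  is under control only in \<open>L2\<close>. Every statement about order \<open>k\<close> is
  therefore an induction that peels off one primitive at a time, and only one thing about
  derivatives is asked of \<open>R_Q\<close>: that it commutes with primitives of mean-zero
  functions up to a constant. The constant arises because the zero extension of such a primitive is
  a primitive on the whole line, and a shift changes its value at the left end of the interval. The
  two dimensions gained per order rest on different facts. The condition \<open>I z = 0\<close> is a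
  proper restriction because test functions of integral one satisfy all boundary conditions. The
  constants stay outside the image because \<open>R_Q\<close> is injective. Closedness of the range
  is proved with sequences: the preimages converge in \<open>L2\<close> since the inverse is bounded
  there, and the conditions \<open>I z = 0\<close> and \<open>I (J z) = 0\<close> are continuous in
  that norm.\<close>

context ambient_vector_space
begin

lemma quotient_basis_trivial_Int:
  "quotient_basis U V B \<Longrightarrow> x \<in> span B \<Longrightarrow> x \<in> U \<Longrightarrow> x = 0"
  by (auto simp: quotient_basis_def)

text \<open>\<open>codim\<close> measures an arbitrary quotient basis, so two of them must be
  compared. Modulo \<open>U\<close> each element \<open>x\<close> of \<open>B'\<close> can be
  replaced by a component \<open>p x\<close> in \<open>span B\<close>; a linear relation among the
  \<open>p x\<close> puts the same combination of the \<open>x\<close> into \<open>U\<close>, hence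
  it is trivial, and the exchange bound in \<open>span B\<close> applies.\<close>

lemma quotient_basis_card_le:
  assumes U: "subspace U" and B: "finite B" "quotient_basis U V B" and B': "quotient_basis U V B'"
  shows "finite B' \<and> card B' \<le> card B"
proof -
  have "\<exists>y\<in>span B. x - y \<in> U" if "x \<in> B'" for x
  proof -
    have "x \<in> span (U \<union> B)"
      using that B B' by (auto simp: quotient_basis_def)
    then obtain u y where "x = u + y" "u \<in> span U" "y \<in> span B"
      unfolding span_Un by auto
    then show ?thesis
      using U by (intro bexI[of _ y]) (auto simp: span_eq_iff[THEN iffD2])
  qed
  then have "\<forall>x\<in>B'. \<exists>y. y \<in> span B \<and> x - y \<in> U"
    by blast
  from bchoice[OF this] obtain p where p: "p x \<in> span B" "x - p x \<in> U" if "x \<in> B'" for x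
    by blast
  have inj: "inj_on p B'"
  proof (rule inj_onI)
    fix x y assume xy: "x \<in> B'" "y \<in> B'" "p x = p y"
    have "(x - p x) - (y - p y) \<in> U"
      using U p(2)[OF xy(1)] p(2)[OF xy(2)] by (rule subspace_diff)
    then have "x - y \<in> U"
      using xy by simp
    moreover have "x - y \<in> span B'"
      using xy by (intro span_diff span_base)
    ultimately have "x - y = 0"
      using quotient_basis_trivial_Int[OF B'] by blast
    then show "x = y"
      by simp
  qed
  have "independent (p ` B')"
    unfolding independent_explicit_finite_subsets
  proof (intro allI impI ballI)
    fix S u v
    assume S: "S \<subseteq> p ` B'" "finite S" and sum0: "(\<Sum>v\<in>S. scale (u v) v) = 0" and "v \<in> S"
    obtain S' where S': "S' \<subseteq> B'" "finite S'" "S = p ` S'"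
      using S finite_subset_image by metis
    then have "inj_on p S'"
      using inj inj_on_subset by blast
    then have "(\<Sum>x\<in>S'. scale (u (p x)) (p x)) = 0"
      using sum0 by (simp add: S' sum.reindex)
    then have "(\<Sum>x\<in>S'. scale (u (p x)) x) = (\<Sum>x\<in>S'. scale (u (p x)) (x - p x))"
      by (simp add: scale_right_diff_distrib sum_subtractf)
    also have "\<dots> \<in> U"
      using S' p U by (intro subspace_sum subspace_scale) auto
    finally have "(\<Sum>x\<in>S'. scale (u (p x)) x) \<in> U" .
    moreover have "(\<Sum>x\<in>S'. scale (u (p x)) x) \<in> span B'"
      using S' by (intro span_sum span_scale span_base) auto
    ultimately have "(\<Sum>x\<in>S'. scale (u (p x)) x) = 0"
      using B' by (auto simp: quotient_basis_def)
    then have "u (p x) = 0" if "x \<in> S'" for x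
      using independentD[of B' S' "\<lambda>x. u (p x)"] B' S' that by (auto simp: quotient_basis_def)
    then show "u v = 0"
      using \<open>v \<in> S\<close> S' by auto
  qed
  then have "finite (p ` B') \<and> card (p ` B') \<le> card B"
    using B p by (intro independent_span_bound) auto
  then show ?thesis
    using inj by (simp add: card_image finite_image_iff)
qed

lemma codim_eq_card:
  assumes "subspace U" "finite B" "quotient_basis U V B"
  shows "codim U V = card B"
proof -
  let ?B = "SOME B. quotient_basis U V B"
  have B: "quotient_basis U V ?B"
    using assms(3) by (rule someI)
  then have "finite ?B \<and> card ?B \<le> card B"
    using assms by (intro quotient_basis_card_le)
  then have "card ?B = card B"
    using B assms quotient_basis_card_le[of U ?B V B] by auto
  then show ?thesis
    by (simp add: codim_def)
qed

text \<open>A functional that is nonzero at \<open>e\<close> cuts \<open>U\<close> down by exactly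
  the line through \<open>e\<close>, so \<open>e\<close> completes the old basis. Linearity is
  required on \<open>U\<close> alone because in the applications \<open>f\<close> involves the
  inverse operator \<open>T\<close>, which is known to be linear only on
  \<open>L2_on a b\<close>.\<close>

lemma quotient_basis_kernel:
  assumes U: "subspace U" "U \<subseteq> V" and B: "quotient_basis U V B"
    and f: "\<And>x y. x \<in> U \<Longrightarrow> y \<in> U \<Longrightarrow> f (x + y) = f x + f y"
      "\<And>c x. x \<in> U \<Longrightarrow> f (scale c x) = c * f x"
    and e: "e \<in> U" "f e \<noteq> 0"
  shows "e \<notin> B" "quotient_basis {x \<in> U. f x = 0} V (insert e B)"
proof -
  let ?U = "{x \<in> U. f x = 0}"
  have f0: "f 0 = 0"
    using f(2)[of e 0] e by simp
  have "e \<notin> span B"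
  proof
    assume "e \<in> span B"
    then have "e = 0"
      using B e by (auto simp: quotient_basis_def)
    then show False
      using e f0 by simp
  qed
  then show "e \<notin> B"
    using span_base by blast
  have "x = 0" if x: "x \<in> span (insert e B)" "x \<in> U" "f x = 0" for x
  proof -
    obtain k where k: "x - scale k e \<in> span B"
      using x span_insert by auto
    have "x - scale k e \<in> U"
      using x U e by (intro subspace_diff subspace_scale)
    then have "x - scale k e = 0"
      using k quotient_basis_trivial_Int[OF B] by blast
    then have "x = scale k e"
      by simp
    then show "x = 0"
      using x e f(2)[of e k] by auto
  qed
  moreover have "0 \<in> ?U"
    using U subspace_0 f0 by auto
  moreover have "V \<subseteq> span (?U \<union> insert e B)"
  proof -
    have "U \<subseteq> span (?U \<union> insert e B)"
    proof
      fix u assume u: "u \<in> U"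
      define c where "c = f u / f e"
      have "u - scale c e \<in> U"
        using u U e by (intro subspace_diff subspace_scale)
      moreover have "f (u - scale c e) = 0"
        using f(1)[OF u, of "scale (- c) e"] f(2)[of e "- c"] e U
        by (simp add: c_def subspace_scale subspace_neg)
      ultimately have "(u - scale c e) + scale c e \<in> span (?U \<union> insert e B)"
        by (intro span_add span_scale span_base) auto
      then show "u \<in> span (?U \<union> insert e B)"
        by simp
    qed
    moreover have "B \<subseteq> span (?U \<union> insert e B)"
      by (auto intro: span_base)
    ultimately have "span (U \<union> B) \<subseteq> span (?U \<union> insert e B)"
      by (intro span_minimal) auto
    then show ?thesis
      using B by (auto simp: quotient_basis_def)
  qed
  ultimately show "quotient_basis ?U V (insert e B)"
    using B e U \<open>e \<notin> span B\<close> independent_insertI[of e B]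
    by (auto simp: quotient_basis_def span_zero)
qed

text \<open>The kernel of \<open>D\<close> is a line that meets \<open>U\<close> trivially, so it
  contributes one dimension beyond the quotient of the images. The new basis consists of lifts of
  \<open>B\<close> together with \<open>e\<close>. Later \<open>D\<close> is the weak derivative and
  \<open>e\<close> the constant function.\<close>

lemma quotient_basis_lift:
  assumes X: "subspace X" and U: "subspace U" "U \<subseteq> X"
    and D: "\<And>x y. x \<in> X \<Longrightarrow> y \<in> X \<Longrightarrow> D (x + y) = D x + D y"
      "\<And>c x. x \<in> X \<Longrightarrow> D (scale c x) = scale c (D x)"
      "D ` X = Y"
    and ker: "\<And>x. x \<in> X \<Longrightarrow> D x = 0 \<Longrightarrow> \<exists>c. x = scale c e"
    and e: "e \<in> X" "D e = 0" "e \<notin> U"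
    and B: "finite B" "quotient_basis (D ` U) Y B"
  shows "\<exists>B'. finite B' \<and> card B' = Suc (card B) \<and> quotient_basis U X B'"
proof -
  have "\<forall>b\<in>B. \<exists>x. x \<in> X \<and> D x = b"
    using B D(3) by (auto simp: quotient_basis_def)
  from bchoice[OF this] obtain g where g: "g b \<in> X" "D (g b) = b" if "b \<in> B" for b
    by blast
  have D_sum: "D (\<Sum>b\<in>S. scale (c b) (h b)) = (\<Sum>b\<in>S. scale (c b) (D (h b)))"
    if "\<And>b. b \<in> S \<Longrightarrow> h b \<in> X" "finite S" for c S and h :: "'b \<Rightarrow> 'b"
    using that(2,1)
  proof (induction S rule: finite_induct)
    case empty
    then show ?case using D(2)[of e 0] e by simp
  next
    case (insert b S)
    moreover have "(\<Sum>b\<in>S. scale (c b) (h b)) \<in> X" "scale (c b) (h b) \<in> X"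
      using insert X by (auto intro!: subspace_sum subspace_scale)
    ultimately show ?case
      by (simp add: D)
  qed
  have inj: "inj_on g B"
    using g(2) by (rule inj_on_inverseI)
  have repr: "\<exists>c. s = (\<Sum>b\<in>B. scale (c b) (g b))" if "s \<in> span (g ` B)" for s
  proof -
    have "s \<in> range (\<lambda>c. \<Sum>v\<in>g ` B. scale (c v) v)"
      using that B(1) span_finite[of "g ` B"] by simp
    then obtain c where "s = (\<Sum>v\<in>g ` B. scale (c v) v)"
      by (rule rangeE)
    then have "s = (\<Sum>b\<in>B. scale (c (g b)) (g b))"
      using inj by (simp add: sum.reindex)
    then show ?thesis
      by (rule exI[of _ "\<lambda>b. c (g b)"])
  qed
  have B0: "c b = 0" if "(\<Sum>b\<in>B. scale (c b) b) = 0" "b \<in> B" for c b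
    using independentD[of B B c b] B that by (auto simp: quotient_basis_def)
  have D_g_sum: "D (\<Sum>b\<in>B. scale (c b) (g b)) = (\<Sum>b\<in>B. scale (c b) b)" for c
    using D_sum[of B g c] g B(1) by simp
  have span_gX: "span (g ` B) \<subseteq> X"
    using g X by (intro span_minimal) auto
  \<comment> \<open>Applied to \<open>s = e\<close>, whose image is 0, this gives independence of
    \<open>e\<close> from the lifts; applied to an element of \<open>U\<close> minus its multiple of
    \<open>e\<close>, it gives the trivial intersection.\<close>
  have inj_span: "s = 0" if s: "s \<in> span (g ` B)" "D s \<in> D ` U" for s
  proof -
    obtain c where c: "s = (\<Sum>b\<in>B. scale (c b) (g b))"
      using repr s by blast
    have "D s = (\<Sum>b\<in>B. scale (c b) b)"
      by (simp add: c D_g_sum)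
    moreover from this have "D s \<in> span B"
      by (simp add: span_sum span_scale span_base)
    ultimately have "(\<Sum>b\<in>B. scale (c b) b) = 0"
      using s B by (auto simp: quotient_basis_def)
    then have "c b = 0" if "b \<in> B" for b
      using B0 that by blast
    then show ?thesis
      by (simp add: c)
  qed
  have D0: "0 \<in> D ` U"
    using U(1) D(2)[of e 0] e by (auto simp: image_iff intro!: bexI[of _ 0] subspace_0)
  have "independent (g ` B)"
  proof (rule independent_if_scalars_zero)
    fix f x assume *: "(\<Sum>x\<in>g ` B. scale (f x) x) = 0" "x \<in> g ` B"
    then have "(\<Sum>b\<in>B. scale (f (g b)) (g b)) = 0"
      using inj by (simp add: sum.reindex)
    then have "(\<Sum>b\<in>B. scale (f (g b)) b) = 0"
      using D_g_sum[of "\<lambda>b. f (g b)"] D(2)[of e 0] e by simp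
    then show "f x = 0"
      using B0[of "\<lambda>b. f (g b)"] * by auto
  qed (use B in auto)
  moreover have e_span: "e \<notin> span (g ` B)"
    using inj_span[of e] e D0 U subspace_0 by auto
  ultimately have indep: "independent (insert e (g ` B))"
    by (rule independent_insertI[rotated])
  have "x = 0" if x: "x \<in> span (insert e (g ` B))" "x \<in> U" for x
  proof -
    obtain k where k: "x - scale k e \<in> span (g ` B)"
      using x span_insert by auto
    have "D ((x - scale k e) + scale k e) = D (x - scale k e) + scale k (D e)"
      using k span_gX e X by (subst D(1)) (auto simp: D subspace_scale)
    then have "D (x - scale k e) = D x"
      using e by simp
    then have "D (x - scale k e) \<in> D ` U"
      using x by simp
    then have x_eq: "x = scale k e"
      using inj_span k by fastforce
    have "k = 0"
    proof (rule ccontr)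
      assume "k \<noteq> 0"
      then have "e = scale (1 / k) x"
        by (simp add: x_eq)
      then show False
        using e x U subspace_scale by metis
    qed
    then show ?thesis
      by (simp add: x_eq)
  qed
  moreover have "X \<subseteq> span (U \<union> insert e (g ` B))"
  proof
    \<comment> \<open>Decompose \<open>D x\<close> modulo the image of \<open>U\<close> and lift
      both summands; what then remains of \<open>x\<close> lies in the kernel of
      \<open>D\<close>.\<close>
    fix x assume x: "x \<in> X"
    have DU: "subspace (D ` U)"
    proof (rule subspaceI)
      show "x + y \<in> D ` U" if xy: "x \<in> D ` U" "y \<in> D ` U" for x y
      proof -
        obtain x' y' where *: "x = D x'" "y = D y'" "x' \<in> U" "y' \<in> U"
          using xy by blast
        moreover have "x' \<in> X" "y' \<in> X"
          using * U by blast+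
        ultimately have "x + y = D (x' + y')"
          using D(1) by simp
        then show ?thesis
          using U * subspace_add[of U x' y'] by blast
      qed
      show "scale c x \<in> D ` U" if "x \<in> D ` U" for c x
      proof -
        obtain x' where *: "x = D x'" "x' \<in> U"
          using \<open>x \<in> D ` U\<close> by blast
        moreover have "x' \<in> X"
          using * U by blast
        ultimately have "scale c x = D (scale c x')"
          using D(2) by simp
        then show ?thesis
          using U * subspace_scale[of U x' c] by blast
      qed
    qed (fact D0)
    have "D x \<in> span (D ` U \<union> B)"
      using x B D(3) by (auto simp: quotient_basis_def)
    then obtain u s' where us: "D x = D u + s'" "u \<in> U" "s' \<in> span B"
      unfolding span_Un using DU by (auto simp: span_eq_iff[THEN iffD2])
    obtain c where c: "s' = (\<Sum>b\<in>B. scale (c b) b)"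
      using us B(1) by (auto simp: span_finite)
    define s where "s = (\<Sum>b\<in>B. scale (c b) (g b))"
    have s: "s \<in> span (g ` B)"
      unfolding s_def by (intro span_sum span_scale span_base) auto
    have "D s = s'"
      by (simp add: s_def c D_g_sum)
    have [simp]: "u \<in> X" "s \<in> X"
      using us U s span_gX by auto
    have "x - (u + s) \<in> X"
      using x X by (intro subspace_diff subspace_add) auto
    moreover have "D (x - (u + s)) = 0"
    proof -
      have "D ((x - (u + s)) + (u + s)) = D (x - (u + s)) + D (u + s)"
        using x X by (intro D subspace_diff subspace_add) auto
      then show ?thesis
        using us \<open>D s = s'\<close> D(1)[of u s] by simp
    qed
    ultimately obtain k where "x - (u + s) = scale k e"
      using ker by blast
    then have "x = scale k e + (u + s)"
      by (simp add: algebra_simps)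
    moreover have "scale k e + (u + s) \<in> span (U \<union> insert e (g ` B))"
      using us s span_mono[of "g ` B" "U \<union> insert e (g ` B)"]
      by (intro span_add span_scale) (auto intro: span_base)
    ultimately show "x \<in> span (U \<union> insert e (g ` B))"
      by simp
  qed
  ultimately have "quotient_basis U X (insert e (g ` B))"
    using indep e g U subspace_0 by (auto simp: quotient_basis_def span_zero)
  moreover have "card (insert e (g ` B)) = Suc (card B)"
    using B e_span span_base[of e "g ` B"] inj by (subst card_insert_disjoint) (auto simp: card_image)
  ultimately show ?thesis
    using B by (intro exI[of _ "insert e (g ` B)"]) auto
qed

end

section \<open>Smooth functions with compact support\<close>

text \<open>The regularity clause of \<open>test_functions\<close> without the support condition,
  which the building blocks below violate.\<close>

definition smooth :: "(real \<Rightarrow> real) \<Rightarrow> bool" where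
  "smooth f \<longleftrightarrow> (\<forall>m x. (deriv ^^ m) f differentiable at x)"

lemma smooth_differentiable: "smooth f \<Longrightarrow> f differentiable at x"
  unfolding smooth_def by (metis funpow_0)

lemma smooth_has_derivative: "smooth f \<Longrightarrow> (f has_real_derivative deriv f x) (at x)"
  using smooth_differentiable[of f x] DERIV_deriv_iff_real_differentiable by blast

lemma smooth_deriv: "smooth f \<Longrightarrow> smooth (deriv f)"
  unfolding smooth_def by (metis comp_apply funpow_Suc_right)

text \<open>Avoids formulas for iterated \<open>deriv\<close>: if every member of a class has a
  derivative in the class, all iterated derivatives stay in it. Each use below only has to exhibit a
  suitable class.\<close>

lemma smooth_coinduct:
  assumes "P f" and step: "\<And>f. P f \<Longrightarrow> \<exists>g. (\<forall>x. (f has_real_derivative g x) (at x)) \<and> P g"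
  shows "smooth f"
proof -
  have "P ((deriv ^^ m) f)" for m
  proof (induction m)
    case (Suc m)
    then obtain g where "\<forall>x. ((deriv ^^ m) f has_real_derivative g x) (at x)" "P g"
      using step by blast
    moreover from this have "deriv ((deriv ^^ m) f) = g"
      by (auto intro!: DERIV_imp_deriv)
    ultimately show ?case
      by simp
  qed (simp add: assms(1))
  then show ?thesis
    using step unfolding smooth_def
    by (metis real_differentiable_def)
qed

lemma smooth_iff_has_derivative:
  assumes "\<And>x. (f has_real_derivative g x) (at x)" "smooth g"
  shows "smooth f"
proof (rule smooth_coinduct[of "\<lambda>F. F = f \<or> smooth F"])
  fix F assume "F = f \<or> smooth F"
  then show "\<exists>G. (\<forall>x. (F has_real_derivative G x) (at x)) \<and> (G = f \<or> smooth G)"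
    using assms smooth_has_derivative smooth_deriv by blast
qed simp

text \<open>Products alone are not closed under differentiation, but by the Leibniz rule their
  finite sums are; this class is the coinduction invariant.\<close>

inductive sum_of_products :: "(real \<Rightarrow> real) \<Rightarrow> bool" where
  product: "smooth f \<Longrightarrow> smooth g \<Longrightarrow> sum_of_products (\<lambda>x. f x * g x)"
| sum: "sum_of_products f \<Longrightarrow> sum_of_products g \<Longrightarrow> sum_of_products (\<lambda>x. f x + g x)"

lemma smooth_mult:
  assumes "smooth f" "smooth g"
  shows "smooth (\<lambda>x. f x * g x)"
proof (rule smooth_coinduct)
  show "sum_of_products (\<lambda>x. f x * g x)"
    using assms by (rule product)
  show "\<exists>h'. (\<forall>x. (h has_real_derivative h' x) (at x)) \<and> sum_of_products h'"
    if "sum_of_products h" for h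
    using that
  proof induction
    case (product f g)
    then have "sum_of_products (\<lambda>x. deriv f x * g x + f x * deriv g x)"
      by (intro sum sum_of_products.product smooth_deriv)
    moreover have "((\<lambda>x. f x * g x) has_real_derivative deriv f x * g x + f x * deriv g x) (at x)" for x
      using product by (auto intro!: derivative_eq_intros smooth_has_derivative)
    ultimately show ?case
      by (intro exI[of _ "\<lambda>x. deriv f x * g x + f x * deriv g x"]) auto
  next
    case (sum f g)
    then obtain f' g' where "\<forall>x. (f has_real_derivative f' x) (at x)" "sum_of_products f'"
      "\<forall>x. (g has_real_derivative g' x) (at x)" "sum_of_products g'"
      by blast
    then show ?case
      by (intro exI[of _ "\<lambda>x. f' x + g' x"]) (auto intro: DERIV_add sum_of_products.sum)
  qed
qed

lemma smooth_affine:
  assumes "smooth f"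
  shows "smooth (\<lambda>x. f (c * x + d))"
proof (rule smooth_coinduct)
  \<comment> \<open>The factor \<open>k\<close> absorbs the powers of \<open>c\<close> produced by
    the chain rule.\<close>
  let ?P = "\<lambda>F. \<exists>f k. smooth f \<and> F = (\<lambda>x. k * f (c * x + d))"
  show "?P (\<lambda>x. f (c * x + d))"
    using assms by (intro exI[of _ f] exI[of _ 1]) simp
  fix F assume "?P F"
  then obtain f k where f: "smooth f" and F: "F = (\<lambda>x. k * f (c * x + d))"
    by blast
  have "(F has_real_derivative (k * c) * deriv f (c * x + d)) (at x)" for x
  proof -
    have "((\<lambda>x. c * x + d) has_real_derivative c) (at x)"
      by (auto intro!: derivative_eq_intros)
    then have "((\<lambda>x. f (c * x + d)) has_real_derivative deriv f (c * x + d) * c) (at x)"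
      using DERIV_chain2[OF smooth_has_derivative[OF f]] by blast
    then show ?thesis
      unfolding F by (auto intro!: derivative_eq_intros)
  qed
  then show "\<exists>G. (\<forall>x. (F has_real_derivative G x) (at x)) \<and> ?P G"
    using smooth_deriv[OF f] by (intro exI[of _ "\<lambda>x. (k * c) * deriv f (c * x + d)"]) blast
qed

lemma smooth_add:
  assumes "smooth f" "smooth g"
  shows "smooth (\<lambda>x. f x + g x)"
proof (rule smooth_coinduct)
  let ?P = "\<lambda>F. \<exists>f g. smooth f \<and> smooth g \<and> F = (\<lambda>x. f x + g x)"
  show "?P (\<lambda>x. f x + g x)"
    using assms by blast
  fix F assume "?P F"
  then obtain f g where f: "smooth f" and g: "smooth g" and F: "F = (\<lambda>x. f x + g x)"
    by blast
  have "(F has_real_derivative deriv f x + deriv g x) (at x)" for x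
    unfolding F by (intro DERIV_add smooth_has_derivative f g)
  then show "\<exists>G. (\<forall>x. (F has_real_derivative G x) (at x)) \<and> ?P G"
    using smooth_deriv[OF f] smooth_deriv[OF g]
    by (intro exI[of _ "\<lambda>x. deriv f x + deriv g x"]) blast
qed

lemma smooth_const: "smooth (\<lambda>x. c)"
proof (rule smooth_coinduct[of "\<lambda>F. \<exists>c. F = (\<lambda>x. c)"])
  fix F :: "real \<Rightarrow> real" assume "\<exists>c. F = (\<lambda>x. c)"
  then show "\<exists>G. (\<forall>x. (F has_real_derivative G x) (at x)) \<and> (\<exists>c. G = (\<lambda>x. c))"
    by (intro exI[of _ "\<lambda>x. 0"]) auto
qed blast

section \<open>Flat functions and bumps\<close>

definition exp_poly :: "real poly \<Rightarrow> real \<Rightarrow> real" where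
  "exp_poly p x = (if x > 0 then poly p (1 / x) * exp (- (1 / x)) else 0)"

lemma tendsto_poly_exp_0: "((\<lambda>t. poly p t * exp (- t)) \<longlongrightarrow> (0::real)) at_top"
proof -
  have "((\<lambda>t. \<Sum>i\<le>degree p. coeff p i * (t ^ i / exp t)) \<longlongrightarrow> (\<Sum>i\<le>degree p. coeff p i * 0)) at_top"
    by (intro tendsto_intros tendsto_power_div_exp_0)
  then show ?thesis
    by (simp add: poly_altdef exp_minus sum_distrib_right divide_inverse mult.assoc)
qed

text \<open>With \<open>t = 1 / x\<close>, differentiation in \<open>x\<close> is
  \<open>- t^2\<close> times differentiation in \<open>t\<close>, and \<open>p e^(- t)\<close> has
  \<open>t\<close>-derivative \<open>(p' - p) e^(- t)\<close>; hence the polynomial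
  \<open>t^2 (p - p')\<close>. The arbitrary polynomial factor makes the family closed under
  differentiation; \<open>p = 1\<close> is the classical flat function.\<close>

lemma exp_poly_has_derivative:
  "(exp_poly p has_real_derivative exp_poly ([:0, 0, 1:] * (p - pderiv p)) x) (at x)"
proof -
  consider "x > 0" | "x < 0" | "x = 0" by linarith
  then show ?thesis
  proof cases
    case 1
    have "((\<lambda>x. poly p (1 / x) * exp (- (1 / x))) has_real_derivative
        (poly (pderiv p) (1 / x) * (- 1 / x\<^sup>2)) * exp (- (1 / x))
          + poly p (1 / x) * (exp (- (1 / x)) * (1 / x\<^sup>2))) (at x)"
    proof (rule DERIV_mult[THEN DERIV_cong])
      show "((\<lambda>x. poly p (1 / x)) has_real_derivative poly (pderiv p) (1 / x) * (- 1 / x\<^sup>2)) (at x)"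
        by (rule DERIV_chain2[OF poly_DERIV])
          (use 1 in \<open>auto intro!: derivative_eq_intros simp: power2_eq_square\<close>)
      show "((\<lambda>x. exp (- (1 / x))) has_real_derivative exp (- (1 / x)) * (1 / x\<^sup>2)) (at x)"
        by (rule DERIV_chain2[OF DERIV_exp])
          (use 1 in \<open>auto intro!: derivative_eq_intros simp: power2_eq_square\<close>)
    qed (simp add: algebra_simps)
    then have "((\<lambda>x. poly p (1 / x) * exp (- (1 / x))) has_real_derivative
        exp_poly ([:0, 0, 1:] * (p - pderiv p)) x) (at x)"
      by (rule DERIV_cong) (use 1 in \<open>simp add: exp_poly_def field_simps power2_eq_square\<close>)
    then show ?thesis
      by (rule has_field_derivative_transform_within_open[where S = "{0<..}"])
        (use 1 in \<open>auto simp: exp_poly_def\<close>)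
  next
    case 2
    have "((\<lambda>x. 0) has_real_derivative exp_poly ([:0, 0, 1:] * (p - pderiv p)) x) (at x)"
      using 2 by (simp add: exp_poly_def)
    then show ?thesis
      by (rule has_field_derivative_transform_within_open[where S = "{..<0}"])
        (use 2 in \<open>auto simp: exp_poly_def\<close>)
  next
    case 3
    have "((\<lambda>y. exp_poly p y / y) \<longlongrightarrow> 0) (at_right 0)"
    proof -
      \<comment> \<open>\<open>pCons 0 p\<close> supplies the extra factor \<open>1 / y\<close> of
        the difference quotient at 0, so flatness there is the decay of a polynomial times
        \<open>exp (- t)\<close> at infinity.\<close>
      have "((\<lambda>y. poly (pCons 0 p) (inverse y) * exp (- inverse y)) \<longlongrightarrow> (0::real)) (at_right 0)"
        using filterlim_compose[OF tendsto_poly_exp_0 filterlim_inverse_at_top_right] .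
      then show ?thesis
        by (rule Lim_transform_eventually)
          (auto simp: eventually_at_right_field exp_poly_def field_simps intro!: exI[of _ 1])
    qed
    moreover have "((\<lambda>y. exp_poly p y / y) \<longlongrightarrow> 0) (at_left 0)"
      by (rule Lim_transform_eventually[of "\<lambda>y. 0"])
        (auto simp: eventually_at_left_field exp_poly_def intro!: exI[of _ "-1"])
    ultimately have "((\<lambda>y. exp_poly p y / y) \<longlongrightarrow> 0) (at 0)"
      by (simp add: filterlim_split_at)
    then show ?thesis
      using 3 by (simp add: has_field_derivative_iff exp_poly_def)
  qed
qed

lemma smooth_exp_poly: "smooth (exp_poly p)"
  by (rule smooth_coinduct[of "\<lambda>F. \<exists>p. F = exp_poly p"])
    (use exp_poly_has_derivative in blast)+

text \<open>The shift by 1 moves the edges of the support inward to \<open>c + 1 / n\<close> and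
  \<open>d - 1 / n\<close>, which makes it compact in the open interval; the scaling by
  \<open>n\<close> lets the functions tend to the indicator of that interval while staying between 0
  and 1.\<close>

definition bump :: "real \<Rightarrow> real \<Rightarrow> nat \<Rightarrow> real \<Rightarrow> real" where
  "bump c d n x = exp_poly 1 (real n * (x - c) - 1) * exp_poly 1 (real n * (d - x) - 1)"

lemma smooth_bump: "smooth (bump c d n)"
proof -
  have "smooth (\<lambda>x. exp_poly 1 (real n * x + (- real n * c - 1)) *
      exp_poly 1 ((- real n) * x + (real n * d - 1)))"
    by (intro smooth_mult smooth_affine smooth_exp_poly)
  also have "(\<lambda>x. exp_poly 1 (real n * x + (- real n * c - 1)) *
      exp_poly 1 ((- real n) * x + (real n * d - 1))) = bump c d n"
    by (auto simp: bump_def fun_eq_iff algebra_simps)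
  finally show ?thesis .
qed

lemma bump_bounds: "0 \<le> bump c d n x" "bump c d n x \<le> 1"
  by (auto simp: bump_def exp_poly_def intro!: mult_le_one)

lemma bump_support:
  assumes "n > 0" "x \<notin> {c + 1 / n .. d - 1 / n}"
  shows "bump c d n x = 0"
  using assms by (auto simp: bump_def exp_poly_def field_simps not_le)

lemma bump_tendsto: "(\<lambda>n. bump c d n x) \<longlonglongrightarrow> indicator {c<..<d} x"
proof (cases "x \<in> {c<..<d}")
  case True
  have "(\<lambda>n. exp_poly 1 (real n * y - 1)) \<longlonglongrightarrow> 1" if "y > 0" for y
  proof -
    have lim: "filterlim (\<lambda>n. real n * y - 1) at_top sequentially"
      using that by real_asymp
    then have "(\<lambda>n. exp (- (1 / (real n * y - 1)))) \<longlonglongrightarrow> 1"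
      using that by real_asymp
    then show ?thesis
    proof (rule Lim_transform_eventually)
      show "\<forall>\<^sub>F n in sequentially. exp (- (1 / (real n * y - 1))) = exp_poly 1 (real n * y - 1)"
        using lim[THEN filterlim_at_top_dense[THEN iffD1], rule_format, of 0]
        by eventually_elim (simp add: exp_poly_def)
    qed
  qed
  from tendsto_mult[OF this[of "x - c"] this[of "d - x"]] show ?thesis
    using True by (simp add: bump_def)
next
  case False
  then have "real n * (x - c) \<le> 0 \<or> real n * (d - x) \<le> 0" for n
    by (auto simp: not_less intro: mult_nonneg_nonpos)
  then have "exp_poly 1 (real n * (x - c) - 1) = 0 \<or> exp_poly 1 (real n * (d - x) - 1) = 0" for n
    unfolding exp_poly_def by (smt (verit, best))
  then have "bump c d n x = 0" for n
    by (simp add: bump_def)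
  then show ?thesis
    using False by simp
qed


section \<open>Supports, integrals and antiderivatives of test functions\<close>

lemma test_functions_iff:
  "\<phi> \<in> test_functions a b \<longleftrightarrow>
     smooth \<phi> \<and> (\<exists>K. compact K \<and> K \<subseteq> {a<..<b} \<and> (\<forall>x. x \<notin> K \<longrightarrow> \<phi> x = 0))"
  by (simp add: test_functions_def smooth_def)

lemma test_functionI:
  "smooth \<phi> \<Longrightarrow> compact K \<Longrightarrow> K \<subseteq> {a<..<b} \<Longrightarrow> (\<And>x. x \<notin> K \<Longrightarrow> \<phi> x = 0) \<Longrightarrow> \<phi> \<in> test_functions a b"
  by (auto simp: test_functions_iff)

lemma test_function_smooth: "\<phi> \<in> test_functions a b \<Longrightarrow> smooth \<phi>"
  by (simp add: test_functions_iff)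

lemma test_function_eq_0: "\<phi> \<in> test_functions a b \<Longrightarrow> x \<notin> {a<..<b} \<Longrightarrow> \<phi> x = 0"
  by (auto simp: test_functions_iff)

lemma test_function_supportE:
  assumes "\<phi> \<in> test_functions a b" "a < b"
  obtains c d where "a < c" "c < d" "d < b" "\<And>x. x \<notin> {c<..<d} \<Longrightarrow> \<phi> x = 0"
proof -
  obtain K where K: "compact K" "K \<subseteq> {a<..<b}" "\<And>x. x \<notin> K \<Longrightarrow> \<phi> x = 0"
    using assms by (auto simp: test_functions_iff)
  \<comment> \<open>The midpoint makes the set nonempty when \<phi> vanishes identically.\<close>
  define L where "L = insert ((a + b) / 2) K"
  have L: "compact L" "L \<noteq> {}" "L \<subseteq> {a<..<b}" "K \<subseteq> L"
    using K \<open>a < b\<close> by (auto simp: L_def)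
  obtain c where c: "c \<in> L" "\<And>x. x \<in> L \<Longrightarrow> c \<le> x"
    using compact_attains_inf[of L] L by blast
  obtain d where d: "d \<in> L" "\<And>x. x \<in> L \<Longrightarrow> x \<le> d"
    using compact_attains_sup[of L] L by blast
  have "a < c" "c \<le> d" "d < b"
    using c d L by auto
  \<comment> \<open>Going halfway towards \<open>a\<close> and \<open>b\<close> keeps a gap at both
    ends and gives a nondegenerate interval even if \<open>c = d\<close>.\<close>
  moreover have "\<phi> x = 0" if "x \<notin> {(a + c) / 2<..<(d + b) / 2}" for x
  proof (rule K(3))
    show "x \<notin> K"
      using that L(4) c(2)[of x] d(2)[of x] \<open>a < c\<close> \<open>d < b\<close> by fastforce
  qed
  ultimately show thesis
    by (intro that[of "(a + c) / 2" "(d + b) / 2"]) auto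
qed

lemma test_function_deriv:
  assumes "\<phi> \<in> test_functions a b"
  shows "deriv \<phi> \<in> test_functions a b"
proof -
  obtain K where K: "compact K" "K \<subseteq> {a<..<b}" "\<And>x. x \<notin> K \<Longrightarrow> \<phi> x = 0"
    using assms by (auto simp: test_functions_iff)
  show ?thesis
  proof (rule test_functionI[OF smooth_deriv[OF test_function_smooth[OF assms]] K(1,2)])
    fix x assume "x \<notin> K"
    moreover have "open (- K)"
      using K compact_imp_closed by blast
    ultimately have "(\<phi> has_real_derivative 0) (at x)"
      by (intro has_field_derivative_transform_within_open[OF DERIV_const[of 0], of "- K"])
        (use K in auto)
    then show "deriv \<phi> x = 0"
      by (rule DERIV_imp_deriv)
  qed
qed

lemma test_function_isCont: "\<phi> \<in> test_functions a b \<Longrightarrow> isCont \<phi> x"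
  by (meson DERIV_isCont smooth_has_derivative test_function_smooth)

lemma test_function_measurable [measurable_dest]:
  "\<phi> \<in> test_functions a b \<Longrightarrow> \<phi> \<in> borel_measurable borel"
  using test_function_deriv_measurable[of \<phi> a b 0] by simp

lemma test_function_bounded:
  assumes "\<phi> \<in> test_functions a b"
  obtains C where "\<And>x. \<bar>\<phi> x\<bar> \<le> C"
proof -
  have "compact (\<phi> ` {a..b})"
    using test_function_isCont[OF assms] by (intro compact_continuous_image continuous_at_imp_continuous_on) auto
  then obtain C where C: "\<forall>y\<in>\<phi> ` {a..b}. norm y \<le> C"
    using bounded_iff compact_imp_bounded by blast
  have "\<bar>\<phi> x\<bar> \<le> max C 0" for x
    using C test_function_eq_0[OF assms, of x] by (cases "x \<in> {a<..<b}") (force simp: le_max_iff_disj)+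
  then show thesis
    by (rule that)
qed

lemma test_function_integrable:
  assumes "\<phi> \<in> test_functions a b"
  shows "integrable lborel \<phi>"
proof -
  have "integrable lborel (\<lambda>x. indicator {a..b} x *\<^sub>R \<phi> x)"
    using borel_integrable_atLeastAtMost'[of a b \<phi>] test_function_isCont[OF assms]
    by (auto simp: set_integrable_def intro: continuous_at_imp_continuous_on)
  moreover have "(\<lambda>x. indicator {a..b} x *\<^sub>R \<phi> x) = \<phi>"
    using test_function_eq_0[OF assms] by (auto simp: fun_eq_iff split: split_indicator)
  ultimately show ?thesis
    by simp
qed

lemma test_function_add:
  assumes "\<phi> \<in> test_functions a b" "\<psi> \<in> test_functions a b"
  shows "(\<lambda>x. \<phi> x + \<psi> x) \<in> test_functions a b"
proof -
  obtain K L where "compact K" "K \<subseteq> {a<..<b}" "\<And>x. x \<notin> K \<Longrightarrow> \<phi> x = 0"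
    "compact L" "L \<subseteq> {a<..<b}" "\<And>x. x \<notin> L \<Longrightarrow> \<psi> x = 0"
    using assms by (auto simp: test_functions_iff)
  then show ?thesis
    using assms by (intro test_functionI[of _ "K \<union> L"]) (auto simp: test_functions_iff smooth_add)
qed

lemma test_function_cmult:
  assumes "\<phi> \<in> test_functions a b"
  shows "(\<lambda>x. c * \<phi> x) \<in> test_functions a b"
  using assms smooth_mult[OF smooth_const[of c], of \<phi>] by (auto simp: test_functions_iff)

lemma bump_test_function:
  assumes "n > 0" "a \<le> c" "d \<le> b"
  shows "bump c d n \<in> test_functions a b"
proof (rule test_functionI[OF smooth_bump])
  have "1 / real n > 0"
    using assms by simp
  then show "{c + 1 / real n..d - 1 / real n} \<subseteq> {a<..<b}"
    using assms unfolding subset_iff atLeastAtMost_iff greaterThanLessThan_iff by linarith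
qed (use assms bump_support in auto)

lemma test_function_integral_deriv:
  assumes "\<And>x. (F has_real_derivative \<phi> x) (at x)" "\<phi> \<in> test_functions a b" "c \<le> d"
  shows "(LINT x:{c..d}|lborel. \<phi> x) = F d - F c"
  unfolding set_lebesgue_integral_def
  using test_function_isCont[OF assms(2)] assms
  by (intro integral_FTC_atLeastAtMost)
    (auto intro: continuous_at_imp_continuous_on has_vector_derivative_at_within
      simp: has_real_derivative_iff_has_vector_derivative)

lemma set_integral_eq_integral_of_support:
  assumes "\<And>x. x \<notin> A \<Longrightarrow> \<phi> x = 0"
  shows "(LINT x:A|lborel. \<phi> x) = (LINT x|lborel. (\<phi> x :: real))"
  unfolding set_lebesgue_integral_def
  using assms by (intro Bochner_Integration.integral_cong) (auto split: split_indicator)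

text \<open>An antiderivative is constant on either side of the support of \<phi>, and the vanishing
  integral says that the two constants coincide; subtracting this constant gives compact
  support.\<close>

lemma test_function_antiderivative:
  assumes \<phi>: "\<phi> \<in> test_functions a b" and "a < b" and int0: "(LINT x|lborel. \<phi> x) = 0"
  obtains \<psi> where "\<psi> \<in> test_functions a b" "deriv \<psi> = \<phi>"
proof -
  obtain F where F: "(F has_real_derivative \<phi> x) (at x)" for x
    using einterval_antiderivative[of "-\<infinity>" "\<infinity>" \<phi>] test_function_isCont[OF \<phi>]
    by (auto simp: has_real_derivative_iff_has_vector_derivative)
  obtain c d where cd: "a < c" "c < d" "d < b" "\<And>x. x \<notin> {c<..<d} \<Longrightarrow> \<phi> x = 0"
    using test_function_supportE[OF \<phi> \<open>a < b\<close>] by blast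
  have const: "F x = F y" if "x \<le> y" "\<And>t. t \<in> {x..y} \<Longrightarrow> t \<notin> {c<..<d}" for x y
  proof -
    have "\<phi> t = 0" if "t \<in> {x..y}" for t
      using that \<open>\<And>t. t \<in> {x..y} \<Longrightarrow> t \<notin> {c<..<d}\<close> cd by blast
    then have "(LINT x:{x..y}|lborel. \<phi> x) = 0"
      unfolding set_lebesgue_integral_def
      by (intro integral_eq_zero_AE) (auto split: split_indicator)
    then show ?thesis
      using test_function_integral_deriv[OF F \<phi> \<open>x \<le> y\<close>] by simp
  qed
  have "\<phi> x = 0" if "x \<notin> {c..d}" for x
    using cd that by auto
  then have Fcd: "F d = F c"
    using test_function_integral_deriv[OF F \<phi>, of c d] cd int0
      set_integral_eq_integral_of_support[of "{c..d}" \<phi>] by simp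
  have zero: "F x - F c = 0" if "x \<notin> {c..d}" for x
    using that const[of x c] const[of d x] Fcd cd by (cases "x \<le> c") auto
  have der: "((\<lambda>x. F x - F c) has_real_derivative \<phi> x) (at x)" for x
    using F[of x] by (auto intro!: derivative_eq_intros)
  show thesis
  proof (rule that)
    show "(\<lambda>x. F x - F c) \<in> test_functions a b"
      using smooth_iff_has_derivative[OF der test_function_smooth[OF \<phi>]] cd zero
      by (intro test_functionI[of _ "{c..d}"]) auto
    show "deriv (\<lambda>x. F x - F c) = \<phi>"
      using der DERIV_imp_deriv by blast
  qed
qed

lemma test_function_integral_1:
  assumes "a < b"
  obtains \<phi> where "\<phi> \<in> test_functions a b" "(LINT x|lborel. \<phi> x) = 1"
proof -
  \<comment> \<open>A margin \<open>1 / n\<close> below half the length leaves an interval on which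
    the bump is positive, so that it can be normalized.\<close>
  obtain n where n: "n > 0" "inverse (real n) < (b - a) / 4"
    using ex_inverse_of_nat_less[of "(b - a) / 4"] assms by auto
  then have n': "a + 1 / n < b - 1 / n"
    using assms unfolding inverse_eq_divide by argo
  let ?\<phi> = "bump a b n"
  have \<phi>: "?\<phi> \<in> test_functions a b"
    using bump_test_function n by simp
  have "?\<phi> x > 0" if "x \<in> {a + 1 / n<..<b - 1 / n}" for x
    using that n by (auto simp: bump_def exp_poly_def field_simps)
  have "(LINT x|lborel. ?\<phi> x) \<noteq> 0"
  proof
    assume "(LINT x|lborel. ?\<phi> x) = 0"
    then have "AE x in lborel. ?\<phi> x = 0"
      using integral_nonneg_eq_0_iff_AE[OF test_function_integrable[OF \<phi>]] bump_bounds by auto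
    then have "AE x in lborel. x \<notin> {a + 1 / n<..<b - 1 / n}"
      by eventually_elim (use \<open>\<And>x. x \<in> {a + 1 / n<..<b - 1 / n} \<Longrightarrow> ?\<phi> x > 0\<close> in force)
    then have "emeasure lborel {a + 1 / n<..<b - 1 / n} = 0"
      by (subst (asm) AE_iff_measurable[of "{a + 1 / n<..<b - 1 / n}"]) auto
    then show False
      using n' by simp
  qed
  then show thesis
    using that[OF test_function_cmult[OF \<phi>, of "1 / (LINT x|lborel. ?\<phi> x)"]] by simp
qed

section \<open>Weak derivatives of integrable functions\<close>

text \<open>The Borel sets over which \<open>G\<close> integrates to zero form a Dynkin system, and
  the open intervals are a generator closed under intersection. Hence all integrals of
  \<open>G\<close> over Borel sets vanish.\<close>

lemma set_integral_zero_of_intervals: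
  fixes G :: "real \<Rightarrow> 'a::euclidean_space"
  assumes G: "integrable lborel G"
    and outside: "\<And>x. x \<notin> {a<..<b} \<Longrightarrow> G x = 0"
    and zero: "\<And>c d. a \<le> c \<Longrightarrow> c < d \<Longrightarrow> d \<le> b \<Longrightarrow> (LINT x:{c<..<d}|lborel. G x) = 0"
  shows "AE x in lborel. G x = 0"
proof (rule sigma_finite_measure.density_zero[OF lborel.sigma_finite_measure_axioms G])
  have box: "(LINT x:{c<..<d}|lborel. G x) = 0" for c d
  proof (cases "max a c < min b d")
    case True
    have "(LINT x:{c<..<d}|lborel. G x) = (LINT x:{max a c<..<min b d}|lborel. G x)"
      unfolding set_lebesgue_integral_def
      using outside by (intro Bochner_Integration.integral_cong) (auto split: split_indicator)
    then show ?thesis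
      using zero[of "max a c" "min b d"] True by simp
  next
    case False
    then have "x \<notin> {c<..<d} \<or> x \<notin> {a<..<b}" for x
      by auto
    then have "indicator {c<..<d} x *\<^sub>R G x = 0" for x
      using outside[of x] by (metis indicator_simps(2) scale_eq_0_iff)
    then have "(\<lambda>x. indicator {c<..<d} x *\<^sub>R G x) = (\<lambda>x. 0)"
      by (rule ext)
    then show ?thesis
      unfolding set_lebesgue_integral_def by (simp only: integral_zero)
  qed
  have UNIV0: "(LINT x|lborel. G x) = 0"
  proof -
    have "(LINT x|lborel. G x) = (LINT x:{a<..<b}|lborel. G x)"
      unfolding set_lebesgue_integral_def
      using outside by (intro Bochner_Integration.integral_cong) (auto split: split_indicator)
    then show ?thesis
      using box by simp
  qed
  fix A :: "real set" assume "A \<in> sets lborel"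
  let ?I = "range (\<lambda>(a, b). {a<..<b}) :: real set set"
  have sets_eq: "sets borel = sigma_sets UNIV ?I"
    by (simp add: borel_eq_box box_real)
  have "{a<..<b} \<inter> {c<..<d} \<in> ?I" for a b c d :: real
    by (rule range_eqI[of _ _ "(max a c, min b d)"]) auto
  then have "Int_stable ?I"
    by (auto simp: Int_stable_def)
  moreover have "?I \<subseteq> Pow UNIV"
    by simp
  moreover have "A \<in> sigma_sets UNIV ?I"
    using \<open>A \<in> sets lborel\<close> by (simp add: sets_eq)
  ultimately show "(LINT x:A|lborel. G x) = 0"
  proof (induction rule: sigma_sets_induct_disjoint)
    case (basic A)
    then show ?case
      using box by auto
  next
    case (compl A)
    then have "A \<in> sets borel"
      by (simp add: sets_eq)
    then have "integrable lborel (\<lambda>x. indicator A x *\<^sub>R G x)"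
      using G by (intro integrable_mult_indicator) simp_all
    moreover have "(\<lambda>x. indicator (UNIV - A) x *\<^sub>R G x) = (\<lambda>x. G x - indicator A x *\<^sub>R G x)"
      by (auto simp: fun_eq_iff split: split_indicator)
    ultimately have "(LINT x:UNIV - A|lborel. G x) = (LINT x|lborel. G x) - (LINT x:A|lborel. G x)"
      unfolding set_lebesgue_integral_def using G by simp
    then show ?case
      using compl UNIV0 by simp
  next
    case (union A)
    then have "A i \<in> sets borel" for i
      by (auto simp: sets_eq)
    moreover from this have "set_integrable lborel (\<Union>(range A)) G"
      unfolding set_integrable_def using G by (intro integrable_mult_indicator) auto
    ultimately have "(LINT x:\<Union>(range A)|lborel. G x) = (\<Sum>i. LINT x:A i|lborel. G x)"
      using union(1) by (intro lebesgue_integral_countable_add) (auto simp: disjoint_family_on_def)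
    then show ?case
      using union by simp
  qed (simp add: set_lebesgue_integral_def)
qed

lemma test_function_bounded_mult_integrable:
  fixes f :: "real \<Rightarrow> 'a::euclidean_space"
  assumes "\<phi> \<in> test_functions a b" "set_integrable lborel S f"
  shows "set_integrable lborel S (\<lambda>x. \<phi> x *\<^sub>R f x)"
proof -
  obtain C where C: "\<And>x. \<bar>\<phi> x\<bar> \<le> C"
    using test_function_bounded[OF assms(1)] by blast
  have "integrable lborel (\<lambda>x. \<phi> x *\<^sub>R (indicator S x *\<^sub>R f x))"
  proof (rule Bochner_Integration.integrable_bound)
    show "integrable lborel (\<lambda>x. C *\<^sub>R (indicator S x *\<^sub>R f x))"
      using assms(2) by (auto simp: set_integrable_def simp del: scaleR_scaleR)
    show "(\<lambda>x. \<phi> x *\<^sub>R (indicator S x *\<^sub>R f x)) \<in> borel_measurable lborel"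
      using assms(2) test_function_measurable[OF assms(1)] unfolding set_integrable_def
      by (intro borel_measurable_scaleR[OF _ borel_measurable_integrable]) simp_all
    have "norm (\<phi> x *\<^sub>R y) \<le> norm (C *\<^sub>R y)" for x and y :: 'a
      using order_trans[OF C abs_ge_self] by (simp add: mult_right_mono)
    then show "AE x in lborel. norm (\<phi> x *\<^sub>R (indicator S x *\<^sub>R f x)) \<le> norm (C *\<^sub>R (indicator S x *\<^sub>R f x))"
      by blast
  qed
  then show ?thesis
    by (simp add: set_integrable_def mult.commute)
qed

text \<open>The fundamental lemma of the calculus of variations. Bumps are bounded by 1 and tend to
  the indicator of an interval, so dominated convergence turns the hypothesis into vanishing
  integrals over all subintervals.\<close>

theorem weakly_zero_imp_AE_zero:
  fixes f :: "real \<Rightarrow> 'a::euclidean_space"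
  assumes f: "set_integrable lborel {a<..<b} f"
    and zero: "\<And>\<phi>. \<phi> \<in> test_functions a b \<Longrightarrow> (LINT x:{a<..<b}|lborel. \<phi> x *\<^sub>R f x) = 0"
  shows "AE x in lborel. x \<in> {a<..<b} \<longrightarrow> f x = 0"
proof -
  define G where "G x = indicator {a<..<b} x *\<^sub>R f x" for x
  have G: "integrable lborel G"
    using f by (simp add: set_integrable_def G_def[abs_def])
  have "AE x in lborel. G x = 0"
  proof (rule set_integral_zero_of_intervals[OF G, of a b])
    fix c d assume cd: "a \<le> c" "c < d" "d \<le> b"
    have "(\<lambda>n. LINT x|lborel. bump c d n x *\<^sub>R G x) \<longlonglongrightarrow> (LINT x|lborel. indicator {c<..<d} x *\<^sub>R G x)"
    proof (rule integral_dominated_convergence)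
      show "integrable lborel (\<lambda>x. norm (G x))"
        using G by simp
      show "(\<lambda>x. indicator {c<..<d} x *\<^sub>R G x) \<in> borel_measurable lborel"
        by (intro borel_measurable_scaleR borel_measurable_integrable[OF G]) simp
      show "(\<lambda>x. bump c d n x *\<^sub>R G x) \<in> borel_measurable lborel" for n
      proof -
        have "continuous_on UNIV (bump c d n)"
          by (meson DERIV_isCont continuous_at_imp_continuous_on smooth_bump smooth_has_derivative)
        then have "bump c d n \<in> borel_measurable borel"
          by (rule borel_measurable_continuous_onI)
        then show ?thesis
          by (intro borel_measurable_scaleR borel_measurable_integrable[OF G]) simp
      qed
      show "AE x in lborel. (\<lambda>n. bump c d n x *\<^sub>R G x) \<longlonglongrightarrow> indicator {c<..<d} x *\<^sub>R G x"
        by (intro AE_I2 tendsto_intros bump_tendsto)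
      show "AE x in lborel. norm (bump c d n x *\<^sub>R G x) \<le> norm (G x)" for n
        by (intro AE_I2) (simp add: abs_of_nonneg bump_bounds mult_left_le_one_le)
    qed
    moreover have "(LINT x|lborel. bump c d n x *\<^sub>R G x) = 0" if "n > 0" for n
    proof -
      have "(LINT x|lborel. bump c d n x *\<^sub>R G x) = (LINT x:{a<..<b}|lborel. bump c d n x *\<^sub>R f x)"
        unfolding set_lebesgue_integral_def G_def by (simp add: mult.commute)
      then show ?thesis
        using zero bump_test_function that cd by simp
    qed
    then have "(\<lambda>n. LINT x|lborel. bump c d n x *\<^sub>R G x) \<longlonglongrightarrow> 0"
      by (intro tendsto_eventually) (auto simp: eventually_sequentially intro!: exI[of _ 1])
    ultimately show "(LINT x:{c<..<d}|lborel. G x) = 0"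
      unfolding set_lebesgue_integral_def by (rule LIMSEQ_unique)
  qed (simp add: G_def)
  then show ?thesis
    by eventually_elim (auto simp: G_def split: split_indicator_asm)
qed

text \<open>The du Bois-Reymond lemma. Subtracting a multiple of a fixed \<eta> of integral one
  turns any test function into the derivative of a test function, so \<open>f\<close> minus its
  average against \<eta> is weakly zero.\<close>

theorem weak_derivative_zero_imp_AE_const:
  fixes f :: "real \<Rightarrow> 'a::euclidean_space"
  assumes f: "set_integrable lborel {a<..<b} f" and "a < b"
    and zero: "\<And>\<phi>. \<phi> \<in> test_functions a b \<Longrightarrow> (LINT x:{a<..<b}|lborel. deriv \<phi> x *\<^sub>R f x) = 0"
  shows "\<exists>c. AE x in lborel. x \<in> {a<..<b} \<longrightarrow> f x = c"
proof -
  obtain \<eta> where \<eta>: "\<eta> \<in> test_functions a b" "(LINT x|lborel. \<eta> x) = 1"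
    using test_function_integral_1[OF \<open>a < b\<close>] by blast
  define c where "c = (LINT x:{a<..<b}|lborel. \<eta> x *\<^sub>R f x)"
  have const: "set_integrable lborel {a<..<b} (\<lambda>x. c)"
    unfolding set_integrable_def using \<open>a < b\<close>
    by (intro integrable_scaleR_left integrable_real_indicator) auto
  have "AE x in lborel. x \<in> {a<..<b} \<longrightarrow> f x - c = 0"
  proof (rule weakly_zero_imp_AE_zero)
    show "set_integrable lborel {a<..<b} (\<lambda>x. f x - c)"
      using f const by (rule set_integral_diff)
    fix \<phi> assume \<phi>: "\<phi> \<in> test_functions a b"
    define s where "s = (LINT x|lborel. \<phi> x)"
    have "(\<lambda>x. \<phi> x + (- s) * \<eta> x) \<in> test_functions a b"
      by (intro test_function_add test_function_cmult \<phi> \<eta>)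
    moreover have "(LINT x|lborel. \<phi> x + (- s) * \<eta> x) = 0"
      using test_function_integrable[OF \<phi>] test_function_integrable[OF \<eta>(1)] \<eta>(2)
      by (simp add: s_def)
    ultimately obtain \<psi> where \<psi>: "\<psi> \<in> test_functions a b" "deriv \<psi> = (\<lambda>x. \<phi> x + (- s) * \<eta> x)"
      using test_function_antiderivative[OF _ \<open>a < b\<close>] by blast
    have "0 = (LINT x:{a<..<b}|lborel. deriv \<psi> x *\<^sub>R f x)"
      using zero[OF \<psi>(1)] by simp
    also have "\<dots> = (LINT x:{a<..<b}|lborel. \<phi> x *\<^sub>R f x - s *\<^sub>R (\<eta> x *\<^sub>R f x))"
      by (simp add: \<psi> algebra_simps)
    also have "\<dots> = (LINT x:{a<..<b}|lborel. \<phi> x *\<^sub>R f x) - s *\<^sub>R c"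
      unfolding c_def set_integral_scaleR_right[symmetric]
      using test_function_bounded_mult_integrable[OF \<phi> f] test_function_bounded_mult_integrable[OF \<eta>(1) f]
      by (intro set_integral_diff set_integrable_scaleR_right)
    finally have "(LINT x:{a<..<b}|lborel. \<phi> x *\<^sub>R f x) = s *\<^sub>R c"
      by simp
    moreover have "(LINT x:{a<..<b}|lborel. \<phi> x *\<^sub>R c) = s *\<^sub>R c"
    proof -
      have "(LINT x:{a<..<b}|lborel. \<phi> x *\<^sub>R c) = (LINT x|lborel. \<phi> x *\<^sub>R c)"
        unfolding set_lebesgue_integral_def using test_function_eq_0[OF \<phi>]
        by (intro Bochner_Integration.integral_cong) (auto split: split_indicator)
      then show ?thesis
        using test_function_integrable[OF \<phi>] by (simp add: s_def)
    qed
    ultimately show "(LINT x:{a<..<b}|lborel. \<phi> x *\<^sub>R (f x - c)) = 0"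
      using test_function_bounded_mult_integrable[OF \<phi> f] test_function_bounded_mult_integrable[OF \<phi> const]
      by (simp add: scaleR_diff_right set_integral_diff)
  qed
  then show ?thesis
    by auto
qed

text \<open>As \<open>g\<close> is merely integrable, integration by parts is done by Fubini on the
  triangle \<open>a < t < x < b\<close>: the inner integral of \<open>deriv \<phi>\<close> over
  \<open>x > t\<close> is \<open>- \<phi> t\<close>, because \<phi> vanishes at
  \<open>b\<close>.\<close>

lemma set_integral_by_parts_test_function:
  fixes g :: "real \<Rightarrow> 'a::euclidean_space"
  assumes \<phi>: "\<phi> \<in> test_functions a b" and g: "set_integrable lborel {a<..<b} g"
  shows "(LINT x:{a<..<b}|lborel. deriv \<phi> x *\<^sub>R (LINT t:{a<..<x}|lborel. g t)) =
    - (LINT t:{a<..<b}|lborel. \<phi> t *\<^sub>R g t)"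
proof -
  define G where "G t = indicator {a<..<b} t *\<^sub>R g t" for t
  have G: "integrable lborel G"
    using g by (simp add: set_integrable_def G_def[abs_def])
  then have [measurable]: "G \<in> borel_measurable borel"
    by auto
  have d\<phi>: "deriv \<phi> \<in> test_functions a b"
    using \<phi> by (rule test_function_deriv)
  then have [measurable]: "deriv \<phi> \<in> borel_measurable borel"
    by (rule test_function_measurable)
  have d\<phi>_int: "integrable lborel (deriv \<phi>)"
    using d\<phi> by (rule test_function_integrable)
  define F where "F t x = (deriv \<phi> x * indicator {t<..} x) *\<^sub>R G t" for t x
  have F_meas: "case_prod F \<in> borel_measurable (lborel \<Otimes>\<^sub>M lborel)"
  proof -
    have "(\<lambda>p. (deriv \<phi> (snd p) * indicator {p. fst p < snd p} p) *\<^sub>R G (fst p))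
        \<in> borel_measurable (lborel \<Otimes>\<^sub>M lborel)"
      by measurable
    moreover have "(\<lambda>p. (deriv \<phi> (snd p) * indicator {p. fst p < snd p} p) *\<^sub>R G (fst p)) = case_prod F"
      by (auto simp: F_def fun_eq_iff split: split_indicator)
    ultimately show ?thesis
      by simp
  qed
  have slice: "integrable lborel (\<lambda>x. deriv \<phi> x * indicator {t<..} x)" for t
    using integrable_mult_indicator[OF _ d\<phi>_int, of "{t<..}"] by (simp add: mult.commute)
  then have F_slice: "integrable lborel (F t)" for t
    unfolding F_def by (intro integrable_scaleR_left)
  have F_int: "integrable (lborel \<Otimes>\<^sub>M lborel) (case_prod F)"
  proof (rule lborel_pair.Fubini_integrable)
    show "integrable lborel (\<lambda>t. LINT x|lborel. norm (case_prod F (t, x)))"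
    proof (rule Bochner_Integration.integrable_bound)
      show "integrable lborel (\<lambda>t. (LINT x|lborel. \<bar>deriv \<phi> x\<bar>) *\<^sub>R G t)"
        using G by simp
      show "(\<lambda>t. LINT x|lborel. norm (case_prod F (t, x))) \<in> borel_measurable lborel"
        using measurable_compose[OF F_meas borel_measurable_norm]
        by (intro lborel.borel_measurable_lebesgue_integral) (simp add: case_prod_unfold)
      show "AE t in lborel. norm (LINT x|lborel. norm (case_prod F (t, x)))
          \<le> norm ((LINT x|lborel. \<bar>deriv \<phi> x\<bar>) *\<^sub>R G t)"
      proof (rule AE_I2)
        fix t
        have "(LINT x|lborel. norm (F t x)) \<le> (LINT x|lborel. \<bar>deriv \<phi> x\<bar> * norm (G t))"
          by (intro integral_mono integrable_norm F_slice integrable_mult_left integrable_abs d\<phi>_int)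
            (auto simp: F_def abs_mult mult_right_mono split: split_indicator)
        then show "norm (LINT x|lborel. norm (case_prod F (t, x)))
            \<le> norm ((LINT x|lborel. \<bar>deriv \<phi> x\<bar>) *\<^sub>R G t)"
          by simp
      qed
    qed
    show "AE t in lborel. integrable lborel (\<lambda>x. case_prod F (t, x))"
      using F_slice by simp
  qed (fact F_meas)
  have "(LINT x:{a<..<b}|lborel. deriv \<phi> x *\<^sub>R (LINT t:{a<..<x}|lborel. g t)) =
      (LINT x|lborel. LINT t|lborel. F t x)"
    unfolding set_lebesgue_integral_def
  proof (intro Bochner_Integration.integral_cong refl)
    fix x
    show "indicator {a<..<b} x *\<^sub>R deriv \<phi> x *\<^sub>R (LINT t|lborel. indicator {a<..<x} t *\<^sub>R g t) =
      (LINT t|lborel. F t x)"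
    proof (cases "x \<in> {a<..<b}")
      case True
      then have "F t x = deriv \<phi> x *\<^sub>R (indicator {a<..<x} t *\<^sub>R g t)" for t
        by (auto simp: F_def G_def split: split_indicator)
      then have "(LINT t|lborel. F t x) = deriv \<phi> x *\<^sub>R (LINT t|lborel. indicator {a<..<x} t *\<^sub>R g t)"
        by (simp only: integral_scaleR_right)
      then show ?thesis
        using True by simp
    next
      case False
      then have "F t x = 0" for t
        using test_function_eq_0[OF d\<phi>] by (auto simp: F_def)
      then show ?thesis
        using False by simp
    qed
  qed
  also have "\<dots> = (LINT t|lborel. LINT x|lborel. F t x)"
    by (rule lborel_pair.Fubini_integral[OF F_int])
  also have "\<dots> = (LINT t|lborel. - (indicator {a<..<b} t *\<^sub>R (\<phi> t *\<^sub>R g t)))"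
  proof (intro Bochner_Integration.integral_cong refl)
    fix t
    show "(LINT x|lborel. F t x) = - (indicator {a<..<b} t *\<^sub>R (\<phi> t *\<^sub>R g t))"
    proof (cases "t \<in> {a<..<b}")
      case True
      \<comment> \<open>Passing to the closed interval changes the integrand only at the single
        point \<open>t\<close>; beyond \<open>b\<close> it is zero anyway.\<close>
      have "(LINT x|lborel. deriv \<phi> x * indicator {t<..} x) = (LINT x:{t..b}|lborel. deriv \<phi> x)"
        unfolding set_lebesgue_integral_def
      proof (rule integral_cong_AE)
        show "AE x in lborel. deriv \<phi> x * indicator {t<..} x = indicator {t..b} x *\<^sub>R deriv \<phi> x"
          using AE_lborel_singleton[of t] by eventually_elim (use test_function_eq_0[OF d\<phi>] in \<open>auto split: split_indicator\<close>)
      qed simp_all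
      also have "\<dots> = \<phi> b - \<phi> t"
        using True smooth_has_derivative[OF test_function_smooth[OF \<phi>]]
        by (intro test_function_integral_deriv[OF _ d\<phi>]) auto
      finally have "(LINT x|lborel. F t x) = (\<phi> b - \<phi> t) *\<^sub>R G t"
        unfolding F_def by (subst integral_scaleR_left) (simp_all only: slice)
      then show ?thesis
        using True test_function_eq_0[OF \<phi>, of b] by (simp add: G_def)
    qed (simp add: F_def G_def)
  qed
  finally show ?thesis
    by (simp add: set_lebesgue_integral_def)
qed

lemma continuous_on_indefinite_set_integral:
  fixes g :: "real \<Rightarrow> 'a::euclidean_space"
  assumes g: "set_integrable lborel {a<..<b} g"
  shows "continuous_on {a..b} (\<lambda>x. LINT t:{a<..<x}|lborel. g t)"
proof -
  have "g integrable_on {a..b}"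
    using set_borel_integral_eq_integral(1)[OF g] by (simp add: integrable_on_open_interval_real)
  then have "continuous_on {a..b} (\<lambda>x. integral {a..x} g)"
    by (rule indefinite_integral_continuous_1)
  then show ?thesis
  proof (rule continuous_on_eq)
    fix x assume "x \<in> {a..b}"
    then have "set_integrable lborel {a<..<x} g"
      by (intro set_integrable_subset[OF g]) auto
    then show "integral {a..x} g = (LINT t:{a<..<x}|lborel. g t)"
      using set_borel_integral_eq_integral(2)[of "{a<..<x}" g] by (simp add: integral_open_interval_real)
  qed
qed

section \<open>Primitives in the space of square integrable functions\<close>

text \<open>Links a class with any one of its representatives. Equality of classes becomes almost
  everywhere equality of functions, and for elements of \<open>L2_on a b\<close> a representative
  vanishing outside the interval can be chosen.\<close>

definition represents :: "'a::{real_normed_field,euclidean_space} L2 \<Rightarrow> (real \<Rightarrow> 'a) \<Rightarrow> bool" where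
  "represents u f \<longleftrightarrow> square_integrable f \<and> u = abs_L2 f"

lemma l2_rel_refl: "l2_rel f f \<longleftrightarrow> square_integrable f"
  by (simp add: l2_rel_def)

lemma representsE:
  obtains f where "represents u f"
proof
  show "represents u (rep_L2 u)"
    using Quotient_abs_rep[OF Quotient_L2, of u] Quotient_rep_reflp[OF Quotient_L2, of u]
    by (simp add: represents_def l2_rel_refl)
qed

lemma represents_abs: "square_integrable f \<Longrightarrow> represents (abs_L2 f) f"
  by (simp add: represents_def)

lemma represents_eq_iff:
  assumes "represents u f" "represents v g"
  shows "u = v \<longleftrightarrow> (AE x in lborel. f x = g x)"
  using Quotient_rel[OF Quotient_L2, of f g] assms by (auto simp: represents_def l2_rel_def)

lemma represents_square_integrable: "represents u f \<Longrightarrow> square_integrable f"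
  by (simp add: represents_def)

lemma represents_0: "represents 0 (\<lambda>x. 0)"
  by (simp add: represents_def square_integrable_0 zero_L2_def)

lemma represents_add:
  "represents u f \<Longrightarrow> represents v g \<Longrightarrow> represents (u + v) (\<lambda>x. f x + g x)"
  by (simp add: represents_def square_integrable_add plus_L2.abs_eq l2_rel_refl)

lemma represents_scale: "represents u f \<Longrightarrow> represents (l2_scale c u) (\<lambda>x. c * f x)"
  by (simp add: represents_def square_integrable_scale l2_scale.abs_eq l2_rel_refl)

lemma represents_shift: "represents u f \<Longrightarrow> represents (l2_shift h u) (\<lambda>t. f (t + h))"
  by (simp add: represents_def square_integrable_shift l2_shift.abs_eq l2_rel_refl)

lemma represents_restrict:
  "represents u f \<Longrightarrow> represents (l2_restrict a b u) (\<lambda>t. indicator {a<..<b} t *\<^sub>R f t)"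
  by (simp add: represents_def square_integrable_restrict l2_restrict.abs_eq l2_rel_refl)

lemma l2_norm_eq: "represents u f \<Longrightarrow> l2_norm u = sqrt (\<integral>x. (norm (f x))\<^sup>2 \<partial>lborel)"
  by (simp add: represents_def l2_norm.abs_eq l2_rel_refl)

lemma is_weak_deriv_iff:
  "represents u f \<Longrightarrow> represents v g \<Longrightarrow> is_weak_deriv a b m u v \<longleftrightarrow>
    (\<forall>\<phi>\<in>test_functions a b.
        (LINT x:{a<..<b}|lborel. (deriv ^^ m) \<phi> x *\<^sub>R f x) =
        (- 1) ^ m *\<^sub>R (LINT x:{a<..<b}|lborel. \<phi> x *\<^sub>R g x))"
  by (simp add: represents_def is_weak_deriv.abs_eq l2_rel_refl)

lemma is_continuous_rep_iff:
  "represents u f \<Longrightarrow> is_continuous_rep a b u h \<longleftrightarrow>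
    continuous_on {a..b} h \<and> (AE x in lborel. x \<in> {a<..<b} \<longrightarrow> f x = h x)"
  by (simp add: represents_def is_continuous_rep.abs_eq l2_rel_refl)

lemma L2_on_iff:
  "represents u f \<Longrightarrow> u \<in> L2_on a b \<longleftrightarrow> (AE x in lborel. x \<notin> {a<..<b} \<longrightarrow> f x = 0)"
  unfolding L2_on_def mem_Collect_eq
  by (subst represents_eq_iff[OF represents_restrict]) (auto intro!: AE_cong split: split_indicator)

lemma L2_on_representsE:
  assumes "u \<in> L2_on a b"
  obtains f where "represents u f" "\<And>x. x \<notin> {a<..<b} \<Longrightarrow> f x = 0"
proof -
  obtain f where "represents u f"
    by (rule representsE)
  then have "represents u (\<lambda>t. indicator {a<..<b} t *\<^sub>R f t)"
    using assms represents_restrict[of u f a b] by (simp add: L2_on_def)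
  then show thesis
    by (rule that) simp
qed

lemma subspace_L2_on: "l2.subspace (L2_on a b)"
proof (rule l2.subspaceI)
  show "0 \<in> L2_on a b"
    by (simp add: L2_on_iff[OF represents_0])
next
  fix u v :: "'a L2" and c :: 'a
  assume "u \<in> L2_on a b"
  then obtain f where f: "represents u f" "\<And>x. x \<notin> {a<..<b} \<Longrightarrow> f x = 0"
    by (rule L2_on_representsE) blast
  then show "l2_scale c u \<in> L2_on a b"
    by (simp add: L2_on_iff[OF represents_scale])
  assume "v \<in> L2_on a b"
  then obtain g where g: "represents v g" "\<And>x. x \<notin> {a<..<b} \<Longrightarrow> g x = 0"
    by (rule L2_on_representsE) blast
  show "u + v \<in> L2_on a b"
    using f g by (simp add: L2_on_iff[OF represents_add])
qed

lemma l2_restrict_in_L2_on: "l2_restrict a b u \<in> L2_on a b"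
proof -
  obtain f where f: "represents u f"
    by (rule representsE)
  show ?thesis
    by (simp add: L2_on_iff[OF represents_restrict[OF f]])
qed

section \<open>Integrals and norms of square integrable functions\<close>

lemma integrable_power2_norm: "square_integrable f \<Longrightarrow> integrable lborel (\<lambda>x. (norm (f x))\<^sup>2)"
  by (simp add: square_integrable_def)

lemma square_integrable_imp_set_integrable:
  fixes f :: "real \<Rightarrow> 'a::{real_normed_field,euclidean_space}"
  assumes f: "square_integrable f" and S: "S \<in> sets borel" "emeasure lborel S < \<infinity>"
  shows "set_integrable lborel S f"
  unfolding set_integrable_def
proof (rule Bochner_Integration.integrable_bound)
  show "integrable lborel (\<lambda>x. indicator S x + (norm (f x))\<^sup>2)"
    using S integrable_power2_norm[OF f] by (intro Bochner_Integration.integrable_add) auto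
  have "f \<in> borel_measurable lborel"
    using f by (simp add: square_integrable_def)
  then show "(\<lambda>x. indicator S x *\<^sub>R f x) \<in> borel_measurable lborel"
    using S by (intro borel_measurable_scaleR) auto
  have "y \<le> 1 + y\<^sup>2" if "y \<ge> 0" for y :: real
    using zero_le_power2[of "y - 1 / 2"] by (simp add: power2_eq_square algebra_simps)
  then show "AE x in lborel. norm (indicator S x *\<^sub>R f x) \<le> norm (indicator S x + (norm (f x))\<^sup>2)"
    by (intro AE_I2) (auto split: split_indicator)
qed

text \<open>The inequality \<open>y \<le> s / 2 + y^2 / (2 s)\<close>, with \<open>s\<close> the
  norm of \<open>f\<close>, is integrated over \<open>S\<close>; this produces
  \<open>(measure lborel S + 1) / 2\<close> where Cauchy-Schwarz has the square root of the measure.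
  The division by \<open>s\<close> is the reason for the case distinction.\<close>

lemma norm_set_integral_le_L2:
  fixes f :: "real \<Rightarrow> 'a::{real_normed_field,euclidean_space}"
  assumes f: "square_integrable f" and S: "S \<in> sets borel" "emeasure lborel S < \<infinity>"
  shows "norm (LINT x:S|lborel. f x) \<le>
    (measure lborel S + 1) / 2 * sqrt (\<integral>x. (norm (f x))\<^sup>2 \<partial>lborel)"
proof -
  define s where "s = sqrt (\<integral>x. (norm (f x))\<^sup>2 \<partial>lborel)"
  have f_meas: "f \<in> borel_measurable lborel"
    using f by (simp add: square_integrable_def)
  have s2: "s\<^sup>2 = (\<integral>x. (norm (f x))\<^sup>2 \<partial>lborel)"
    by (simp add: s_def)
  show ?thesis
  proof (cases "s = 0")
    case True
    then have "(\<integral>x. (norm (f x))\<^sup>2 \<partial>lborel) = 0"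
      using s2 by simp
    then have "AE x in lborel. (norm (f x))\<^sup>2 = 0"
      using integral_nonneg_eq_0_iff_AE[OF integrable_power2_norm[OF f]] by simp
    then have "AE x in lborel. indicator S x *\<^sub>R f x = 0"
      by eventually_elim simp
    then have "(LINT x:S|lborel. f x) = 0"
      unfolding set_lebesgue_integral_def by (rule integral_eq_zero_AE)
    then show ?thesis
      by (simp add: s_def[symmetric] True)
  next
    case False
    then have s: "s > 0"
      by (simp add: s_def order_less_le)
    have int: "integrable lborel (\<lambda>x. s / 2 * indicator S x + 1 / (2 * s) * (norm (f x))\<^sup>2)"
      using S integrable_power2_norm[OF f]
      by (intro Bochner_Integration.integrable_add integrable_mult_right integrable_real_indicator) auto
    have "norm (LINT x:S|lborel. f x) \<le> (LINT x|lborel. norm (indicator S x *\<^sub>R f x))"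
      unfolding set_lebesgue_integral_def by (rule integral_norm_bound)
    also have "\<dots> \<le> (LINT x|lborel. s / 2 * indicator S x + 1 / (2 * s) * (norm (f x))\<^sup>2)"
    proof (rule integral_mono)
      show "integrable lborel (\<lambda>x. norm (indicator S x *\<^sub>R f x))"
        using square_integrable_imp_set_integrable[OF assms] unfolding set_integrable_def
        by (rule integrable_norm)
      have "y \<le> s / 2 + 1 / (2 * s) * y\<^sup>2" for y
        using zero_le_power2[of "y - s"] s by (simp add: power2_eq_square field_simps)
      then show "norm (indicator S x *\<^sub>R f x) \<le> s / 2 * indicator S x + 1 / (2 * s) * (norm (f x))\<^sup>2" for x
        using s by (auto split: split_indicator)
    qed (fact int)
    also have "\<dots> = s / 2 * measure lborel S + 1 / (2 * s) * s\<^sup>2"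
      using S integrable_power2_norm[OF f] by (simp add: s2)
    also have "\<dots> = (measure lborel S + 1) / 2 * s"
      using s by (simp add: power2_eq_square field_simps)
    finally show ?thesis
      by (simp add: s_def)
  qed
qed

lemma l2_norm_nonneg: "0 \<le> l2_norm u"
proof -
  obtain f where f: "represents u f"
    by (rule representsE)
  show ?thesis
    by (simp add: l2_norm_eq[OF f])
qed

lemma l2_norm_0: "l2_norm 0 = 0"
  by (simp add: l2_norm_eq[OF represents_0])

lemma l2_norm_eq_0_imp: "l2_norm u = 0 \<Longrightarrow> u = 0"
proof -
  assume *: "l2_norm u = 0"
  obtain f where f: "represents u f"
    by (rule representsE)
  have "(\<integral>x. (norm (f x))\<^sup>2 \<partial>lborel) = 0"
    using * by (simp add: l2_norm_eq[OF f])
  then have "AE x in lborel. (norm (f x))\<^sup>2 = 0"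
    using integral_nonneg_eq_0_iff_AE[OF integrable_power2_norm] represents_square_integrable[OF f] by fastforce
  then show "u = 0"
    using represents_eq_iff[OF f represents_0] by simp
qed

lemma l2_norm_scale: "l2_norm (l2_scale c u) = norm c * l2_norm u"
proof -
  obtain f where f: "represents u f"
    by (rule representsE)
  show ?thesis
    by (simp add: l2_norm_eq[OF f] l2_norm_eq[OF represents_scale[OF f]] norm_mult
        power_mult_distrib real_sqrt_mult)
qed

lemma l2_norm_shift: "l2_norm (l2_shift h u) = l2_norm u"
proof -
  obtain f where f: "represents u f"
    by (rule representsE)
  have "(\<integral>x. (norm (f (x + h)))\<^sup>2 \<partial>lborel) = (\<integral>x. (norm (f x))\<^sup>2 \<partial>lborel)"
    using lborel_integral_real_affine[of 1 "\<lambda>x. (norm (f x))\<^sup>2" h] by (simp add: add.commute)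
  then show ?thesis
    by (simp add: l2_norm_eq[OF f] l2_norm_eq[OF represents_shift[OF f]])
qed

lemma l2_norm_mono:
  assumes "represents u f" "represents v g" "AE x in lborel. norm (f x) \<le> norm (g x)"
  shows "l2_norm u \<le> l2_norm v"
  using assms(3) unfolding l2_norm_eq[OF assms(1)] l2_norm_eq[OF assms(2)]
  by (intro real_sqrt_le_mono integral_mono_AE integrable_power2_norm
      represents_square_integrable[OF assms(1)] represents_square_integrable[OF assms(2)])
    (auto elim!: eventually_mono intro: power_mono)

lemma l2_norm_restrict_le: "l2_norm (l2_restrict a b u) \<le> l2_norm u"
proof -
  obtain f where f: "represents u f"
    by (rule representsE)
  show ?thesis
    by (rule l2_norm_mono[OF represents_restrict[OF f] f]) (auto split: split_indicator)
qed

text \<open>The factor 2 stems from \<open>(x + y)^2 \<le> 2 x^2 + 2 y^2\<close>. This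
  quasi-triangle inequality serves both for boundedness and for uniqueness of limits.\<close>

lemma l2_norm_add_le: "l2_norm (u + v) \<le> 2 * (l2_norm u + l2_norm v)"
proof -
  obtain f g where f: "represents u f" and g: "represents v g"
    using representsE by metis
  have int: "integrable lborel (\<lambda>x. (norm (f x))\<^sup>2)" "integrable lborel (\<lambda>x. (norm (g x))\<^sup>2)"
    "integrable lborel (\<lambda>x. (norm (f x + g x))\<^sup>2)"
    using f g represents_add[OF f g] by (simp_all add: represents_def integrable_power2_norm)
  have sq: "(l2_norm u)\<^sup>2 = (\<integral>x. (norm (f x))\<^sup>2 \<partial>lborel)" "(l2_norm v)\<^sup>2 = (\<integral>x. (norm (g x))\<^sup>2 \<partial>lborel)"
    "(l2_norm (u + v))\<^sup>2 = (\<integral>x. (norm (f x + g x))\<^sup>2 \<partial>lborel)"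
    by (simp_all add: l2_norm_eq[OF f] l2_norm_eq[OF g] l2_norm_eq[OF represents_add[OF f g]])
  have "(l2_norm (u + v))\<^sup>2 \<le> (\<integral>x. 2 * (norm (f x))\<^sup>2 + 2 * (norm (g x))\<^sup>2 \<partial>lborel)"
    unfolding sq
  proof (rule integral_mono)
    show "integrable lborel (\<lambda>x. 2 * (norm (f x))\<^sup>2 + 2 * (norm (g x))\<^sup>2)"
      using int by simp
    fix x
    have "(norm (f x + g x))\<^sup>2 \<le> (norm (f x) + norm (g x))\<^sup>2"
      by (simp add: norm_triangle_ineq power_mono)
    also have "\<dots> \<le> 2 * (norm (f x))\<^sup>2 + 2 * (norm (g x))\<^sup>2"
      using sum_squares_bound[of "norm (f x)" "norm (g x)"] by (simp add: power2_sum)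
    finally show "(norm (f x + g x))\<^sup>2 \<le> 2 * (norm (f x))\<^sup>2 + 2 * (norm (g x))\<^sup>2" .
  qed (fact int)
  also have "\<dots> = 2 * (l2_norm u)\<^sup>2 + 2 * (l2_norm v)\<^sup>2"
    using int by (simp add: sq)
  also have "\<dots> \<le> (2 * (l2_norm u + l2_norm v))\<^sup>2"
    using l2_norm_nonneg[of u] l2_norm_nonneg[of v] by (simp add: power2_eq_square algebra_simps)
  finally show ?thesis
    by (rule power2_le_imp_le) (simp add: l2_norm_nonneg)
qed

lemma square_integrable_bounded_support:
  fixes f :: "real \<Rightarrow> 'a::{real_normed_field,euclidean_space}"
  assumes "f \<in> borel_measurable borel" "\<And>x. norm (f x) \<le> C" "\<And>x. x \<notin> {a<..<b} \<Longrightarrow> f x = 0"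
  shows "square_integrable f"
  unfolding square_integrable_def
proof
  show "integrable lborel (\<lambda>x. (norm (f x))\<^sup>2)"
  proof (rule Bochner_Integration.integrable_bound)
    show "integrable lborel (\<lambda>x. C\<^sup>2 * indicator {a<..<b} x)"
      by (cases "a \<le> b") (auto intro!: integrable_real_indicator)
    show "AE x in lborel. norm ((norm (f x))\<^sup>2) \<le> norm (C\<^sup>2 * indicator {a<..<b} x)"
      using assms(2,3) by (intro AE_I2) (auto split: split_indicator intro: power_mono)
  qed (use assms in simp)
qed (use assms in simp)

lemma emeasure_Ioo_finite: "emeasure lborel {a<..<b::real} < \<infinity>"
  by (cases "a \<le> b") auto

lemma represents_set_integrable: "represents u f \<Longrightarrow> set_integrable lborel {a<..<b} f"
  by (intro square_integrable_imp_set_integrable represents_square_integrable emeasure_Ioo_finite) auto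

lemma represents_norm_set_integral_le:
  assumes "represents u f"
  shows "norm (LINT x:{a<..<b}|lborel. f x) \<le> (max 0 (b - a) + 1) / 2 * l2_norm u"
proof -
  have "measure lborel {a<..<b} = max 0 (b - a)"
    by (cases "a \<le> b") auto
  then show ?thesis
    using norm_set_integral_le_L2[OF represents_square_integrable[OF assms], of "{a<..<b}"]
      emeasure_Ioo_finite[of a b] by (simp add: l2_norm_eq[OF assms])
qed

section \<open>Primitives, integrals and constants on an interval\<close>

lemma square_integrable_primitive:
  fixes f :: "real \<Rightarrow> 'a::{real_normed_field,euclidean_space}"
  assumes "square_integrable f"
  shows "square_integrable (\<lambda>x. indicator {a<..<b} x *\<^sub>R (LINT t:{a<..<x}|lborel. f t))"
proof (rule square_integrable_bounded_support[where a = a and b = b])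
  have rep: "represents (abs_L2 f) f"
    using assms by (rule represents_abs)
  let ?C = "(max 0 (b - a) + 1) / 2 * l2_norm (abs_L2 f)"
  have "set_integrable lborel {a<..<b} f"
    using rep by (rule represents_set_integrable)
  then have "continuous_on {a<..<b} (\<lambda>x. LINT t:{a<..<x}|lborel. f t)"
    by (intro continuous_on_subset[OF continuous_on_indefinite_set_integral]) auto
  then show "(\<lambda>x. indicator {a<..<b} x *\<^sub>R (LINT t:{a<..<x}|lborel. f t)) \<in> borel_measurable borel"
    by (intro borel_measurable_continuous_on_indicator) auto
  show "norm (indicator {a<..<b} x *\<^sub>R (LINT t:{a<..<x}|lborel. f t)) \<le> ?C" for x
  proof (cases "x \<in> {a<..<b}")
    case True
    have "norm (LINT t:{a<..<x}|lborel. f t) \<le> (max 0 (x - a) + 1) / 2 * l2_norm (abs_L2 f)"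
      using rep by (rule represents_norm_set_integral_le)
    also have "\<dots> \<le> ?C"
      using True by (intro mult_right_mono) (auto simp: l2_norm_nonneg)
    finally show ?thesis
      using True by simp
  qed (simp add: l2_norm_nonneg)
qed simp

lift_definition primitive ::
    "real \<Rightarrow> real \<Rightarrow> 'a::{real_normed_field,euclidean_space} L2 \<Rightarrow> 'a L2"
  is "\<lambda>a b f x. indicator {a<..<b} x *\<^sub>R (LINT t:{a<..<x}|lborel. f t)"
proof -
  fix a b and f g :: "real \<Rightarrow> 'a"
  assume "l2_rel f g"
  then have [measurable]: "f \<in> borel_measurable borel" "g \<in> borel_measurable borel"
    and sq: "square_integrable f" "square_integrable g" and "AE x in lborel. f x = g x"
    by (auto simp: l2_rel_def square_integrable_def)
  then have "(LINT t:{a<..<x}|lborel. f t) = (LINT t:{a<..<x}|lborel. g t)" for x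
    unfolding set_lebesgue_integral_def by (intro integral_cong_AE) auto
  then show "l2_rel (\<lambda>x. indicator {a<..<b} x *\<^sub>R (LINT t:{a<..<x}|lborel. f t))
      (\<lambda>x. indicator {a<..<b} x *\<^sub>R (LINT t:{a<..<x}|lborel. g t))"
    using sq by (simp add: l2_rel_def square_integrable_primitive)
qed

lift_definition l2_integral ::
    "real \<Rightarrow> real \<Rightarrow> 'a::{real_normed_field,euclidean_space} L2 \<Rightarrow> 'a"
  is "\<lambda>a b f. LINT t:{a<..<b}|lborel. f t"
proof -
  fix a b and f g :: "real \<Rightarrow> 'a"
  assume "l2_rel f g"
  then have [measurable]: "f \<in> borel_measurable borel" "g \<in> borel_measurable borel"
    and "AE x in lborel. f x = g x"
    by (auto simp: l2_rel_def square_integrable_def)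
  then show "(LINT t:{a<..<b}|lborel. f t) = (LINT t:{a<..<b}|lborel. g t)"
    unfolding set_lebesgue_integral_def by (intro integral_cong_AE) auto
qed

definition one_on :: "real \<Rightarrow> real \<Rightarrow> 'a::{real_normed_field,euclidean_space} L2" where
  "one_on a b = abs_L2 (\<lambda>x. indicator {a<..<b} x *\<^sub>R 1)"

lemma represents_primitive:
  "represents u f \<Longrightarrow> represents (primitive a b u) (\<lambda>x. indicator {a<..<b} x *\<^sub>R (LINT t:{a<..<x}|lborel. f t))"
  by (simp add: represents_def square_integrable_primitive primitive.abs_eq l2_rel_refl)

lemma l2_integral_eq: "represents u f \<Longrightarrow> l2_integral a b u = (LINT t:{a<..<b}|lborel. f t)"
  by (simp add: represents_def l2_integral.abs_eq l2_rel_refl)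

lemma represents_one_on: "represents (one_on a b) (\<lambda>x. indicator {a<..<b} x *\<^sub>R 1)"
  unfolding one_on_def
  by (intro represents_abs square_integrable_bounded_support[of _ 1 a b]) (auto split: split_indicator)

lemma primitive_add: "primitive a b (u + v) = primitive a b u + primitive a b v"
proof -
  obtain f g where f: "represents u f" and g: "represents v g"
    using representsE by metis
  show ?thesis
    unfolding represents_eq_iff[OF represents_primitive[OF represents_add[OF f g]]
        represents_add[OF represents_primitive[OF f] represents_primitive[OF g]]]
    by (subst set_integral_add) (simp_all add: represents_set_integrable[OF f] represents_set_integrable[OF g] scaleR_add_right)
qed

lemma primitive_scale: "primitive a b (l2_scale c u) = l2_scale c (primitive a b u)"
proof -
  obtain f where f: "represents u f"
    by (rule representsE)
  show ?thesis
    unfolding represents_eq_iff[OF represents_primitive[OF represents_scale[OF f]]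
        represents_scale[OF represents_primitive[OF f]]]
    by simp
qed

lemma l2_integral_add: "l2_integral a b (u + v) = l2_integral a b u + l2_integral a b v"
proof -
  obtain f g where f: "represents u f" and g: "represents v g"
    using representsE by metis
  show ?thesis
    using represents_set_integrable[OF f] represents_set_integrable[OF g]
    by (simp add: l2_integral_eq[OF f] l2_integral_eq[OF g] l2_integral_eq[OF represents_add[OF f g]])
qed

lemma l2_integral_scale: "l2_integral a b (l2_scale c u) = c * l2_integral a b u"
proof -
  obtain f where f: "represents u f"
    by (rule representsE)
  show ?thesis
    by (simp add: l2_integral_eq[OF f] l2_integral_eq[OF represents_scale[OF f]])
qed

lemma l2_integral_bound: "norm (l2_integral a b u) \<le> (max 0 (b - a) + 1) / 2 * l2_norm u"
proof -
  obtain f where f: "represents u f"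
    by (rule representsE)
  show ?thesis
    using represents_norm_set_integral_le[OF f] by (simp add: l2_integral_eq[OF f])
qed

text \<open>Pointwise the primitive is bounded by a multiple of the norm of \<open>u\<close>, so it
  is dominated by a multiple of \<open>one_on a b\<close>, whose norm stands for the square root of
  the length of the interval.\<close>

lemma primitive_bound:
  "l2_norm (primitive a b u) \<le> (max 0 (b - a) + 1) / 2 * l2_norm (one_on a b :: 'a L2) * l2_norm (u :: 'a::{real_normed_field,euclidean_space} L2)"
proof -
  obtain f where f: "represents u f"
    by (rule representsE)
  let ?C = "(max 0 (b - a) + 1) / 2 * l2_norm u"
  have "l2_norm (primitive a b u) \<le> l2_norm (l2_scale (of_real ?C) (one_on a b :: 'a L2))"
  proof (rule l2_norm_mono[OF represents_primitive[OF f] represents_scale[OF represents_one_on]], rule AE_I2)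
    fix x
    show "norm (indicator {a<..<b} x *\<^sub>R (LINT t:{a<..<x}|lborel. f t))
      \<le> norm (of_real ?C * (indicator {a<..<b} x *\<^sub>R (1::'a)))"
    proof (cases "x \<in> {a<..<b}")
      case True
      have "norm (LINT t:{a<..<x}|lborel. f t) \<le> (max 0 (x - a) + 1) / 2 * l2_norm u"
        using f by (rule represents_norm_set_integral_le)
      also have "\<dots> \<le> ?C"
        using True by (intro mult_right_mono) (auto simp: l2_norm_nonneg)
      also have "\<dots> \<le> \<bar>?C\<bar>"
        by (rule abs_ge_self)
      finally show ?thesis
        using True by (simp only: indicator_simps scaleR_one mult_1_right norm_of_real)
    qed simp
  qed
  also have "\<dots> = ?C * l2_norm (one_on a b :: 'a L2)"
    unfolding l2_norm_scale norm_of_real using l2_norm_nonneg[of u] by (simp add: abs_of_nonneg)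
  finally show ?thesis
    by (simp add: mult_ac)
qed

lemma primitive_in_L2_on: "primitive a b u \<in> L2_on a b"
proof -
  obtain f where f: "represents u f"
    by (rule representsE)
  show ?thesis
    by (simp add: L2_on_iff[OF represents_primitive[OF f]])
qed

lemma one_on_in_L2_on: "one_on a b \<in> L2_on a b"
  by (simp add: L2_on_iff[OF represents_one_on])

lemma one_on_nonzero:
  assumes "a < b"
  shows "(one_on a b :: 'a::{real_normed_field,euclidean_space} L2) \<noteq> 0"
proof
  assume "(one_on a b :: 'a L2) = 0"
  then have "AE x in lborel. indicator {a<..<b} x *\<^sub>R (1::'a) = 0"
    using represents_eq_iff[OF represents_one_on represents_0] by blast
  then have "AE x in lborel. x \<notin> {a<..<b}"
    by eventually_elim (auto split: split_indicator_asm)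
  then have "emeasure lborel {a<..<b} = 0"
    by (subst (asm) AE_iff_measurable[of "{a<..<b}"]) auto
  then show False
    using assms by simp
qed

section \<open>Weak derivatives of primitives\<close>

lemma L2_on_eq_iff:
  assumes "u \<in> L2_on a b" "v \<in> L2_on a b" "represents u f" "represents v g"
  shows "u = v \<longleftrightarrow> (AE x in lborel. x \<in> {a<..<b} \<longrightarrow> f x = g x)"
proof -
  have "AE x in lborel. x \<notin> {a<..<b} \<longrightarrow> f x = 0" "AE x in lborel. x \<notin> {a<..<b} \<longrightarrow> g x = 0"
    using assms L2_on_iff by blast+
  then have "AE x in lborel. (f x = g x) = (x \<in> {a<..<b} \<longrightarrow> f x = g x)"
    by eventually_elim auto
  then have "(AE x in lborel. f x = g x) \<longleftrightarrow> (AE x in lborel. x \<in> {a<..<b} \<longrightarrow> f x = g x)"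
    by (intro iffI; elim AE_mp) (auto elim!: eventually_mono)
  then show ?thesis
    using represents_eq_iff assms by blast
qed

text \<open>Gives meaning to the definite description in \<open>weak_deriv\<close>: two candidates
  differ by a function that every test function annihilates.\<close>

lemma is_weak_deriv_unique:
  assumes "g \<in> L2_on a b" "g' \<in> L2_on a b" "is_weak_deriv a b m u g" "is_weak_deriv a b m u g'"
  shows "g = g'"
proof -
  obtain f h h' where f: "represents u f" and h: "represents g h" and h': "represents g' h'"
    using representsE by metis
  note int = represents_set_integrable[OF h, of a b] represents_set_integrable[OF h', of a b]
  have "AE x in lborel. x \<in> {a<..<b} \<longrightarrow> h x - h' x = 0"
  proof (rule weakly_zero_imp_AE_zero)
    show "set_integrable lborel {a<..<b} (\<lambda>x. h x - h' x)"
      using int by (rule set_integral_diff)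
    fix \<phi> assume \<phi>: "\<phi> \<in> test_functions a b"
    then have "(- 1) ^ m *\<^sub>R (LINT x:{a<..<b}|lborel. \<phi> x *\<^sub>R h x) = (- 1) ^ m *\<^sub>R (LINT x:{a<..<b}|lborel. \<phi> x *\<^sub>R h' x)"
      using assms(3,4) by (simp add: is_weak_deriv_iff[OF f h] is_weak_deriv_iff[OF f h'])
    then have "(LINT x:{a<..<b}|lborel. \<phi> x *\<^sub>R h x) = (LINT x:{a<..<b}|lborel. \<phi> x *\<^sub>R h' x)"
      by simp
    then show "(LINT x:{a<..<b}|lborel. \<phi> x *\<^sub>R (h x - h' x)) = 0"
      using test_function_bounded_mult_integrable[OF \<phi> int(1)] test_function_bounded_mult_integrable[OF \<phi> int(2)]
      by (simp add: scaleR_diff_right set_integral_diff)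
  qed
  then show ?thesis
    using L2_on_eq_iff[OF assms(1,2) h h'] by simp
qed

lemma is_weak_deriv_0: "is_weak_deriv a b 0 u u"
proof -
  obtain f where f: "represents u f"
    by (rule representsE)
  show ?thesis
    by (simp add: is_weak_deriv_iff[OF f f])
qed

lemma test_function_integral_deriv_eq_0:
  fixes c :: "'a::euclidean_space"
  assumes "\<phi> \<in> test_functions a b" "a < b"
  shows "(LINT x:{a<..<b}|lborel. deriv \<phi> x *\<^sub>R c) = 0"
proof -
  have d\<phi>: "deriv \<phi> \<in> test_functions a b"
    using assms by (intro test_function_deriv)
  have "(LINT x:{a<..<b}|lborel. deriv \<phi> x *\<^sub>R c) = (LINT x|lborel. deriv \<phi> x *\<^sub>R c)"
    unfolding set_lebesgue_integral_def using test_function_eq_0[OF d\<phi>]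
    by (intro Bochner_Integration.integral_cong) (auto split: split_indicator)
  also have "\<dots> = (LINT x|lborel. deriv \<phi> x) *\<^sub>R c"
    using test_function_integrable[OF d\<phi>] by simp
  also have "(LINT x|lborel. deriv \<phi> x) = (LINT x:{a..b}|lborel. deriv \<phi> x)"
    using test_function_eq_0[OF d\<phi>] by (intro set_integral_eq_integral_of_support[symmetric]) auto
  also have "\<dots> = \<phi> b - \<phi> a"
    using assms smooth_has_derivative[OF test_function_smooth[OF assms(1)]]
    by (intro test_function_integral_deriv[OF _ d\<phi>]) auto
  finally show ?thesis
    using test_function_eq_0[OF assms(1)] by simp
qed

lemma is_weak_deriv_primitive:
  assumes "a < b"
  shows "is_weak_deriv a b 1 (primitive a b g + l2_scale c (one_on a b)) g"
proof -
  obtain f where f: "represents g f"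
    by (rule representsE)
  note int = represents_set_integrable[OF f, of a b]
  note rep = represents_add[OF represents_primitive[OF f] represents_scale[OF represents_one_on]]
  show ?thesis
    unfolding is_weak_deriv_iff[OF rep f]
  proof
    fix \<phi> assume \<phi>: "\<phi> \<in> test_functions a b"
    have d\<phi>: "deriv \<phi> \<in> test_functions a b"
      using \<phi> by (rule test_function_deriv)
    let ?F = "\<lambda>x. indicator {a<..<b} x *\<^sub>R (LINT t:{a<..<x}|lborel. f t)"
    have 1: "set_integrable lborel {a<..<b} (\<lambda>x. deriv \<phi> x *\<^sub>R ?F x)"
      by (rule test_function_bounded_mult_integrable[OF d\<phi> represents_set_integrable[OF represents_primitive[OF f]]])
    have "set_integrable lborel {a<..<b} (\<lambda>x. deriv \<phi> x *\<^sub>R (c * (indicator {a<..<b} x *\<^sub>R 1)))"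
      by (intro test_function_bounded_mult_integrable[OF d\<phi>]
          represents_set_integrable[OF represents_scale[OF represents_one_on]])
    then have "(LINT x:{a<..<b}|lborel. deriv \<phi> x *\<^sub>R (?F x + c * (indicator {a<..<b} x *\<^sub>R 1))) =
        (LINT x:{a<..<b}|lborel. deriv \<phi> x *\<^sub>R ?F x) +
        (LINT x:{a<..<b}|lborel. deriv \<phi> x *\<^sub>R (c * (indicator {a<..<b} x *\<^sub>R 1)))"
      using 1 unfolding scaleR_add_right by (intro set_integral_add)
    also have "(LINT x:{a<..<b}|lborel. deriv \<phi> x *\<^sub>R ?F x) =
        (LINT x:{a<..<b}|lborel. deriv \<phi> x *\<^sub>R (LINT t:{a<..<x}|lborel. f t))"
      by (intro set_lebesgue_integral_cong) auto
    also have "\<dots> = - (LINT x:{a<..<b}|lborel. \<phi> x *\<^sub>R f x)"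
      by (rule set_integral_by_parts_test_function[OF \<phi> int])
    also have "(LINT x:{a<..<b}|lborel. deriv \<phi> x *\<^sub>R (c * (indicator {a<..<b} x *\<^sub>R 1))) =
        (LINT x:{a<..<b}|lborel. deriv \<phi> x *\<^sub>R c)"
      by (intro set_lebesgue_integral_cong) auto
    also have "\<dots> = 0"
      by (rule test_function_integral_deriv_eq_0[OF \<phi> assms])
    finally show "(LINT x:{a<..<b}|lborel. (deriv ^^ 1) \<phi> x *\<^sub>R (?F x + c * (indicator {a<..<b} x *\<^sub>R 1))) =
        (- 1) ^ 1 *\<^sub>R (LINT x:{a<..<b}|lborel. \<phi> x *\<^sub>R f x)"
      by simp
  qed
qed

text \<open>\<open>u\<close> and the primitive of \<open>g\<close> have the same first weak
  derivative, so their difference is constant by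
  \<open>weak_derivative_zero_imp_AE_const\<close>.\<close>

lemma is_weak_deriv_1_imp_primitive:
  fixes u g :: "'a::{real_normed_field,euclidean_space} L2"
  assumes "a < b" "u \<in> L2_on a b" "is_weak_deriv a b 1 u g"
  shows "\<exists>c. u = primitive a b g + l2_scale c (one_on a b)"
proof -
  obtain f h where f: "represents u f" and h: "represents g h"
    using representsE by metis
  let ?H = "\<lambda>x. indicator {a<..<b} x *\<^sub>R (LINT t:{a<..<x}|lborel. h t)"
  have H: "represents (primitive a b g) ?H"
    by (rule represents_primitive[OF h])
  note int = represents_set_integrable[OF f, of a b] represents_set_integrable[OF H, of a b]
  have "is_weak_deriv a b 1 (primitive a b g + l2_scale 0 (one_on a b)) g"
    using \<open>a < b\<close> by (rule is_weak_deriv_primitive)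
  then have H': "is_weak_deriv a b 1 (primitive a b g) g"
    by simp
  have "\<exists>c. AE x in lborel. x \<in> {a<..<b} \<longrightarrow> f x - ?H x = c"
  proof (rule weak_derivative_zero_imp_AE_const[OF _ \<open>a < b\<close>])
    show "set_integrable lborel {a<..<b} (\<lambda>x. f x - ?H x)"
      using int by (rule set_integral_diff)
    fix \<phi> assume \<phi>: "\<phi> \<in> test_functions a b"
    have d\<phi>: "deriv \<phi> \<in> test_functions a b"
      using \<phi> by (rule test_function_deriv)
    have "(LINT x:{a<..<b}|lborel. deriv \<phi> x *\<^sub>R f x) = (LINT x:{a<..<b}|lborel. deriv \<phi> x *\<^sub>R ?H x)"
      using assms(3) H' \<phi> unfolding is_weak_deriv_iff[OF f h] is_weak_deriv_iff[OF H h] by simp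
    then show "(LINT x:{a<..<b}|lborel. deriv \<phi> x *\<^sub>R (f x - ?H x)) = 0"
      unfolding scaleR_diff_right
      using test_function_bounded_mult_integrable[OF d\<phi> int(1)] test_function_bounded_mult_integrable[OF d\<phi> int(2)]
      by (subst set_integral_diff) simp_all
  qed
  then obtain c where c: "AE x in lborel. x \<in> {a<..<b} \<longrightarrow> f x - ?H x = c"
    by blast
  have "u = primitive a b g + l2_scale c (one_on a b)"
  proof (subst L2_on_eq_iff[OF assms(2) _ f represents_add[OF H represents_scale[OF represents_one_on]]])
    show "primitive a b g + l2_scale c (one_on a b) \<in> L2_on a b"
      by (intro l2.subspace_add[OF subspace_L2_on] l2.subspace_scale[OF subspace_L2_on]
          primitive_in_L2_on one_on_in_L2_on)
    show "AE x in lborel. x \<in> {a<..<b} \<longrightarrow> f x = ?H x + c * (indicator {a<..<b} x *\<^sub>R 1)"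
      using c by eventually_elim (auto simp: algebra_simps)
  qed
  then show ?thesis ..
qed

text \<open>Derivatives of test functions are test functions, so the first order relation between
  \<open>u\<close> and \<open>g\<close> can be tested with \<open>(deriv ^^ m) \<phi>\<close>. This
  is what permits inductions on the Sobolev order.\<close>

lemma is_weak_deriv_Suc_iff:
  assumes "is_weak_deriv a b 1 u g"
  shows "is_weak_deriv a b (Suc m) u h \<longleftrightarrow> is_weak_deriv a b m g h"
proof -
  obtain f f' f'' where f: "represents u f" and f': "represents g f'" and f'': "represents h f''"
    using representsE by metis
  have "(LINT x:{a<..<b}|lborel. (deriv ^^ Suc m) \<phi> x *\<^sub>R f x) =
    - (LINT x:{a<..<b}|lborel. (deriv ^^ m) \<phi> x *\<^sub>R f' x)" if "\<phi> \<in> test_functions a b" for \<phi>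
  proof -
    have "(deriv ^^ m) \<phi> \<in> test_functions a b"
      using that by (induction m) (auto intro: test_function_deriv)
    then show ?thesis
      using assms unfolding is_weak_deriv_iff[OF f f'] by simp
  qed
  then show ?thesis
    unfolding is_weak_deriv_iff[OF f f''] is_weak_deriv_iff[OF f' f'']
    by (intro ball_cong refl) (simp del: funpow.simps)
qed

section \<open>Sobolev spaces and primitives\<close>

lemma primitive_0 [simp]: "primitive a b 0 = 0"
  using primitive_scale[of a b 0 0] by simp

lemma l2_integral_0 [simp]: "l2_integral a b 0 = 0"
  using l2_integral_scale[of a b 0 0] by simp

lemma primitive_uminus: "primitive a b (- u) = - primitive a b u"
  using primitive_add[of a b u "- u"] by (simp add: eq_neg_iff_add_eq_0 add.commute)

lemma primitive_diff: "primitive a b (u - v) = primitive a b u - primitive a b v"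
  using primitive_add[of a b u "- v"] by (simp add: primitive_uminus)

lemma l2_integral_uminus: "l2_integral a b (- u) = - l2_integral a b u"
  using l2_integral_add[of a b u "- u"] by (simp add: eq_neg_iff_add_eq_0 add.commute)

lemma l2_integral_diff: "l2_integral a b (u - v) = l2_integral a b u - l2_integral a b v"
  using l2_integral_add[of a b u "- v"] by (simp add: l2_integral_uminus)

lemma primitive_plus_const_in_L2_on: "primitive a b g + l2_scale c (one_on a b) \<in> L2_on a b"
  by (intro l2.subspace_add[OF subspace_L2_on] l2.subspace_scale[OF subspace_L2_on]
      primitive_in_L2_on one_on_in_L2_on)

lemma primitive_plus_const_inject:
  assumes "a < b" "g \<in> L2_on a b" "g' \<in> L2_on a b"
    "primitive a b g + l2_scale c (one_on a b) = primitive a b g' + l2_scale c' (one_on a b)"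
  shows "g = g' \<and> c = c'"
proof
  show "g = g'"
    using is_weak_deriv_primitive[OF \<open>a < b\<close>, of g c] is_weak_deriv_primitive[OF \<open>a < b\<close>, of g' c']
    unfolding assms(4) by (rule is_weak_deriv_unique[OF assms(2,3)])
  then have "l2_scale (c - c') (one_on a b) = 0"
    using assms(4) by (simp add: l2.scale_left_diff_distrib)
  then show "c = c'"
    using one_on_nonzero[OF \<open>a < b\<close>] by auto
qed

lemma sobolev_0: "sobolev 0 a b = L2_on a b"
  using is_weak_deriv_0 by (auto simp: sobolev_def)

lemma sobolev_subset_L2_on: "sobolev k a b \<subseteq> L2_on a b"
  by (auto simp: sobolev_def)

text \<open>Splitting off \<open>m = 0\<close>, where a function is its own weak derivative, leaves
  exactly the conditions on \<open>g\<close>, shifted by one order.\<close>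

lemma primitive_plus_const_in_sobolev_iff:
  fixes g :: "'a::{real_normed_field,euclidean_space} L2"
  assumes "a < b" "g \<in> L2_on a b"
  shows "primitive a b g + l2_scale c (one_on a b) \<in> sobolev (Suc k) a b \<longleftrightarrow> g \<in> sobolev k a b"
    (is "?u \<in> _ \<longleftrightarrow> _")
proof -
  have weak: "is_weak_deriv a b (Suc m) ?u h \<longleftrightarrow> is_weak_deriv a b m g h" for m h
    by (rule is_weak_deriv_Suc_iff[OF is_weak_deriv_primitive[OF \<open>a < b\<close>]])
  have "(\<forall>m\<le>Suc k. \<exists>h\<in>L2_on a b. is_weak_deriv a b m ?u h) \<longleftrightarrow>
      (\<forall>m\<le>k. \<exists>h\<in>L2_on a b. is_weak_deriv a b m g h)"
    unfolding less_Suc_eq_le[symmetric] All_less_Suc2 weak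
    using is_weak_deriv_0[of a b ?u] primitive_plus_const_in_L2_on[of a b g c] by blast
  then show ?thesis
    using assms primitive_plus_const_in_L2_on[of a b g c]
    unfolding sobolev_def mem_Collect_eq by blast
qed

lemma sobolev_SucE:
  assumes "a < b" "u \<in> sobolev (Suc k) a b"
  obtains g c where "g \<in> sobolev k a b" "u = primitive a b g + l2_scale c (one_on a b)"
proof -
  have "u \<in> L2_on a b" "\<exists>g\<in>L2_on a b. is_weak_deriv a b 1 u g"
    using assms(2) by (auto simp: sobolev_def)
  then obtain g c where g: "g \<in> L2_on a b" "u = primitive a b g + l2_scale c (one_on a b)"
    using is_weak_deriv_1_imp_primitive[OF \<open>a < b\<close>] by blast
  then show thesis
    using primitive_plus_const_in_sobolev_iff[OF \<open>a < b\<close> g(1)] assms(2) that by blast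
qed

section \<open>Boundary values of primitives\<close>

lemma weak_deriv_0:
  assumes "u \<in> L2_on a b"
  shows "weak_deriv a b 0 u = u"
  unfolding weak_deriv_def
proof (rule the_equality)
  show "u \<in> L2_on a b \<and> is_weak_deriv a b 0 u u"
    using assms is_weak_deriv_0 by blast
  show "g = u" if "g \<in> L2_on a b \<and> is_weak_deriv a b 0 u g" for g
    using is_weak_deriv_unique[of g a b u 0 u] that assms is_weak_deriv_0[of a b u] by blast
qed

lemma weak_deriv_Suc_primitive:
  assumes "a < b"
  shows "weak_deriv a b (Suc m) (primitive a b g + l2_scale c (one_on a b)) = weak_deriv a b m g"
  unfolding weak_deriv_def is_weak_deriv_Suc_iff[OF is_weak_deriv_primitive[OF assms]] ..

text \<open>The indefinite integral plus \<open>c\<close> is a continuous representative, with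
  values \<open>c\<close> at \<open>a\<close> and \<open>l2_integral a b g + c\<close> at
  \<open>b\<close>. Since \<open>vanishes_at_ends\<close> asks for some representative, uniqueness
  on the closed interval is needed for the forward direction.\<close>

lemma vanishes_at_ends_primitive:
  assumes "a < b" "g \<in> L2_on a b"
  shows "vanishes_at_ends a b (primitive a b g + l2_scale c (one_on a b)) \<longleftrightarrow>
    c = 0 \<and> l2_integral a b g = 0"
proof -
  obtain f where f: "represents g f"
    by (rule representsE)
  note rep = represents_add[OF represents_primitive[OF f] represents_scale[OF represents_one_on]]
  define h where "h x = (LINT t:{a<..<x}|lborel. f t) + c" for x
  have h: "continuous_on {a..b} h"
    unfolding h_def
    by (intro continuous_intros continuous_on_indefinite_set_integral represents_set_integrable[OF f])
  have h_ends: "h a = c" "h b = l2_integral a b g + c"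
    by (simp_all add: h_def l2_integral_eq[OF f] set_lebesgue_integral_def)
  let ?u = "primitive a b g + l2_scale c (one_on a b)"
  have "is_continuous_rep a b ?u h' \<longleftrightarrow>
      continuous_on {a..b} h' \<and> (AE x in lborel. x \<in> {a<..<b} \<longrightarrow> h x = h' x)" for h'
    unfolding is_continuous_rep_iff[OF rep]
    by (intro arg_cong2[where f = "(\<and>)"] refl AE_cong) (auto simp: h_def)
  note rep_iff = this
  have unique: "h' x = h x"
    if h': "continuous_on {a..b} h'" "AE x in lborel. x \<in> {a<..<b} \<longrightarrow> h x = h' x" and x: "x \<in> {a..b}" for h' x
  proof -
    define d where "d x = h' x - h x" for x
    have d: "continuous_on {a..b} d"
      unfolding d_def using h h' by (intro continuous_intros)
    have zero: "d y = 0" if y: "y \<in> {a<..<b}" for y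
    proof (rule ccontr)
      assume "d y \<noteq> 0"
      have "isCont d y"
        using d y continuous_on_interior[of "{a..b}" d y] by simp
      then obtain e where e: "e > 0" "\<And>z. dist y z < e \<Longrightarrow> d z \<noteq> 0"
        using continuous_at_avoid[of y d 0] \<open>d y \<noteq> 0\<close> by blast
      \<comment> \<open>The neighbourhood is cut down to \<open>(a, b)\<close>, where the almost
        everywhere equality holds; it still has positive length.\<close>
      define l r where "l = max a (y - e)" and "r = min b (y + e)"
      have lr: "l < r"
        using y e by (auto simp: l_def r_def)
      have "AE z in lborel. z \<notin> {l<..<r}"
        using h'(2)
      proof eventually_elim
        case (elim z)
        have "dist y z < e" if "z \<in> {l<..<r}"
          using that by (simp add: l_def r_def dist_real_def abs_less_iff)
        then show ?case
          using e(2)[of z] elim by (auto simp: l_def r_def d_def)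
      qed
      then have "emeasure lborel {l<..<r} = 0"
        by (subst (asm) AE_iff_measurable[of "{l<..<r}"]) auto
      then show False
        using lr by simp
    qed
    \<comment> \<open>Equality in the interior extends by continuity to the endpoints, which are the
      points of interest.\<close>
    have "x \<in> closure {a<..<b}"
      using x \<open>a < b\<close> by simp
    then have "d x = 0"
      by (rule continuous_constant_on_closure[rotated 2]) (use d zero \<open>a < b\<close> in auto)
    then show ?thesis
      by (simp add: d_def)
  qed
  have "is_continuous_rep a b ?u h"
    unfolding rep_iff using h by simp
  moreover have "h' a = h a \<and> h' b = h b" if "is_continuous_rep a b ?u h'" for h'
    using that unique[of h' a] unique[of h' b] \<open>a < b\<close> unfolding rep_iff by auto
  ultimately have "vanishes_at_ends a b ?u \<longleftrightarrow> h a = 0 \<and> h b = 0"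
    unfolding vanishes_at_ends_def by metis
  then show ?thesis
    by (auto simp: h_ends)
qed

lemma sobolev0_0: "sobolev0 0 a b = L2_on a b"
  by (simp add: sobolev0_def sobolev_0)

lemma sobolev0_subset_sobolev: "sobolev0 k a b \<subseteq> sobolev k a b"
  by (auto simp: sobolev0_def)

lemma sobolev0_subset_L2_on: "sobolev0 k a b \<subseteq> L2_on a b"
  using sobolev0_subset_sobolev sobolev_subset_L2_on by blast

lemma primitive_plus_const_in_sobolev0_iff:
  assumes "a < b" "g \<in> L2_on a b"
  shows "primitive a b g + l2_scale c (one_on a b) \<in> sobolev0 (Suc k) a b \<longleftrightarrow>
    g \<in> sobolev0 k a b \<and> c = 0 \<and> l2_integral a b g = 0"
proof -
  let ?u = "primitive a b g + l2_scale c (one_on a b)"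
  have "(\<forall>\<mu><Suc k. vanishes_at_ends a b (weak_deriv a b \<mu> ?u)) \<longleftrightarrow>
      vanishes_at_ends a b ?u \<and> (\<forall>\<mu><k. vanishes_at_ends a b (weak_deriv a b \<mu> g))"
    by (simp add: All_less_Suc2 weak_deriv_0 primitive_plus_const_in_L2_on weak_deriv_Suc_primitive[OF \<open>a < b\<close>])
  then show ?thesis
    using assms by (auto simp: sobolev0_def primitive_plus_const_in_sobolev_iff vanishes_at_ends_primitive)
qed

lemma sobolev0_Suc:
  assumes "a < b"
  shows "sobolev0 (Suc k) a b = primitive a b ` {g \<in> sobolev0 k a b. l2_integral a b g = 0}"
proof (intro equalityI subsetI)
  fix u assume u: "u \<in> sobolev0 (Suc k) a b"
  then obtain g c where g: "g \<in> sobolev k a b" "u = primitive a b g + l2_scale c (one_on a b)"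
    using sobolev_SucE[OF assms] sobolev0_subset_sobolev by blast
  then have "g \<in> sobolev0 k a b \<and> c = 0 \<and> l2_integral a b g = 0"
    using u primitive_plus_const_in_sobolev0_iff[OF assms] sobolev_subset_L2_on by blast
  then show "u \<in> primitive a b ` {g \<in> sobolev0 k a b. l2_integral a b g = 0}"
    using g by auto
next
  fix u assume "u \<in> primitive a b ` {g \<in> sobolev0 k a b. l2_integral a b g = 0}"
  then obtain g where g: "u = primitive a b g" "g \<in> sobolev0 k a b" "l2_integral a b g = 0"
    by auto
  then show "u \<in> sobolev0 (Suc k) a b"
    using primitive_plus_const_in_sobolev0_iff[OF assms, of g 0 k] sobolev0_subset_L2_on by auto
qed

lemma subspace_sobolev:
  assumes "a < b"
  shows "l2.subspace (sobolev k a b :: 'a::{real_normed_field,euclidean_space} L2 set)"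
proof (induction k)
  case 0
  then show ?case
    by (simp add: sobolev_0 subspace_L2_on)
next
  case (Suc k)
  have iff: "primitive a b g + l2_scale c (one_on a b) \<in> sobolev (Suc k) a b"
    if "g \<in> sobolev k a b" for g :: "'a L2" and c
    using that primitive_plus_const_in_sobolev_iff[OF assms] sobolev_subset_L2_on by blast
  show ?case
  proof (rule l2.subspaceI)
    show "(0 :: 'a L2) \<in> sobolev (Suc k) a b"
      using iff[OF l2.subspace_0[OF Suc], of 0] by simp
  next
    fix u v :: "'a L2" and r
    assume u: "u \<in> sobolev (Suc k) a b"
    obtain g c where g: "g \<in> sobolev k a b" "u = primitive a b g + l2_scale c (one_on a b)"
      using sobolev_SucE[OF assms u] by blast
    have "l2_scale r u = primitive a b (l2_scale r g) + l2_scale (r * c) (one_on a b)"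
      by (simp add: g primitive_scale l2.scale_right_distrib)
    then show "l2_scale r u \<in> sobolev (Suc k) a b"
      using iff[OF l2.subspace_scale[OF Suc g(1)]] by simp
    assume v: "v \<in> sobolev (Suc k) a b"
    obtain g' c' where g': "g' \<in> sobolev k a b" "v = primitive a b g' + l2_scale c' (one_on a b)"
      using sobolev_SucE[OF assms v] by blast
    have "u + v = primitive a b (g + g') + l2_scale (c + c') (one_on a b)"
      by (simp add: g g' primitive_add l2.scale_left_distrib algebra_simps)
    then show "u + v \<in> sobolev (Suc k) a b"
      using iff[OF l2.subspace_add[OF Suc g(1) g'(1)]] by simp
  qed
qed

lemma subspace_sobolev0:
  assumes "a < b"
  shows "l2.subspace (sobolev0 k a b :: 'a::{real_normed_field,euclidean_space} L2 set)"
proof (induction k)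
  case 0
  then show ?case
    by (simp add: sobolev0_0 subspace_L2_on)
next
  case (Suc k)
  show ?case
    unfolding sobolev0_Suc[OF assms]
  proof (rule l2.subspaceI)
    show "(0 :: 'a L2) \<in> primitive a b ` {g \<in> sobolev0 k a b. l2_integral a b g = 0}"
      using l2.subspace_0[OF Suc] by (auto intro!: image_eqI[of _ _ 0])
  next
    fix u v :: "'a L2" and r
    assume "u \<in> primitive a b ` {g \<in> sobolev0 k a b. l2_integral a b g = 0}"
    then obtain g where g: "u = primitive a b g" "g \<in> sobolev0 k a b" "l2_integral a b g = 0"
      by auto
    then show "l2_scale r u \<in> primitive a b ` {g \<in> sobolev0 k a b. l2_integral a b g = 0}"
      using l2.subspace_scale[OF Suc]
      by (intro image_eqI[of _ _ "l2_scale r g"]) (auto simp: primitive_scale l2_integral_scale)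
    assume "v \<in> primitive a b ` {g \<in> sobolev0 k a b. l2_integral a b g = 0}"
    then obtain g' where g': "v = primitive a b g'" "g' \<in> sobolev0 k a b" "l2_integral a b g' = 0"
      by auto
    then show "u + v \<in> primitive a b ` {g \<in> sobolev0 k a b. l2_integral a b g = 0}"
      using g l2.subspace_add[OF Suc]
      by (intro image_eqI[of _ _ "g + g'"]) (auto simp: primitive_add l2_integral_add)
  qed
qed

section \<open>Sobolev norms\<close>

lemma sobolev_norm_0: "u \<in> L2_on a b \<Longrightarrow> sobolev_norm 0 a b u = l2_norm u"
  by (simp add: sobolev_norm_def weak_deriv_0 l2_norm_nonneg)

lemma sobolev_norm_nonneg: "0 \<le> sobolev_norm k a b u"
  by (simp add: sobolev_norm_def sum_nonneg)

text \<open>The inductive form of the norm: the order zero term splits off, and the remaining weak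
  derivatives of the primitive are those of \<open>g\<close>.\<close>

lemma sobolev_norm_Suc_primitive:
  assumes "a < b"
  shows "(sobolev_norm (Suc k) a b (primitive a b g + l2_scale c (one_on a b)))\<^sup>2 =
    (l2_norm (primitive a b g + l2_scale c (one_on a b)))\<^sup>2 + (sobolev_norm k a b g)\<^sup>2"
  unfolding sobolev_norm_def
  by (simp add: sum_nonneg sum.atMost_Suc_shift weak_deriv_0[OF primitive_plus_const_in_L2_on]
      weak_deriv_Suc_primitive[OF assms] del: sum.atMost_Suc)

lemma l2_norm_le_sobolev_norm:
  assumes "u \<in> L2_on a b"
  shows "l2_norm u \<le> sobolev_norm k a b u"
proof -
  have "(l2_norm u)\<^sup>2 = (\<Sum>m\<in>{0}. (l2_norm (weak_deriv a b m u))\<^sup>2)"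
    using assms by (simp add: weak_deriv_0)
  also have "\<dots> \<le> (\<Sum>m\<le>k. (l2_norm (weak_deriv a b m u))\<^sup>2)"
    by (intro sum_mono2) auto
  finally show ?thesis
    unfolding sobolev_norm_def by (rule real_le_rsqrt)
qed

lemma sobolev_norm_le_Suc_primitive:
  assumes "a < b"
  shows "sobolev_norm k a b g \<le> sobolev_norm (Suc k) a b (primitive a b g + l2_scale c (one_on a b))"
  using sobolev_norm_Suc_primitive[OF assms, of k g c]
  by (intro power2_le_imp_le[OF _ sobolev_norm_nonneg]) simp

section \<open>Test functions as elements of the spaces with zero boundary values\<close>

lemma square_integrable_test_function:
  assumes "\<phi> \<in> test_functions a b"
  shows "square_integrable (\<lambda>x. of_real (\<phi> x) :: 'a::{real_normed_field,euclidean_space})"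
proof -
  obtain C where "\<And>x. \<bar>\<phi> x\<bar> \<le> C"
    using test_function_bounded[OF assms] by blast
  then show ?thesis
    using test_function_measurable[OF assms] test_function_eq_0[OF assms]
    by (intro square_integrable_bounded_support[of _ C a b]) (auto intro: borel_measurable_of_real)
qed

lemma test_function_primitive:
  fixes \<phi> :: "real \<Rightarrow> real"
  defines "T \<equiv> \<lambda>\<phi>. abs_L2 (\<lambda>x. of_real (\<phi> x)) :: 'a::{real_normed_field,euclidean_space} L2"
  assumes \<phi>: "\<phi> \<in> test_functions a b"
  shows "l2_integral a b (T (deriv \<phi>)) = 0" "primitive a b (T (deriv \<phi>)) = T \<phi>"
proof -
  have d\<phi>: "deriv \<phi> \<in> test_functions a b"
    using \<phi> by (rule test_function_deriv)
  have rep: "represents (T \<psi>) (\<lambda>x. of_real (\<psi> x))" if "\<psi> \<in> test_functions a b" for \<psi>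
    unfolding T_def by (rule represents_abs[OF square_integrable_test_function[OF that]])
  \<comment> \<open>Valid for every real \<open>x\<close>, inside and outside the interval; at
    \<open>x = b\<close> it gives the zero mean.\<close>
  have int: "(LINT t:{a<..<x}|lborel. of_real (deriv \<phi> t)) = (of_real (\<phi> x) :: 'a)" for x
  proof (cases "a \<le> x")
    case True
    have "(LINT t:{a<..<x}|lborel. deriv \<phi> t) = (LINT t:{a..x}|lborel. deriv \<phi> t)"
      unfolding set_lebesgue_integral_def
    proof (rule integral_cong_AE)
      show "AE t in lborel. indicator {a<..<x} t *\<^sub>R deriv \<phi> t = indicator {a..x} t *\<^sub>R deriv \<phi> t"
        using AE_lborel_singleton[of x] AE_lborel_singleton[of a]
        by eventually_elim (auto split: split_indicator)
    qed (use test_function_measurable[OF d\<phi>] in auto)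
    also have "\<dots> = \<phi> x"
      using True smooth_has_derivative[OF test_function_smooth[OF \<phi>]] test_function_eq_0[OF \<phi>, of a]
        test_function_integral_deriv[OF _ d\<phi>, of \<phi> a x] by simp
    finally have "of_real (LINT t:{a<..<x}|lborel. deriv \<phi> t) = (of_real (\<phi> x) :: 'a)"
      by simp
    moreover have "(LINT t:{a<..<x}|lborel. of_real (deriv \<phi> t)) = (of_real (LINT t:{a<..<x}|lborel. deriv \<phi> t) :: 'a)"
      unfolding set_lebesgue_integral_def
      using integrable_mult_indicator[OF _ test_function_integrable[OF d\<phi>], of "{a<..<x}"]
      by (subst integral_of_real[symmetric]) (simp_all add: scaleR_conv_of_real)
    ultimately show ?thesis
      by simp
  next
    case False
    then show ?thesis
      using test_function_eq_0[OF \<phi>, of x] by (simp add: set_lebesgue_integral_def)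
  qed
  show "l2_integral a b (T (deriv \<phi>)) = 0"
    using test_function_eq_0[OF \<phi>, of b] by (simp add: l2_integral_eq[OF rep[OF d\<phi>]] int)
  show "primitive a b (T (deriv \<phi>)) = T \<phi>"
    unfolding represents_eq_iff[OF represents_primitive[OF rep[OF d\<phi>]] rep[OF \<phi>]] int
    using test_function_eq_0[OF \<phi>] by (auto split: split_indicator)
qed

lemma test_function_in_sobolev0:
  assumes "a < b" "\<phi> \<in> test_functions a b"
  shows "abs_L2 (\<lambda>x. of_real (\<phi> x) :: 'a::{real_normed_field,euclidean_space}) \<in> sobolev0 k a b"
  using assms(2)
proof (induction k arbitrary: \<phi>)
  case 0
  then show ?case
    using test_function_eq_0[OF 0]
    by (simp add: sobolev0_0 L2_on_iff[OF represents_abs[OF square_integrable_test_function]])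
next
  case (Suc k)
  let ?T = "\<lambda>\<phi>. abs_L2 (\<lambda>x. of_real (\<phi> x)) :: 'a L2"
  have "?T \<phi> = primitive a b (?T (deriv \<phi>))" "l2_integral a b (?T (deriv \<phi>)) = 0"
    using test_function_primitive[OF Suc.prems, where 'a = 'a] by simp_all
  moreover have "?T (deriv \<phi>) \<in> sobolev0 k a b"
    by (rule Suc.IH[OF test_function_deriv[OF Suc.prems]])
  ultimately show ?case
    unfolding sobolev0_Suc[OF \<open>a < b\<close>] by blast
qed

text \<open>Supplies, at every order, an element on which the integral functional is nonzero.
  Constants violate the boundary conditions once \<open>k > 0\<close>, so a test function is
  taken.\<close>

lemma sobolev0_integral_nonzero:
  assumes "a < b"
  obtains e :: "'a::{real_normed_field,euclidean_space} L2" where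
    "e \<in> sobolev0 k a b" "l2_integral a b e = 1"
proof -
  obtain \<phi> where \<phi>: "\<phi> \<in> test_functions a b" "(LINT x|lborel. \<phi> x) = 1"
    using test_function_integral_1[OF assms] by blast
  let ?e = "abs_L2 (\<lambda>x. of_real (\<phi> x)) :: 'a L2"
  have "l2_integral a b ?e = (LINT x:{a<..<b}|lborel. of_real (\<phi> x))"
    by (rule l2_integral_eq[OF represents_abs[OF square_integrable_test_function[OF \<phi>(1)]]])
  also have "\<dots> = (LINT x|lborel. of_real (\<phi> x))"
    unfolding set_lebesgue_integral_def using test_function_eq_0[OF \<phi>(1)]
    by (intro Bochner_Integration.integral_cong) (auto split: split_indicator)
  also have "\<dots> = 1"
    by (subst integral_of_real[OF test_function_integrable[OF \<phi>(1)]]) (simp add: \<phi>)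
  finally show thesis
    by (rule that[OF test_function_in_sobolev0[OF assms \<phi>(1)]])
qed

section \<open>The difference operator as a matrix of shifts\<close>

lemma represents_sum:
  "(\<And>i. i \<in> A \<Longrightarrow> represents (u i) (f i)) \<Longrightarrow> represents (\<Sum>i\<in>A. u i) (\<lambda>x. \<Sum>i\<in>A. f i x)"
  by (induction A rule: infinite_finite_induct) (auto intro: represents_0 represents_add)

lemma l2_shift_add: "l2_shift h (u + v) = l2_shift h u + l2_shift h v"
proof -
  obtain f g where f: "represents u f" and g: "represents v g"
    using representsE by metis
  show ?thesis
    by (simp add: represents_eq_iff[OF represents_shift[OF represents_add[OF f g]]
        represents_add[OF represents_shift[OF f] represents_shift[OF g]]])
qed

lemma l2_shift_scale: "l2_shift h (l2_scale c u) = l2_scale c (l2_shift h u)"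
proof -
  obtain f where f: "represents u f"
    by (rule representsE)
  show ?thesis
    by (simp add: represents_eq_iff[OF represents_shift[OF represents_scale[OF f]]
        represents_scale[OF represents_shift[OF f]]])
qed

lemma l2_restrict_add: "l2_restrict a b (u + v) = l2_restrict a b u + l2_restrict a b v"
proof -
  obtain f g where f: "represents u f" and g: "represents v g"
    using representsE by metis
  show ?thesis
    by (simp add: represents_eq_iff[OF represents_restrict[OF represents_add[OF f g]]
        represents_add[OF represents_restrict[OF f] represents_restrict[OF g]]] scaleR_add_right)
qed

lemma l2_restrict_scale: "l2_restrict a b (l2_scale c u) = l2_scale c (l2_restrict a b u)"
proof -
  obtain f where f: "represents u f"
    by (rule representsE)
  show ?thesis
    by (simp add: represents_eq_iff[OF represents_restrict[OF represents_scale[OF f]]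
        represents_scale[OF represents_restrict[OF f]]])
qed

lemma l2_restrict_0: "l2_restrict a b 0 = 0"
  using l2_restrict_scale[of a b 0 0] by simp

lemma l2_restrict_sum: "l2_restrict a b (\<Sum>i\<in>A. u i) = (\<Sum>i\<in>A. l2_restrict a b (u i))"
  by (induction A rule: infinite_finite_induct) (auto simp: l2_restrict_0 l2_restrict_add)

lemma R_Q_eq_sum:
  "R_Q N b v = (\<Sum>j\<in>{- int N..int N}. l2_scale (of_real (b j)) (l2_restrict 0 (real N + 1) (l2_shift (of_int j) v)))"
  by (simp add: R_Q_def diff_op_def l2_restrict_sum l2_restrict_scale)

text \<open>A function on \<open>(0, N + 1)\<close> is read as the vector of its restrictions to the unit intervals.\<close>

definition mat_op_fun ::
    "nat \<Rightarrow> (nat \<Rightarrow> nat \<Rightarrow> real) \<Rightarrow> (real \<Rightarrow> 'a::{real_normed_field,euclidean_space}) \<Rightarrow> real \<Rightarrow> 'a" where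
  "mat_op_fun N A f x = (\<Sum>i<Suc N. \<Sum>k<Suc N.
     of_real (A i k) * (indicator {real i<..<real i + 1} x *\<^sub>R f (x + (real k - real i))))"

text \<open>The term with indices \<open>i\<close> and \<open>k\<close> moves the
  \<open>k\<close>-th unit piece of \<open>u\<close> onto the \<open>i\<close>-th unit interval, as
  a matrix entry does with coordinates.\<close>

definition mat_op ::
    "nat \<Rightarrow> (nat \<Rightarrow> nat \<Rightarrow> real) \<Rightarrow> 'a::{real_normed_field,euclidean_space} L2 \<Rightarrow> 'a L2" where
  "mat_op N A u = (\<Sum>i<Suc N. \<Sum>k<Suc N.
     l2_scale (of_real (A i k)) (l2_restrict (real i) (real i + 1) (l2_shift (real k - real i) u)))"

lemma represents_mat_op: "represents u f \<Longrightarrow> represents (mat_op N A u) (mat_op_fun N A f)"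
  unfolding mat_op_def mat_op_fun_def
  by (intro represents_sum represents_scale represents_restrict represents_shift)

lemma mat_op_fun_eq:
  assumes "i < Suc N" "x \<in> {real i<..<real i + 1}"
  shows "mat_op_fun N A f x = (\<Sum>k<Suc N. of_real (A i k) * f (x + (real k - real i)))"
proof -
  have "x \<notin> {real j<..<real j + 1}" if "j \<noteq> i" for j
  proof
    assume "x \<in> {real j<..<real j + 1}"
    then have "real j < real i + 1" "real i < real j + 1"
      using assms(2) by auto
    then show False
      using that by linarith
  qed
  then have ind: "indicator {real j<..<real j + 1} x = (if j = i then 1 else 0 :: real)" for j
    using assms(2) by auto
  have "mat_op_fun N A f x = (\<Sum>j<Suc N. if j = i then
      \<Sum>k<Suc N. of_real (A i k) * f (x + (real k - real i)) else 0)"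
    unfolding mat_op_fun_def ind by (intro sum.cong refl) (simp del: sum.lessThan_Suc)
  then show ?thesis
    using assms(1) by (simp only: sum.delta[OF finite_lessThan] lessThan_iff if_True)
qed

lemma mat_op_fun_eq_0:
  "(\<And>i. i < Suc N \<Longrightarrow> x \<notin> {real i<..<real i + 1}) \<Longrightarrow> mat_op_fun N A f x = 0"
  unfolding mat_op_fun_def by (intro sum.neutral ballI) simp

text \<open>Shifting a point of the \<open>i\<close>-th interval by \<open>k - i\<close> lands in
  the \<open>k\<close>-th one, so the inner operator acts there through row \<open>k\<close>, and
  the two shifts add up to \<open>l - i\<close> independently of \<open>k\<close>.\<close>

lemma mat_op_fun_mult:
  fixes f :: "real \<Rightarrow> 'a::{real_normed_field,euclidean_space}"
  shows
  "mat_op_fun N A (mat_op_fun N B f) x = mat_op_fun N (\<lambda>i l. \<Sum>k<Suc N. A i k * B k l) f x"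
proof (cases "\<exists>i<Suc N. x \<in> {real i<..<real i + 1}")
  case True
  then obtain i where i: "i < Suc N" "x \<in> {real i<..<real i + 1}"
    by blast
  have "mat_op_fun N A (mat_op_fun N B f) x =
      (\<Sum>k<Suc N. of_real (A i k) * mat_op_fun N B f (x + (real k - real i)))"
    by (rule mat_op_fun_eq[OF i])
  also have "\<dots> = (\<Sum>k<Suc N. of_real (A i k) * (\<Sum>l<Suc N. of_real (B k l) * f (x + (real l - real i))))"
  proof (intro sum.cong refl)
    fix k assume "k \<in> {..<Suc N}"
    then show "of_real (A i k) * mat_op_fun N B f (x + (real k - real i)) =
        of_real (A i k) * (\<Sum>l<Suc N. of_real (B k l) * f (x + (real l - real i)))"
      using i(2) by (subst mat_op_fun_eq[of k]) (auto simp: algebra_simps)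
  qed
  also have "\<dots> = (\<Sum>k<Suc N. \<Sum>l<Suc N. of_real (A i k * B k l) * f (x + (real l - real i)))"
    by (simp only: sum_distrib_left of_real_mult mult.assoc)
  also have "\<dots> = (\<Sum>l<Suc N. \<Sum>k<Suc N. of_real (A i k * B k l) * f (x + (real l - real i)))"
    by (rule sum.swap)
  also have "\<dots> = mat_op_fun N (\<lambda>i l. \<Sum>k<Suc N. A i k * B k l) f x"
    by (subst mat_op_fun_eq[OF i]) (simp only: of_real_sum sum_distrib_right)
  finally show ?thesis .
next
  case False
  have "mat_op_fun N A' g x = 0" for A' and g :: "real \<Rightarrow> 'a"
    by (rule mat_op_fun_eq_0) (use False in blast)
  then show ?thesis
    by simp
qed

lemma mat_op_mult: "mat_op N A (mat_op N B u) = mat_op N (\<lambda>i l. \<Sum>k<Suc N. A i k * B k l) u"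
proof -
  obtain f where f: "represents u f"
    by (rule representsE)
  show ?thesis
    unfolding represents_eq_iff[OF represents_mat_op[OF represents_mat_op[OF f]] represents_mat_op[OF f]]
      mat_op_fun_mult by simp
qed

text \<open>At natural numbers \<open>mat_op_fun\<close> is zero whatever the function is; they form
  a null set and are discarded in the comparisons below.\<close>

lemma AE_not_nat: "AE x in lborel. x \<notin> range real"
  by (intro AE_not_in countable_imp_null_set_lborel) simp

lemma unit_interval_cases:
  assumes "x \<notin> range real"
  obtains i where "i < Suc N" "x \<in> {real i<..<real i + 1}" "x \<in> {0<..<real N + 1}"
  | "x \<notin> {0<..<real N + 1}" "\<And>i. i < Suc N \<Longrightarrow> x \<notin> {real i<..<real i + 1}"
proof (cases "x \<in> {0<..<real N + 1}")
  case True
  define i where "i = nat \<lfloor>x\<rfloor>"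
  have "real i = of_int \<lfloor>x\<rfloor>"
    using True by (simp add: i_def)
  then have "real i \<le> x" "x < real i + 1"
    by (simp_all add: floor_le_iff)
  moreover have "x \<noteq> real i"
    using assms by blast
  ultimately have "x \<in> {real i<..<real i + 1}" "i < Suc N"
    using True by auto
  then show thesis
    using that(1) True by blast
next
  case False
  then show thesis
    by (intro that(2)) auto
qed

lemma mat_op_in_L2_on: "mat_op N A u \<in> L2_on 0 (real N + 1)"
proof -
  obtain f where f: "represents u f"
    by (rule representsE)
  have "mat_op_fun N A f x = 0" if "x \<notin> {0<..<real N + 1}" for x
    using that by (intro mat_op_fun_eq_0) auto
  then show ?thesis
    by (simp add: L2_on_iff[OF represents_mat_op[OF f]])
qed

lemma mat_op_id:
  assumes "u \<in> L2_on 0 (real N + 1)"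
    and "\<And>i k. i < Suc N \<Longrightarrow> k < Suc N \<Longrightarrow> A i k = (if i = k then 1 else 0)"
  shows "mat_op N A u = u"
proof -
  obtain f where f: "represents u f" "\<And>x. x \<notin> {0<..<real N + 1} \<Longrightarrow> f x = 0"
    using L2_on_representsE[OF assms(1)] by blast
  have "AE x in lborel. mat_op_fun N A f x = f x"
    using AE_not_nat
  proof eventually_elim
    case (elim x)
    then show ?case
    proof (cases rule: unit_interval_cases[of x N])
      case (1 i)
      have "mat_op_fun N A f x = (\<Sum>k<Suc N. if k = i then f x else 0)"
        unfolding mat_op_fun_eq[OF 1(1,2)] using assms(2)[OF 1(1)] by (intro sum.cong) auto
      then show ?thesis
        using 1 by simp
    next
      case 2
      then show ?thesis
        using mat_op_fun_eq_0[of N x A f] f(2)[of x] by simp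
    qed
  qed
  then show ?thesis
    using represents_eq_iff[OF represents_mat_op[OF f(1)] f(1)] by blast
qed

text \<open>For \<open>x\<close> in the \<open>i\<close>-th unit interval, \<open>x + j\<close>
  stays in the domain only if \<open>i + j\<close> is again the index of a unit interval; all other
  terms see the extension by zero. What remains is row \<open>i\<close> of
  \<open>R_1\<close>.\<close>

lemma R_Q_eq_mat_op:
  assumes "u \<in> L2_on 0 (real N + 1)"
  shows "R_Q N b u = mat_op N (\<lambda>i k. b (int k - int i)) u"
proof -
  obtain f where f: "represents u f" "\<And>x. x \<notin> {0<..<real N + 1} \<Longrightarrow> f x = 0"
    using L2_on_representsE[OF assms(1)] by blast
  let ?A = "\<lambda>i k. b (int k - int i)"
  let ?F = "\<lambda>x. \<Sum>j\<in>{- int N..int N}. of_real (b j) * (indicator {0<..<real N + 1} x *\<^sub>R f (x + of_int j))"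
  have rep: "represents (R_Q N b u) ?F"
    unfolding R_Q_eq_sum by (intro represents_sum represents_scale represents_restrict represents_shift f)
  have "AE x in lborel. ?F x = mat_op_fun N ?A f x"
    using AE_not_nat
  proof eventually_elim
    case (elim x)
    then show ?case
    proof (cases rule: unit_interval_cases[of x N])
      case (1 i)
      have "?F x = (\<Sum>j\<in>{- int N..int N}. of_real (b j) * f (x + of_int j))"
        using 1 by simp
      also have "\<dots> = (\<Sum>j\<in>(\<lambda>k. int k - int i) ` {..<Suc N}. of_real (b j) * f (x + of_int j))"
      proof (rule sum.mono_neutral_right)
        show "(\<lambda>k. int k - int i) ` {..<Suc N} \<subseteq> {- int N..int N}"
          using 1(1) by auto
        show "\<forall>j\<in>{- int N..int N} - (\<lambda>k. int k - int i) ` {..<Suc N}. of_real (b j) * f (x + of_int j) = 0"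
        proof
          fix j assume j: "j \<in> {- int N..int N} - (\<lambda>k. int k - int i) ` {..<Suc N}"
          have "x + of_int j \<notin> {0<..<real N + 1}"
          proof
            assume "x + of_int j \<in> {0<..<real N + 1}"
            \<comment> \<open>The strict real bounds become \<open>0 \<le> i + j \<le> N\<close>
              because \<open>i + j\<close> is an integer.\<close>
            then have "- 1 < real_of_int (int i + j)" "real_of_int (int i + j) < real N + 1"
              using 1(2) by auto
            then have "0 \<le> int i + j" "int i + j \<le> int N"
              by linarith+
            then have "j = int (nat (int i + j)) - int i" "nat (int i + j) \<in> {..<Suc N}"
              by auto
            then show False
              using j by blast
          qed
          then show "of_real (b j) * f (x + of_int j) = 0"
            using f(2) by simp
        qed
      qed simp
      also have "\<dots> = (\<Sum>k<Suc N. of_real (?A i k) * f (x + (real k - real i)))"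
        by (subst sum.reindex) (auto simp: inj_on_def)
      also have "\<dots> = mat_op_fun N ?A f x"
        by (rule mat_op_fun_eq[OF 1(1,2), symmetric])
      finally show ?thesis .
    next
      case 2
      then show ?thesis
        using mat_op_fun_eq_0[of N x ?A f] by simp
    qed
  qed
  then show ?thesis
    using represents_eq_iff[OF rep represents_mat_op[OF f(1)]] by blast
qed

section \<open>Linearity, boundedness and commutation with primitives\<close>

lemma mat_op_add: "mat_op N A (u + v) = mat_op N A u + mat_op N A v"
  by (simp only: mat_op_def l2_shift_add l2_restrict_add l2.scale_right_distrib sum.distrib)

lemma mat_op_scale: "mat_op N A (l2_scale c u) = l2_scale c (mat_op N A u)"
  by (simp only: mat_op_def l2_shift_scale l2_restrict_scale l2.scale_sum_right l2.scale_left_commute)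

text \<open>The bound is existential because the factor 2 of \<open>l2_norm_add_le\<close>
  accumulates with every summand.\<close>

lemma l2_norm_sum_bounded:
  assumes "finite I" "\<And>i. i \<in> I \<Longrightarrow> \<exists>C. \<forall>u. l2_norm (f i u) \<le> C * l2_norm (u :: 'a::{real_normed_field,euclidean_space} L2)"
  shows "\<exists>C. \<forall>u. l2_norm (\<Sum>i\<in>I. f i u) \<le> C * l2_norm u"
  using assms
proof (induction I rule: finite_induct)
  case empty
  then show ?case
    by (auto simp: l2_norm_0 intro!: exI[of _ 0])
next
  case (insert i I)
  then obtain C D where C: "\<And>u. l2_norm (f i u) \<le> C * l2_norm u"
    and D: "\<And>u. l2_norm (\<Sum>i\<in>I. f i u) \<le> D * l2_norm u"
    by blast
  have "l2_norm (\<Sum>i\<in>insert i I. f i u) \<le> 2 * (C + D) * l2_norm u" for u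
  proof -
    have "l2_norm (\<Sum>i\<in>insert i I. f i u) \<le> 2 * (l2_norm (f i u) + l2_norm (\<Sum>i\<in>I. f i u))"
      using insert(1,2) l2_norm_add_le by simp
    also have "\<dots> \<le> 2 * (C * l2_norm u + D * l2_norm u)"
      by (intro mult_left_mono add_mono C D) simp
    finally show ?thesis
      by (simp add: algebra_simps)
  qed
  then show ?case
    by blast
qed

lemma mat_op_bounded: "\<exists>C. \<forall>u :: 'a::{real_normed_field,euclidean_space} L2. l2_norm (mat_op N A u) \<le> C * l2_norm u"
  unfolding mat_op_def
proof (intro l2_norm_sum_bounded finite_lessThan)
  fix i k
  have "l2_norm (l2_scale (of_real (A i k)) (l2_restrict (real i) (real i + 1) (l2_shift (real k - real i) u)))
      \<le> \<bar>A i k\<bar> * l2_norm u" for u :: "'a L2"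
    using l2_norm_restrict_le[of "real i" "real i + 1" "l2_shift (real k - real i) u"]
    by (simp add: l2_norm_scale l2_norm_shift mult_left_mono)
  then show "\<exists>C. \<forall>u :: 'a L2. l2_norm (l2_scale (of_real (A i k))
      (l2_restrict (real i) (real i + 1) (l2_shift (real k - real i) u))) \<le> C * l2_norm u"
    by blast
qed

text \<open>With mean zero, the zero extension of the primitive is the primitive \<Psi> of
  \<open>z\<close> on the whole line; otherwise a jump would appear at \<open>b\<close>. A shift of
  \<Psi> is a primitive of the shifted function, and on \<open>(a, b)\<close> it differs from the
  one vanishing at \<open>a\<close> by the value of \<Psi> at \<open>a + h\<close>.\<close>

lemma restrict_shift_primitive:
  fixes z :: "'a::{real_normed_field,euclidean_space} L2"
  assumes "z \<in> L2_on a b" "l2_integral a b z = 0"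
  shows "\<exists>c. l2_restrict a b (l2_shift h (primitive a b z)) =
    primitive a b (l2_restrict a b (l2_shift h z)) + l2_scale c (one_on a b)"
proof -
  obtain f where f: "represents z f" "\<And>x. x \<notin> {a<..<b} \<Longrightarrow> f x = 0"
    using L2_on_representsE[OF assms(1)] by blast
  have ind: "(\<lambda>x. indicator {a<..<b} x *\<^sub>R f x) = f"
    using f(2) by (auto simp: fun_eq_iff split: split_indicator)
  then have int: "integrable lborel f"
    using represents_set_integrable[OF f(1), of a b] by (simp add: set_integrable_def)
  have total: "(LINT t|lborel. f t) = 0"
    using assms(2) ind by (simp add: l2_integral_eq[OF f(1)] set_lebesgue_integral_def)
  define \<Psi> where "\<Psi> y = (LINT t:{..<y}|lborel. f t)" for y
  \<comment> \<open>The half-line is closed here and open in \<Psi>, so that their difference is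
    exactly the open interval \<open>(a + h, x + h)\<close>.\<close>
  define c where "c = (LINT t:{..a + h}|lborel. f t)"
  have primitive_eq: "indicator {a<..<b} y *\<^sub>R (LINT t:{a<..<y}|lborel. f t) = \<Psi> y" for y
  proof (cases "y \<in> {a<..<b}")
    case True
    then have "\<Psi> y = (LINT t:{a<..<y}|lborel. f t)"
      unfolding \<Psi>_def set_lebesgue_integral_def using f(2)
      by (intro Bochner_Integration.integral_cong) (auto split: split_indicator)
    then show ?thesis
      using True by simp
  next
    case False
    have "\<Psi> y = 0"
    proof (cases "y \<le> a")
      case True
      then have "indicator {..<y} t *\<^sub>R f t = 0" for t
        using f(2)[of t] by (auto split: split_indicator)
      then have "(\<lambda>t. indicator {..<y} t *\<^sub>R f t) = (\<lambda>t. 0)"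
        by (rule ext)
      then show ?thesis
        unfolding \<Psi>_def set_lebesgue_integral_def by (simp only: integral_zero)
    next
      case False
      then have "indicator {..<y} t *\<^sub>R f t = f t" for t
        using \<open>y \<notin> {a<..<b}\<close> f(2)[of t] by (auto split: split_indicator)
      then show ?thesis
        unfolding \<Psi>_def set_lebesgue_integral_def using total by simp
    qed
    then show ?thesis
      using False by simp
  qed
  have shifted: "(LINT t:{a<..<x}|lborel. indicator {a<..<b} t *\<^sub>R f (t + h)) = \<Psi> (x + h) - c"
    if x: "x \<in> {a<..<b}" for x
  proof -
    have "(LINT t:{a<..<x}|lborel. indicator {a<..<b} t *\<^sub>R f (t + h)) =
        (LINT t|lborel. indicator {a + h<..<x + h} (h + 1 * t) *\<^sub>R f (h + 1 * t))"
      unfolding set_lebesgue_integral_def using x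
      by (intro Bochner_Integration.integral_cong) (auto simp: add.commute split: split_indicator)
    also have "\<dots> = (LINT t|lborel. indicator {a + h<..<x + h} t *\<^sub>R f t)"
      using lborel_integral_real_affine[of 1 "\<lambda>t. indicator {a + h<..<x + h} t *\<^sub>R f t" h] by simp
    also have "\<dots> = (LINT t|lborel. indicator {..<x + h} t *\<^sub>R f t - indicator {..a + h} t *\<^sub>R f t)"
      using x by (intro Bochner_Integration.integral_cong) (auto split: split_indicator)
    also have "\<dots> = \<Psi> (x + h) - c"
      unfolding \<Psi>_def c_def set_lebesgue_integral_def
      by (intro Bochner_Integration.integral_diff integrable_mult_indicator int) simp_all
    finally show ?thesis .
  qed
  note rep1 = represents_restrict[OF represents_shift[OF represents_primitive[OF f(1), of a b], of h], of a b]
  note rep2 = represents_add[OF represents_primitive[OF represents_restrict[OF represents_shift[OF f(1), of h], of a b], of a b]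
      represents_scale[OF represents_one_on[of a b], of c]]
  have "l2_restrict a b (l2_shift h (primitive a b z)) =
      primitive a b (l2_restrict a b (l2_shift h z)) + l2_scale c (one_on a b)"
    unfolding represents_eq_iff[OF rep1 rep2] primitive_eq
    using shifted by (intro AE_I2) (auto split: split_indicator)
  then show ?thesis ..
qed

lemma primitive_sum: "primitive a b (\<Sum>i\<in>A. u i) = (\<Sum>i\<in>A. primitive a b (u i))"
  by (induction A rule: infinite_finite_induct) (auto simp: primitive_add)

lemma R_Q_primitive:
  fixes z :: "'a::{real_normed_field,euclidean_space} L2"
  assumes z: "z \<in> L2_on 0 (real N + 1)" "l2_integral 0 (real N + 1) z = 0"
  shows "\<exists>c. R_Q N b (primitive 0 (real N + 1) z) =
    primitive 0 (real N + 1) (R_Q N b z) + l2_scale c (one_on 0 (real N + 1))"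
proof -
  let ?P = "primitive 0 (real N + 1) :: 'a L2 \<Rightarrow> 'a L2" and ?R = "l2_restrict 0 (real N + 1) :: 'a L2 \<Rightarrow> 'a L2"
    and ?I = "{- int N..int N}"
  obtain c where c: "?R (l2_shift h (?P z)) = ?P (?R (l2_shift h z)) + l2_scale (c h) (one_on 0 (real N + 1))" for h
    using restrict_shift_primitive[OF z] by metis
  have "R_Q N b (?P z) = ?P (R_Q N b z) +
      l2_scale (\<Sum>j\<in>?I. of_real (b j) * c (of_int j)) (one_on 0 (real N + 1))"
    by (simp add: R_Q_eq_sum c l2.scale_right_distrib sum.distrib primitive_sum primitive_scale l2.scale_sum_left)
  then show ?thesis ..
qed

lemma nonsingular_R_1_inverse:
  assumes "Determinant.det (R_1 N b) \<noteq> 0"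
  obtains S :: "nat \<Rightarrow> nat \<Rightarrow> real" where
    "\<And>i l. i < Suc N \<Longrightarrow> l < Suc N \<Longrightarrow> (\<Sum>k<Suc N. b (int k - int i) * S k l) = (if i = l then 1 else 0)"
    "\<And>i l. i < Suc N \<Longrightarrow> l < Suc N \<Longrightarrow> (\<Sum>k<Suc N. S i k * b (int l - int k)) = (if i = l then 1 else 0)"
proof -
  have R: "R_1 N b \<in> carrier_mat (Suc N) (Suc N)"
    by (simp add: R_1_def)
  obtain S where S: "S \<in> carrier_mat (Suc N) (Suc N)" "R_1 N b * S = 1\<^sub>m (Suc N)" "S * R_1 N b = 1\<^sub>m (Suc N)"
    using det_non_zero_imp_unit[OF R assms, of undefined]
    by (auto simp: Units_def ring_mat_def)
  have entry: "(A * B) $$ (i, l) = (\<Sum>k<Suc N. A $$ (i, k) * B $$ (k, l))"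
    if "A \<in> carrier_mat (Suc N) (Suc N)" "B \<in> carrier_mat (Suc N) (Suc N)" "i < Suc N" "l < Suc N"
    for A B :: "real mat" and i l
    using that by (simp add: scalar_prod_def atLeast0LessThan)
  have R_entry: "R_1 N b $$ (i, k) = b (int k - int i)" if "i < Suc N" "k < Suc N" for i k
    using that by (simp add: R_1_def)
  show thesis
  proof (rule that[of "\<lambda>i k. S $$ (i, k)"])
    fix i l assume il: "i < Suc N" "l < Suc N"
    have "(\<Sum>k<Suc N. b (int k - int i) * S $$ (k, l)) = (\<Sum>k<Suc N. R_1 N b $$ (i, k) * S $$ (k, l))"
      using il by (intro sum.cong refl) (simp add: R_entry)
    also have "\<dots> = (if i = l then 1 else 0)"
      using entry[OF R S(1) il] il by (simp add: S)
    finally show "(\<Sum>k<Suc N. b (int k - int i) * S $$ (k, l)) = (if i = l then 1 else 0)" .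
    have "(\<Sum>k<Suc N. S $$ (i, k) * b (int l - int k)) = (\<Sum>k<Suc N. S $$ (i, k) * R_1 N b $$ (k, l))"
      using il by (intro sum.cong refl) (simp add: R_entry)
    also have "\<dots> = (if i = l then 1 else 0)"
      using entry[OF S(1) R il] il by (simp add: S)
    finally show "(\<Sum>k<Suc N. S $$ (i, k) * b (int l - int k)) = (if i = l then 1 else 0)" .
  qed
qed

section \<open>Operators commuting with differentiation\<close>

lemma l2_norm_uminus: "l2_norm (- u) = l2_norm u"
  using l2_norm_scale[of "- 1" u] by (simp add: l2.scale_minus_left)

lemma sobolev_norm_uminus:
  assumes "a < b" "u \<in> sobolev k a b"
  shows "sobolev_norm k a b (- u) = sobolev_norm k a b u"
  using assms(2)
proof (induction k arbitrary: u)
  case 0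
  then have "u \<in> L2_on a b" "- u \<in> L2_on a b"
    using l2.subspace_neg[OF subspace_L2_on] by (auto simp: sobolev_0)
  then show ?case
    by (simp add: sobolev_norm_0 l2_norm_uminus)
next
  case (Suc k)
  obtain g c where g: "g \<in> sobolev k a b" "u = primitive a b g + l2_scale c (one_on a b)"
    using sobolev_SucE[OF assms(1) Suc.prems] by blast
  have u: "- u = primitive a b (- g) + l2_scale (- c) (one_on a b)"
    by (simp add: g primitive_uminus l2.scale_minus_left)
  have "(sobolev_norm (Suc k) a b (- u))\<^sup>2 = (l2_norm (- u))\<^sup>2 + (sobolev_norm k a b (- g))\<^sup>2"
    unfolding u by (rule sobolev_norm_Suc_primitive[OF assms(1)])
  also have "\<dots> = (l2_norm u)\<^sup>2 + (sobolev_norm k a b g)\<^sup>2"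
    by (simp only: l2_norm_uminus Suc.IH[OF g(1)])
  also have "\<dots> = (sobolev_norm (Suc k) a b u)\<^sup>2"
    unfolding g(2) by (rule sobolev_norm_Suc_primitive[OF assms(1), symmetric])
  finally show ?case
    by (rule power2_eq_imp_eq[OF _ sobolev_norm_nonneg sobolev_norm_nonneg])
qed

lemma null_sequence_bound:
  fixes f g :: "nat \<Rightarrow> real"
  assumes "\<And>n. 0 \<le> f n" "\<And>n. f n \<le> C * g n" "g \<longlonglongrightarrow> 0"
  shows "f \<longlonglongrightarrow> 0"
proof (rule Lim_null_comparison)
  show "\<forall>\<^sub>F n in sequentially. norm (f n) \<le> C * g n"
    using assms by (intro always_eventually) auto
  show "(\<lambda>n. C * g n) \<longlonglongrightarrow> 0"
    using tendsto_mult_right_zero[OF assms(3)] .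
qed

lemma l2_integral_eq_0_limit:
  fixes z :: "'a::{real_normed_field,euclidean_space} L2"
  assumes "\<And>n. l2_integral a b (y n) = 0" "(\<lambda>n. l2_norm (y n - z)) \<longlonglongrightarrow> 0"
  shows "l2_integral a b z = 0"
proof -
  have "norm (l2_integral a b z) \<le> (max 0 (b - a) + 1) / 2 * l2_norm (y n - z)" for n
    using l2_integral_bound[of a b "y n - z"] by (simp add: l2_integral_diff assms(1))
  then have "(\<lambda>n. norm (l2_integral a b z)) \<longlonglongrightarrow> 0"
    by (rule null_sequence_bound[OF norm_ge_zero _ assms(2)])
  then show ?thesis
    using LIMSEQ_unique[OF tendsto_const] by fastforce
qed

lemma primitive_limit:
  fixes z :: "'a::{real_normed_field,euclidean_space} L2"
  assumes "(\<lambda>n. l2_norm (y n - z)) \<longlonglongrightarrow> 0"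
  shows "(\<lambda>n. l2_norm (primitive a b (y n) - primitive a b z)) \<longlonglongrightarrow> 0"
  using primitive_bound[of a b "y _ - z"]
  by (intro null_sequence_bound[OF l2_norm_nonneg _ assms]) (simp only: primitive_diff)

lemma l2_limit_unique:
  assumes "(\<lambda>n. l2_norm (y n - z)) \<longlonglongrightarrow> 0" "(\<lambda>n. l2_norm (y n - z')) \<longlonglongrightarrow> 0"
  shows "z = z'"
proof -
  have "l2_norm (z - z') \<le> 2 * (l2_norm (y n - z) + l2_norm (y n - z'))" for n
    using l2_norm_add_le[of "- (y n - z)" "y n - z'"] by (simp only: l2_norm_uminus) simp
  moreover have "(\<lambda>n. l2_norm (y n - z) + l2_norm (y n - z')) \<longlonglongrightarrow> 0"
    using tendsto_add[OF assms] by simp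
  ultimately have "(\<lambda>n. l2_norm (z - z')) \<longlonglongrightarrow> 0"
    by (intro null_sequence_bound[OF l2_norm_nonneg])
  then have "l2_norm (z - z') = 0"
    using LIMSEQ_unique[OF tendsto_const] by fastforce
  then show ?thesis
    using l2_norm_eq_0_imp[of "z - z'"] by simp
qed

text \<open>
  Commutation with differentiation on functions that vanish at both ends is expressed in terms of
  the primitives of functions of mean zero; the constant of integration may change.
\<close>

locale derivative_commuting =
  fixes a b :: real and R T :: "'a::{real_normed_field,euclidean_space} L2 \<Rightarrow> 'a L2"
  assumes less: "a < b"
    and R_in: "R u \<in> L2_on a b" and T_in: "T u \<in> L2_on a b"
    and T_R: "u \<in> L2_on a b \<Longrightarrow> T (R u) = u" and R_T: "u \<in> L2_on a b \<Longrightarrow> R (T u) = u"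
    and R_add: "u \<in> L2_on a b \<Longrightarrow> v \<in> L2_on a b \<Longrightarrow> R (u + v) = R u + R v"
    and R_scale: "u \<in> L2_on a b \<Longrightarrow> R (l2_scale c u) = l2_scale c (R u)"
    and R_bounded: "\<exists>C. \<forall>u\<in>L2_on a b. l2_norm (R u) \<le> C * l2_norm u"
    and T_bounded: "\<exists>C. \<forall>u\<in>L2_on a b. l2_norm (T u) \<le> C * l2_norm u"
    and R_primitive: "z \<in> L2_on a b \<Longrightarrow> l2_integral a b z = 0 \<Longrightarrow>
      \<exists>c. R (primitive a b z) = primitive a b (R z) + l2_scale c (one_on a b)"
begin

abbreviation "H \<equiv> \<lambda>k. sobolev k a b :: 'a L2 set"
abbreviation "H0 \<equiv> \<lambda>k. sobolev0 k a b :: 'a L2 set"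
abbreviation "J \<equiv> primitive a b :: 'a L2 \<Rightarrow> 'a L2"
abbreviation "I \<equiv> l2_integral a b :: 'a L2 \<Rightarrow> 'a"
abbreviation "e \<equiv> one_on a b :: 'a L2"

lemma H0_L2_on: "z \<in> H0 k \<Longrightarrow> z \<in> L2_on a b"
  by (rule subsetD[OF sobolev0_subset_L2_on])

lemma L2_on_add: "u \<in> L2_on a b \<Longrightarrow> v \<in> L2_on a b \<Longrightarrow> u + v \<in> L2_on a b"
  by (rule l2.subspace_add[OF subspace_L2_on])

lemma L2_on_scale: "u \<in> L2_on a b \<Longrightarrow> l2_scale c u \<in> L2_on a b"
  by (rule l2.subspace_scale[OF subspace_L2_on])

lemma L2_on_diff: "u \<in> L2_on a b \<Longrightarrow> v \<in> L2_on a b \<Longrightarrow> u - v \<in> L2_on a b"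
  by (rule l2.subspace_diff[OF subspace_L2_on])

lemma R_0: "R 0 = 0"
  using R_scale[OF R_in, of 0] by simp

lemma R_diff: "u \<in> L2_on a b \<Longrightarrow> v \<in> L2_on a b \<Longrightarrow> R (u - v) = R u - R v"
  using R_add[OF L2_on_diff, of u v v] by simp

lemma R_eq_0_iff:
  assumes "u \<in> L2_on a b"
  shows "R u = 0 \<longleftrightarrow> u = 0"
proof
  assume "R u = 0"
  then have "u = T (R 0)"
    using T_R[OF assms] by (simp add: R_0)
  then show "u = 0"
    using T_R[OF l2.subspace_0[OF subspace_L2_on]] by simp
qed (simp add: R_0)

lemma T_add:
  assumes "u \<in> L2_on a b" "v \<in> L2_on a b"
  shows "T (u + v) = T u + T v"
  using T_R[OF L2_on_add[OF T_in T_in], of u v] assms by (simp add: R_add T_in R_T)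

lemma T_scale:
  assumes "u \<in> L2_on a b"
  shows "T (l2_scale c u) = l2_scale c (T u)"
  using T_R[OF L2_on_scale[OF T_in], of c u] assms by (simp add: R_scale T_in R_T)

lemma R_image_subspace:
  assumes "l2.subspace W" "W \<subseteq> L2_on a b"
  shows "l2.subspace (R ` W)"
proof (rule l2.subspaceI)
  show "(0 :: 'a L2) \<in> R ` W"
    using l2.subspace_0[OF assms(1)] by (rule image_eqI[of _ R 0, OF R_0[symmetric]])
  fix u v :: "'a L2" and c
  assume "u \<in> R ` W"
  then obtain x where x: "u = R x" "x \<in> W" by blast
  then have "l2_scale c u = R (l2_scale c x)"
    using assms(2) by (simp add: R_scale subset_iff)
  then show "l2_scale c u \<in> R ` W"
    using l2.subspace_scale[OF assms(1) x(2)] by blast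
  assume "v \<in> R ` W"
  then obtain y where y: "v = R y" "y \<in> W" by blast
  then have "u + v = R (x + y)"
    using x assms(2) by (simp add: R_add subset_iff)
  then show "u + v \<in> R ` W"
    using l2.subspace_add[OF assms(1) x(2) y(2)] by blast
qed

text \<open>The constants of integration destroy the boundary conditions, so the target is
  \<open>H k\<close> and not \<open>H0 k\<close>.\<close>

lemma R_maps_H0_H: "z \<in> H0 k \<Longrightarrow> R z \<in> H k"
proof (induction k arbitrary: z)
  case 0
  then show ?case
    by (simp add: sobolev_0 R_in)
next
  case (Suc k)
  then obtain y where y: "z = J y" "y \<in> H0 k" "I y = 0"
    by (auto simp: sobolev0_Suc[OF less])
  then obtain c where "R z = J (R y) + l2_scale c e"
    using R_primitive[OF H0_L2_on[OF y(2)] y(3)] by blast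
  then show ?case
    using primitive_plus_const_in_sobolev_iff[OF less R_in, of y c k] Suc.IH[OF y(2)] by simp
qed

text \<open>One constant serves all orders: each weak derivative of \<open>R z\<close> up to order
  \<open>k\<close> is \<open>R\<close> applied to that of \<open>z\<close>, and the squared norm is
  the sum of their squared norms.\<close>

lemma R_sobolev_bound:
  assumes C: "\<And>u. u \<in> L2_on a b \<Longrightarrow> l2_norm (R u) \<le> C * l2_norm u" and "C \<ge> 0" and "z \<in> H0 k"
  shows "sobolev_norm k a b (R z) \<le> C * sobolev_norm k a b z"
  using assms(3)
proof (induction k arbitrary: z)
  case 0
  then show ?case
    using C by (simp add: sobolev0_0 sobolev_norm_0 R_in)
next
  case (Suc k)
  then obtain y where y: "z = J y" "y \<in> H0 k" "I y = 0"
    by (auto simp: sobolev0_Suc[OF less])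
  then obtain c where Rz: "R z = J (R y) + l2_scale c e"
    using R_primitive[OF H0_L2_on[OF y(2)] y(3)] by blast
  have z: "z = J y + l2_scale 0 e"
    by (simp add: y)
  have "(sobolev_norm (Suc k) a b (R z))\<^sup>2 = (l2_norm (R z))\<^sup>2 + (sobolev_norm k a b (R y))\<^sup>2"
    unfolding Rz by (rule sobolev_norm_Suc_primitive[OF less])
  also have "\<dots> \<le> (C * l2_norm z)\<^sup>2 + (C * sobolev_norm k a b y)\<^sup>2"
    using C[OF H0_L2_on[OF Suc.prems]] Suc.IH[OF y(2)]
    by (intro add_mono power_mono l2_norm_nonneg sobolev_norm_nonneg)
  also have "\<dots> = C\<^sup>2 * ((l2_norm z)\<^sup>2 + (sobolev_norm k a b y)\<^sup>2)"
    by (simp add: power_mult_distrib distrib_left)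
  also have "(l2_norm z)\<^sup>2 + (sobolev_norm k a b y)\<^sup>2 = (sobolev_norm (Suc k) a b z)\<^sup>2"
    unfolding z by (rule sobolev_norm_Suc_primitive[OF less, symmetric])
  finally show ?case
    by (intro power2_le_imp_le[OF _ mult_nonneg_nonneg[OF \<open>C \<ge> 0\<close> sobolev_norm_nonneg]])
      (simp only: power_mult_distrib)
qed

text \<open>Convergence of the preimages is obtained in the \<open>L2\<close> norm, where
  \<open>T\<close> is bounded. The integral and the primitive are continuous in that norm, so
  mean-zero conditions survive the limit.\<close>

lemma limit_of_preimages:
  assumes "\<And>n. y n \<in> L2_on a b" "z \<in> L2_on a b" "(\<lambda>n. sobolev_norm k a b (R (y n) - R z)) \<longlonglongrightarrow> 0"
  shows "(\<lambda>n. l2_norm (y n - z)) \<longlonglongrightarrow> 0"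
proof -
  obtain C where C: "\<And>u. u \<in> L2_on a b \<Longrightarrow> l2_norm (T u) \<le> C * l2_norm u"
    using T_bounded by blast
  have "l2_norm (y n - z) \<le> \<bar>C\<bar> * sobolev_norm k a b (R (y n) - R z)" for n
  proof -
    have "y n - z = T (R (y n) - R z)"
      using assms by (simp add: T_R L2_on_diff flip: R_diff)
    then have "l2_norm (y n - z) \<le> C * l2_norm (R (y n) - R z)"
      using C[OF L2_on_diff[OF R_in R_in]] by simp
    also have "\<dots> \<le> \<bar>C\<bar> * l2_norm (R (y n) - R z)"
      by (intro mult_right_mono l2_norm_nonneg) simp
    also have "\<dots> \<le> \<bar>C\<bar> * sobolev_norm k a b (R (y n) - R z)"
      by (intro mult_left_mono l2_norm_le_sobolev_norm L2_on_diff R_in) simp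
    finally show ?thesis .
  qed
  then show ?thesis
    by (rule null_sequence_bound[OF l2_norm_nonneg _ assms(3)])
qed

lemma R_limit:
  assumes "\<And>n. y n \<in> L2_on a b" "z \<in> L2_on a b" "(\<lambda>n. l2_norm (y n - z)) \<longlonglongrightarrow> 0"
  shows "(\<lambda>n. l2_norm (R (y n) - R z)) \<longlonglongrightarrow> 0"
proof -
  obtain C where C: "\<And>u. u \<in> L2_on a b \<Longrightarrow> l2_norm (R u) \<le> C * l2_norm u"
    using R_bounded by blast
  have "l2_norm (R (y n) - R z) \<le> C * l2_norm (y n - z)" for n
    using C[OF L2_on_diff, of "y n" z] assms by (simp add: R_diff)
  then show ?thesis
    by (rule null_sequence_bound[OF l2_norm_nonneg _ assms(3)])
qed

text \<open>Differentiation lowers the order, and the induction hypothesis identifies the limit of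
  the derivatives as \<open>R z\<close>. The constant of integration in \<open>g\<close> is
  recovered indirectly: in \<open>L2\<close> the sequence \<open>R (y n)\<close> converges both to
  \<open>g\<close> and to \<open>R (J z)\<close>.\<close>

lemma R_H0_closed:
  assumes "\<And>n. y n \<in> H0 k" "g \<in> H k" "(\<lambda>n. sobolev_norm k a b (R (y n) - g)) \<longlonglongrightarrow> 0"
  shows "g \<in> R ` H0 k"
  using assms
proof (induction k arbitrary: y g)
  case 0
  then show ?case
    using R_T[of g] T_in[of g] by (auto simp: sobolev_0 sobolev0_0 intro!: image_eqI[of _ _ "T g"])
next
  case (Suc k)
  have "\<forall>n. \<exists>x. x \<in> H0 k \<and> I x = 0 \<and> y n = J x"
    using Suc.prems(1) by (auto simp: sobolev0_Suc[OF less])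
  from choice[OF this] obtain x
    where x: "\<And>n. x n \<in> H0 k" "\<And>n. I (x n) = 0" "\<And>n. y n = J (x n)"
    by blast
  obtain g' c where g: "g' \<in> H k" "g = J g' + l2_scale c e"
    using sobolev_SucE[OF less Suc.prems(2)] by blast
  have "sobolev_norm k a b (R (x n) - g') \<le> 1 * sobolev_norm (Suc k) a b (R (y n) - g)" for n
  proof -
    obtain d where "R (y n) = J (R (x n)) + l2_scale d e"
      using R_primitive[OF H0_L2_on[OF x(1)] x(2)] x(3) by auto
    then have "R (y n) - g = J (R (x n) - g') + l2_scale (d - c) e"
      by (simp add: g primitive_diff l2.scale_left_diff_distrib)
    then show ?thesis
      using sobolev_norm_le_Suc_primitive[OF less] by simp
  qed
  then have lim: "(\<lambda>n. sobolev_norm k a b (R (x n) - g')) \<longlonglongrightarrow> 0"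
    by (rule null_sequence_bound[OF sobolev_norm_nonneg _ Suc.prems(3)])
  then obtain z where z: "z \<in> H0 k" "g' = R z"
    using Suc.IH[of x, OF x(1) g(1)] by blast
  have xz: "(\<lambda>n. l2_norm (x n - z)) \<longlonglongrightarrow> 0"
    using limit_of_preimages[of x, OF H0_L2_on[OF x(1)] H0_L2_on[OF z(1)]] lim z(2) by blast
  have "I z = 0"
    using x(2) xz by (rule l2_integral_eq_0_limit)
  moreover have "g = R (J z)"
  proof (rule l2_limit_unique)
    show "(\<lambda>n. l2_norm (R (y n) - g)) \<longlonglongrightarrow> 0"
    proof (rule null_sequence_bound[OF l2_norm_nonneg _ Suc.prems(3)])
      show "l2_norm (R (y n) - g) \<le> 1 * sobolev_norm (Suc k) a b (R (y n) - g)" for n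
        using Suc.prems(2) sobolev_subset_L2_on
        by (simp, intro l2_norm_le_sobolev_norm L2_on_diff R_in) blast
    qed
    show "(\<lambda>n. l2_norm (R (y n) - R (J z))) \<longlonglongrightarrow> 0"
      using primitive_limit[OF xz] unfolding x(3) by (intro R_limit primitive_in_L2_on)
  qed
  ultimately show ?case
    using z(1) by (auto simp: sobolev0_Suc[OF less])
qed

lemma R_image_restrict: "R ` {z \<in> H0 k. P z} = {x \<in> R ` H0 k. P (T x)}"
  by (auto simp: T_R[OF H0_L2_on[of _ k]])

text \<open>The weak derivative carries the image at order \<open>Suc k\<close> onto the part of the
  image at order \<open>k\<close> where \<open>I (T x) = 0\<close>.
  \<open>quotient_basis_kernel\<close> counts this restriction, and
  \<open>quotient_basis_lift\<close> counts the kernel of the derivative.\<close>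

lemma R_H0_codim:
  "\<exists>B. finite B \<and> card B = 2 * k \<and> l2.quotient_basis (R ` H0 k) (H k) B"
proof (induction k)
  case 0
  have "u \<in> R ` L2_on a b" if "u \<in> L2_on a b" for u
    using R_T[OF that] T_in[of u] by (intro image_eqI[of _ _ "T u"]) simp_all
  then have "R ` L2_on a b = L2_on a b"
    using R_in by blast
  moreover have "0 \<in> L2_on a b"
    by (rule l2.subspace_0[OF subspace_L2_on])
  ultimately show ?case
    by (intro exI[of _ "{}"])
      (auto simp: sobolev_0 sobolev0_0 l2.quotient_basis_def l2.independent_empty intro: l2.span_base)
next
  case (Suc k)
  then obtain B where B: "finite B" "card B = 2 * k" "l2.quotient_basis (R ` H0 k) (H k) B"
    by blast
  let ?U = "R ` H0 k" and ?D = "weak_deriv a b 1" and ?U' = "R ` H0 (Suc k)"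
  have U: "l2.subspace ?U" and U': "l2.subspace ?U'"
    by (rule R_image_subspace[OF subspace_sobolev0[OF less] sobolev0_subset_L2_on])+
  have U_H: "?U \<subseteq> H k" "?U' \<subseteq> H (Suc k)"
    using R_maps_H0_H by auto
  obtain z0 :: "'a L2" where z0: "z0 \<in> H0 k" "I z0 = 1"
    using sobolev0_integral_nonzero[OF less] by blast
  have L2: "u \<in> L2_on a b" if "u \<in> ?U" for u
    using that R_in by blast
  have ker: "R z0 \<notin> B" "l2.quotient_basis {x \<in> ?U. I (T x) = 0} (H k) (insert (R z0) B)"
    using l2.quotient_basis_kernel[OF U U_H(1) B(3), of "\<lambda>x. I (T x)" "R z0"] z0
    by (auto simp: T_add T_scale L2 l2_integral_add l2_integral_scale T_R H0_L2_on)
  have D: "?D (J g + l2_scale c e) = g" if "g \<in> L2_on a b" for g c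
    using weak_deriv_Suc_primitive[OF less, of 0 g c] weak_deriv_0[OF that] by simp
  have H_L2: "g \<in> L2_on a b" if "g \<in> H k" for g
    using that sobolev_subset_L2_on by blast
  have D_image: "?D ` ?U' = {x \<in> ?U. I (T x) = 0}"
  proof -
    have D_R: "?D (R (J g)) = R g" if "g \<in> H0 k" "I g = 0" for g
      using R_primitive[OF H0_L2_on[OF that(1)] that(2)] D[OF R_in] by auto
    have "?D ` ?U' = (\<lambda>g. ?D (R (J g))) ` {g \<in> H0 k. I g = 0}"
      unfolding sobolev0_Suc[OF less] image_image ..
    also have "\<dots> = R ` {g \<in> H0 k. I g = 0}"
      using D_R by (intro image_cong) auto
    also have "\<dots> = {x \<in> ?U. I (T x) = 0}"
      by (rule R_image_restrict)
    finally show ?thesis .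
  qed
  have "\<exists>B'. finite B' \<and> card B' = Suc (card (insert (R z0) B)) \<and> l2.quotient_basis ?U' (H (Suc k)) B'"
  proof (rule l2.quotient_basis_lift[OF subspace_sobolev[OF less] U' U_H(2)])
    fix x y :: "'a L2" and c
    assume x: "x \<in> H (Suc k)"
    obtain g d where g: "g \<in> H k" "x = J g + l2_scale d e"
      using sobolev_SucE[OF less x] by blast
    have scale: "l2_scale c x = J (l2_scale c g) + l2_scale (c * d) e"
      by (simp add: g primitive_scale l2.scale_right_distrib)
    show "?D (l2_scale c x) = l2_scale c (?D x)"
      unfolding scale D[OF L2_on_scale[OF H_L2[OF g(1)]]]
      unfolding g(2) D[OF H_L2[OF g(1)]] ..
    show "\<exists>c. x = l2_scale c e" if "?D x = 0"
      using that D[OF H_L2[OF g(1)]] g(2) by auto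
    assume y: "y \<in> H (Suc k)"
    obtain g' d' where g': "g' \<in> H k" "y = J g' + l2_scale d' e"
      using sobolev_SucE[OF less y] by blast
    have add: "x + y = J (g + g') + l2_scale (d + d') e"
      by (simp add: g g' primitive_add l2.scale_left_distrib algebra_simps)
    show "?D (x + y) = ?D x + ?D y"
      unfolding add D[OF L2_on_add[OF H_L2[OF g(1)] H_L2[OF g'(1)]]]
      unfolding g(2) g'(2) D[OF H_L2[OF g(1)]] D[OF H_L2[OF g'(1)]] ..
  next
    show "?D ` H (Suc k) = H k"
    proof (intro equalityI subsetI)
      fix u assume "u \<in> ?D ` H (Suc k)"
      then obtain x where x: "u = ?D x" "x \<in> H (Suc k)" by blast
      obtain g d where g: "g \<in> H k" "x = J g + l2_scale d e"
        using sobolev_SucE[OF less x(2)] by blast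
      then show "u \<in> H k"
        unfolding x(1) g(2) D[OF H_L2[OF g(1)]] by simp
    next
      fix g assume g: "g \<in> H k"
      then have "J g + l2_scale 0 e \<in> H (Suc k)"
        using primitive_plus_const_in_sobolev_iff[OF less H_L2] by blast
      then show "g \<in> ?D ` H (Suc k)"
        using D[OF H_L2[OF g], of 0] by (intro image_eqI[of _ _ "J g + l2_scale 0 e"]) simp_all
    qed
    have e_eq: "e = J 0 + l2_scale 1 e"
      by simp
    have zero: "(0 :: 'a L2) \<in> H k" "(0 :: 'a L2) \<in> L2_on a b"
      by (rule l2.subspace_0, rule subspace_sobolev[OF less], rule l2.subspace_0, rule subspace_L2_on)
    then show "e \<in> H (Suc k)"
      using primitive_plus_const_in_sobolev_iff[OF less zero(2), of 1 k] e_eq by simp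
    show "?D e = 0"
      using D[OF zero(2), of 1] e_eq by simp
    \<comment> \<open>If \<open>e = R (J g)\<close>, uniqueness of the representation as primitive
      plus constant forces \<open>R g = 0\<close>; hence \<open>g = 0\<close> and
      \<open>e = 0\<close>, a contradiction.\<close>
    show "e \<notin> ?U'"
    proof
      assume "e \<in> ?U'"
      then obtain g where g: "g \<in> H0 k" "I g = 0" "e = R (J g)"
        by (auto simp: sobolev0_Suc[OF less])
      then obtain c where "e = J (R g) + l2_scale c e"
        using R_primitive[OF H0_L2_on[OF g(1)] g(2)] by auto
      then have "J 0 + l2_scale 1 e = J (R g) + l2_scale c e"
        by simp
      then have "R g = 0"
        using primitive_plus_const_inject[OF less zero(2) R_in, of 1 g c] by simp
      then have "e = 0"
        using g R_eq_0_iff H0_L2_on R_0 by simp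
      then show False
        using one_on_nonzero[OF less] by blast
    qed
    show "finite (insert (R z0) B)"
      using B by simp
    show "l2.quotient_basis (?D ` ?U') (H k) (insert (R z0) B)"
      using ker(2) by (simp only: D_image)
  qed
  then show ?case
    using B ker(1) by simp
qed

section \<open>Image, kernel, codimension and closed range of the second order operator\<close>

definition B_op :: "'a L2 \<Rightarrow> 'a L2" where
  "B_op v = - weak_deriv a b 2 (R v)"

text \<open>Each use of \<open>R_primitive\<close> leaves a constant; the outer one disappears in
  the first differentiation and the inner one in the second.\<close>

lemma B_op_primitive:
  assumes "z \<in> L2_on a b" "I z = 0" "I (J z) = 0"
  shows "B_op (J (J z)) = - R z"
proof -
  obtain c where c: "R (J (J z)) = J (R (J z)) + l2_scale c e"
    using R_primitive[OF primitive_in_L2_on assms(3)] by blast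
  obtain c' where c': "R (J z) = J (R z) + l2_scale c' e"
    using R_primitive[OF assms(1,2)] by blast
  show ?thesis
    unfolding B_op_def numeral_2_eq_2 c c' weak_deriv_Suc_primitive[OF less] weak_deriv_0[OF R_in] ..
qed

text \<open>The second derivatives of the elements of \<open>H0 (k + 2)\<close>. The two conditions
  say that \<open>z\<close> integrates to zero against all polynomials of degree at most
  one.\<close>

abbreviation "W \<equiv> \<lambda>k. {z \<in> H0 k. I z = 0 \<and> I (J z) = 0}"

lemma W_L2: "z \<in> W k \<Longrightarrow> z \<in> L2_on a b"
  using H0_L2_on[of z k] by blast

lemma H0_Suc_Suc: "H0 (k + 2) = (\<lambda>z. J (J z)) ` W k"
proof -
  have "H0 (k + 2) = J ` {g \<in> J ` {z \<in> H0 k. I z = 0}. I g = 0}"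
    by (simp add: sobolev0_Suc[OF less])
  then show ?thesis
    by auto
qed

lemma subspace_W: "l2.subspace (W k)"
  by (rule l2.subspaceI)
    (simp_all add: l2.subspace_0 l2.subspace_add l2.subspace_scale subspace_sobolev0[OF less]
      primitive_add primitive_scale l2_integral_add l2_integral_scale)

lemma B_op_image: "B_op ` H0 (k + 2) = R ` W k"
proof -
  have "B_op (J (J z)) = R (- z)" if "z \<in> W k" for z
    using B_op_primitive[OF W_L2[OF that]] R_scale[OF W_L2[OF that], of "- 1"] that
    by (simp add: l2.scale_minus_left)
  then have "B_op ` H0 (k + 2) = (\<lambda>z. R (- z)) ` W k"
    unfolding H0_Suc_Suc image_image by (rule image_cong[OF refl])
  also have "\<dots> = R ` (uminus ` W k)"
    by (simp only: image_image)
  \<comment> \<open>The sign in \<open>B_op\<close> is absorbed because \<open>W k\<close> is a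
    subspace.\<close>
  also have "uminus ` W k = W k"
  proof (intro equalityI subsetI)
    show "z \<in> uminus ` W k" if "z \<in> W k" for z
      using l2.subspace_neg[OF subspace_W that] by (intro image_eqI[of _ _ "- z"]) simp_all
  qed (use l2.subspace_neg[OF subspace_W[of k]] in blast)
  finally show ?thesis .
qed

text \<open>The two functionals are imposed one after the other, so the second has to be nonzero on
  the kernel of the first; this is the purpose of \<open>z1\<close>.\<close>

lemma R_W_codim:
  "\<exists>B. finite B \<and> card B = 2 * (k + 1) \<and> l2.quotient_basis (R ` W k) (H k) B"
proof -
  let ?U = "R ` H0 k"
  obtain B where B: "finite B" "card B = 2 * k" "l2.quotient_basis ?U (H k) B"
    using R_H0_codim by blast
  have U: "l2.subspace ?U" "?U \<subseteq> H k"
    using R_image_subspace[OF subspace_sobolev0[OF less, of k] sobolev0_subset_L2_on] R_maps_H0_H by auto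
  obtain z0 :: "'a L2" where z0: "z0 \<in> H0 k" "I z0 = 1"
    using sobolev0_integral_nonzero[OF less] by blast
  \<comment> \<open>\<open>z1\<close> is the derivative of an element of \<open>H0 (Suc k)\<close>
    with integral one: its own integral vanishes by the boundary values, and its primitive has
    integral one.\<close>
  obtain z1 where z1: "z1 \<in> H0 k" "I z1 = 0" "I (J z1) = 1"
  proof -
    obtain y :: "'a L2" where "y \<in> H0 (Suc k)" "I y = 1"
      using sobolev0_integral_nonzero[OF less] by blast
    then show thesis
      using that by (auto simp: sobolev0_Suc[OF less])
  qed
  have L2: "u \<in> L2_on a b" if "u \<in> ?U" for u
    using that R_in by blast
  have 1: "R z0 \<notin> B" "l2.quotient_basis {x \<in> ?U. I (T x) = 0} (H k) (insert (R z0) B)"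
    using l2.quotient_basis_kernel[OF U B(3), of "\<lambda>x. I (T x)" "R z0"] z0
    by (auto simp: T_add T_scale L2 l2_integral_add l2_integral_scale T_R H0_L2_on)
  let ?U1 = "{x \<in> ?U. I (T x) = 0}"
  have "l2.subspace (R ` {z \<in> H0 k. I z = 0})"
  proof (rule R_image_subspace)
    show "l2.subspace {z \<in> H0 k. I z = 0}"
      by (rule l2.subspaceI)
        (simp_all add: l2.subspace_0 l2.subspace_add l2.subspace_scale subspace_sobolev0[OF less]
          l2_integral_add l2_integral_scale)
  qed (use H0_L2_on[of _ k] in blast)
  then have U1: "l2.subspace ?U1" "?U1 \<subseteq> H k"
    using U(2) by (auto simp only: R_image_restrict)
  have 2: "R z1 \<notin> insert (R z0) B"
    "l2.quotient_basis {x \<in> ?U1. I (J (T x)) = 0} (H k) (insert (R z1) (insert (R z0) B))"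
    using l2.quotient_basis_kernel[OF U1 1(2), of "\<lambda>x. I (J (T x))" "R z1"] z1
    by (auto simp: T_add T_scale L2 l2_integral_add l2_integral_scale primitive_add primitive_scale T_R H0_L2_on)
  have "{x \<in> ?U1. I (J (T x)) = 0} = R ` W k"
    unfolding R_image_restrict by auto
  then show ?thesis
    using 1 2 B by (intro exI[of _ "insert (R z1) (insert (R z0) B)"]) simp
qed

lemma B_op_codim: "l2.codim (B_op ` H0 (k + 2)) (H k) = 2 * (k + 1)"
proof -
  obtain B where B: "finite B" "card B = 2 * (k + 1)" "l2.quotient_basis (R ` W k) (H k) B"
    using R_W_codim by blast
  have "l2.subspace (R ` W k)"
    using H0_L2_on by (intro R_image_subspace subspace_W) auto
  then show ?thesis
    unfolding B_op_image using l2.codim_eq_card[OF _ B(1,3)] B(2) by simp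
qed

lemma B_op_kernel: "l2.kernel_on (H0 (k + 2)) B_op = {0}"
proof -
  have "v = 0" if v: "v \<in> H0 (k + 2)" "B_op v = 0" for v
  proof -
    obtain z where z: "v = J (J z)" "z \<in> W k"
      using v(1) unfolding H0_Suc_Suc by blast
    moreover have "z \<in> L2_on a b"
      using z H0_L2_on[of z k] by blast
    ultimately have "R z = 0"
      using v(2) B_op_primitive[of z] by simp
    then show "v = 0"
      using z \<open>z \<in> L2_on a b\<close> by (simp add: R_eq_0_iff)
  qed
  moreover have "(0 :: 'a L2) \<in> L2_on a b"
    by (rule l2.subspace_0[OF subspace_L2_on])
  then have "B_op 0 = 0"
    using B_op_primitive[of 0] R_0 by simp
  ultimately show ?thesis
    using l2.subspace_0[OF subspace_sobolev0[OF less]] by (auto simp: l2.kernel_on_def)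
qed

lemma B_op_bounded:
  "l2.bounded_between (H0 (k + 2)) (sobolev_norm (k + 2) a b) (H k) (sobolev_norm k a b) B_op"
proof -
  have rep: "\<exists>z\<in>W k. v = J (J z)" if "v \<in> H0 (k + 2)" for v
    using that unfolding H0_Suc_Suc by blast
  have B: "B_op (J (J z)) = - R z" if "z \<in> W k" for z
    using that B_op_primitive[OF W_L2[OF that]] by blast
  have "l2.linear_between (H0 (k + 2)) (H k) B_op"
    unfolding l2.linear_between_def
  proof (intro conjI ballI allI)
    show "B_op ` H0 (k + 2) \<subseteq> H k"
      unfolding B_op_image using R_maps_H0_H by auto
    fix u c assume "u \<in> H0 (k + 2)"
    then obtain y where y: "y \<in> W k" "u = J (J y)"
      using rep by blast
    have "l2_scale c y \<in> W k"
      using l2.subspace_scale[OF subspace_W y(1)] .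
    from B[OF this] show "B_op (l2_scale c u) = l2_scale c (B_op u)"
      using y W_L2[OF y(1)] by (simp add: primitive_scale R_scale B)
    fix v assume "v \<in> H0 (k + 2)"
    then obtain z where z: "z \<in> W k" "v = J (J z)"
      using rep by blast
    have "y + z \<in> W k"
      using l2.subspace_add[OF subspace_W y(1) z(1)] .
    from B[OF this] show "B_op (u + v) = B_op u + B_op v"
      using y z W_L2[OF y(1)] W_L2[OF z(1)] by (simp add: primitive_add R_add B)
  qed
  moreover have "\<exists>C. \<forall>v\<in>H0 (k + 2). sobolev_norm k a b (B_op v) \<le> C * sobolev_norm (k + 2) a b v"
  proof -
    obtain C where C: "\<And>u. u \<in> L2_on a b \<Longrightarrow> l2_norm (R u) \<le> C * l2_norm u"
      using R_bounded by blast
    have C': "l2_norm (R u) \<le> \<bar>C\<bar> * l2_norm u" if "u \<in> L2_on a b" for u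
      using C[OF that] mult_right_mono[OF abs_ge_self[of C] l2_norm_nonneg[of u]] by linarith
    have "sobolev_norm k a b (B_op v) \<le> \<bar>C\<bar> * sobolev_norm (k + 2) a b v" if "v \<in> H0 (k + 2)" for v
    proof -
      obtain z where z: "z \<in> W k" "v = J (J z)"
        using rep \<open>v \<in> H0 (k + 2)\<close> by blast
      have "sobolev_norm k a b (B_op v) = sobolev_norm k a b (R z)"
        using z sobolev_norm_uminus[OF less R_maps_H0_H[of z k]] B by simp
      also have "\<dots> \<le> \<bar>C\<bar> * sobolev_norm k a b z"
        using z by (intro R_sobolev_bound C') auto
      also have "sobolev_norm k a b z \<le> sobolev_norm (Suc (Suc k)) a b (J (J z))"
        using sobolev_norm_le_Suc_primitive[OF less, of k z 0]
          sobolev_norm_le_Suc_primitive[OF less, of "Suc k" "J z" 0] by simp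
      finally show ?thesis
        using z by (simp add: mult_left_mono)
    qed
    then show ?thesis
      by blast
  qed
  ultimately show ?thesis
    by (simp add: l2.bounded_between_def)
qed

text \<open>\<open>R_H0_closed\<close> writes the limit as \<open>R z\<close>, and both integral
  conditions pass to \<open>z\<close> since the preimages converge in \<open>L2\<close>.\<close>

lemma B_op_closed: "l2.norm_closed_in (B_op ` H0 (k + 2)) (H k) (sobolev_norm k a b)"
  unfolding l2.norm_closed_in_def B_op_image
proof (intro allI impI, elim conjE)
  fix w :: "nat \<Rightarrow> 'a L2" and g :: "'a L2"
  assume w: "\<forall>n. w n \<in> R ` W k" and g: "g \<in> H k"
    and lim: "(\<lambda>n. sobolev_norm k a b (w n - g)) \<longlonglongrightarrow> 0"
  have "\<forall>n. \<exists>z. z \<in> W k \<and> w n = R z"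
    using w by blast
  from choice[OF this] obtain y where y: "\<And>n. y n \<in> W k" "\<And>n. w n = R (y n)"
    by blast
  then have y_H0: "y n \<in> H0 k" for n
    by blast
  obtain z where z: "z \<in> H0 k" "g = R z"
    using R_H0_closed[of y, OF y_H0 g] lim y(2) by auto
  have yz: "(\<lambda>n. l2_norm (y n - z)) \<longlonglongrightarrow> 0"
    using limit_of_preimages[of y, OF H0_L2_on[OF y_H0] H0_L2_on[OF z(1)], of k] lim by (simp add: y(2) z(2))
  have "I z = 0"
    using y(1) by (intro l2_integral_eq_0_limit[OF _ yz]) blast
  moreover have "I (J z) = 0"
    using y(1) by (intro l2_integral_eq_0_limit[OF _ primitive_limit[OF yz]]) blast
  ultimately show "g \<in> R ` W k"
    using z by blast
qed

theorem B_op_fredholm: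
  "l2.fredholm (H0 (k + 2)) (sobolev_norm (k + 2) a b) (H k) (sobolev_norm k a b) B_op"
proof -
  have "l2.finite_dim (l2.kernel_on (H0 (k + 2)) B_op)"
    unfolding B_op_kernel l2.finite_dim_def by (intro exI[of _ "{}"]) simp
  moreover have "l2.finite_codim (B_op ` H0 (k + 2)) (H k)"
    unfolding B_op_image l2.finite_codim_def using R_W_codim by blast
  ultimately show ?thesis
    using B_op_bounded B_op_closed by (simp add: l2.fredholm_def)
qed

end

section \<open>The difference operator as an instance\<close>

lemma R_Q_derivative_commuting:
  assumes "Determinant.det (R_1 N b) \<noteq> 0"
  obtains T where "derivative_commuting 0 (real N + 1) (R_Q N b) T"
proof -
  let ?M = "\<lambda>i k. b (int k - int i)"
  show thesis
  proof (rule nonsingular_R_1_inverse[OF assms])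
    fix S assume S:
      "\<And>i l. i < Suc N \<Longrightarrow> l < Suc N \<Longrightarrow> (\<Sum>k<Suc N. ?M i k * S k l) = (if i = l then 1 else 0)"
      "\<And>i l. i < Suc N \<Longrightarrow> l < Suc N \<Longrightarrow> (\<Sum>k<Suc N. S i k * ?M k l) = (if i = l then 1 else 0)"
    \<comment> \<open>\<open>T\<close> is the operator of the inverse matrix. Both operators act
      through matrices on the unit pieces, so the two inverse laws reduce to the matrix identities
      \<open>S\<close>.\<close>
    have "derivative_commuting 0 (real N + 1) (R_Q N b) (mat_op N S :: 'a L2 \<Rightarrow> 'a L2)"
    proof
      show "R_Q N b u \<in> L2_on 0 (real N + 1)" for u :: "'a L2"
        unfolding R_Q_def by (rule l2_restrict_in_L2_on)
      show "mat_op N S u \<in> L2_on 0 (real N + 1)" for u :: "'a L2"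
        by (rule mat_op_in_L2_on)
      fix u :: "'a L2" assume u: "u \<in> L2_on 0 (real N + 1)"
      show "mat_op N S (R_Q N b u) = u"
        unfolding R_Q_eq_mat_op[OF u] mat_op_mult by (rule mat_op_id[OF u S(2)])
      show "R_Q N b (mat_op N S u) = u"
        unfolding R_Q_eq_mat_op[OF mat_op_in_L2_on] mat_op_mult by (rule mat_op_id[OF u S(1)])
      show "R_Q N b (l2_scale c u) = l2_scale c (R_Q N b u)" for c
        unfolding R_Q_eq_mat_op[OF u] R_Q_eq_mat_op[OF l2.subspace_scale[OF subspace_L2_on u]]
        by (rule mat_op_scale)
      show "\<exists>c. R_Q N b (primitive 0 (real N + 1) u) =
          primitive 0 (real N + 1) (R_Q N b u) + l2_scale c (one_on 0 (real N + 1))"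
        if "l2_integral 0 (real N + 1) u = 0"
        using u that by (rule R_Q_primitive)
      fix v :: "'a L2" assume v: "v \<in> L2_on 0 (real N + 1)"
      show "R_Q N b (u + v) = R_Q N b u + R_Q N b v"
        unfolding R_Q_eq_mat_op[OF u] R_Q_eq_mat_op[OF v] R_Q_eq_mat_op[OF l2.subspace_add[OF subspace_L2_on u v]]
        by (rule mat_op_add)
    next
      obtain C where "\<forall>u :: 'a L2. l2_norm (mat_op N ?M u) \<le> C * l2_norm u"
        using mat_op_bounded by blast
      then show "\<exists>C. \<forall>u\<in>L2_on 0 (real N + 1) :: 'a L2 set. l2_norm (R_Q N b u) \<le> C * l2_norm u"
        by (intro exI[of _ C] ballI) (simp add: R_Q_eq_mat_op)
      show "\<exists>C. \<forall>u\<in>L2_on 0 (real N + 1) :: 'a L2 set. l2_norm (mat_op N S u) \<le> C * l2_norm u"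
        using mat_op_bounded[of N S, where 'a = 'a] by blast
    qed simp
    then show thesis
      by (rule that)
  qed
qed

theorem theorem6:
  fixes N k :: nat and b :: "int \<Rightarrow> real"
  assumes "N \<ge> 1"
    and "Determinant.det (R_1 N b) \<noteq> 0"
    and "Determinant.det (R_2 N b) = 0"
  shows "l2.fredholm
           (sobolev0 (k + 2) 0 (real N + 1)) (sobolev_norm (k + 2) 0 (real N + 1))
           (sobolev k 0 (real N + 1)) (sobolev_norm k 0 (real N + 1))
           (B_R N b :: 'a::{real_normed_field,euclidean_space} L2 \<Rightarrow> 'a L2)
       \<and> l2.dim (l2.kernel_on (sobolev0 (k + 2) 0 (real N + 1))
           (B_R N b :: 'a L2 \<Rightarrow> 'a L2)) = 0
       \<and> l2.codim ((B_R N b :: 'a L2 \<Rightarrow> 'a L2) ` sobolev0 (k + 2) 0 (real N + 1))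
           (sobolev k 0 (real N + 1)) = 2 * (k + 1)"
proof -
  obtain T :: "'a L2 \<Rightarrow> 'a L2" where "derivative_commuting 0 (real N + 1) (R_Q N b) T"
    by (rule R_Q_derivative_commuting[OF assms(2)])
  then interpret derivative_commuting 0 "real N + 1" "R_Q N b :: 'a L2 \<Rightarrow> 'a L2" T .
  have "B_op = B_R N b"
    by (simp add: fun_eq_iff B_op_def B_R_def)
  moreover have "l2.dim {0 :: 'a L2} = 0"
    using l2.dim_eq_card[of "{}" "{0}"] by (simp add: l2.independent_empty)
  ultimately show ?thesis
    using B_op_fredholm[of k] B_op_kernel[of k] B_op_codim[of k] by simp
qed

end
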